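(* Let $1\le k\le n-1$ and let $\Delta(k,n)$ be the hypersimplex. The split complex $\mathrm{Split}(\Delta(k,n))$ is a polytopal subcomplex of the tropical pre-Grassmannian $\mathcal{G}'_{k,n}$ (the spherical polytopal complex obtained by intersecting the fan of weight functions on $\Delta(k,n)$ that induce regular matroid subdivisions with the unit sphere, modulo the lineality space of affine functions). In particular, for every compatible set $\mathcal S$ of splits of $\Delta(k,n)$, all maximal cells of the regular subdivision induced by the weight function $\sum_{S\in\mathcal S} w_S$ are matroid polytopes.
   Context: The $k$-th hypersimplex is $\Delta(k,n)=\{x\in[0,1]^n:\sum_i x_i=k\}=\mathrm{conv}\{\sum_{i\in A}e_i: A\subseteq[n],\#A=k\}$. A weight function is a map $w$ from the vertex set of a polytope $P$ to $\mathbb R$; it induces the regular subdivision of $P$ obtained by projecting the lower faces of the convex hull of the lifted vertices $(v,w(v))$ (only vertices of $P$ are used as vertices of the subdivision). The secondary fan of $P$ is the fan whose cones are the closures of the sets of weight functions inducing the same subdivision; its lineality space consists of the (restrictions of) affine functions. A split of $P$ is a subdivision of $P$ without new vertices having exactly two maximal cells $S_+,S_-$; for $P=\Delta(k,n)$ (whose affine hull misses the origin) the split hyperplane $H_S$ is the linear span of $S_+\cap S_-$. The split weight $w_S$ is $w_S(v)=|a\cdot v|$ for $v\in S_+$ and $w_S(v)=0$ for $v\in S_-$, where $a$ is a normal vector of $H_S$; it induces $S$. Two splits $S_1,S_2$ are compatible if $H_{S_1}\cap H_{S_2}$ does not meet the interior of $P$; a set of splits is compatible if any two of its members are. The split complex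 $\mathrm{Split}(P)$ is the abstract simplicial complex on the set of splits of $P$ whose faces are the compatible sets; a face $\mathcal S$ is realized by the cone spanned by $\{w_S:S\in\mathcal S\}$ in the secondary fan (intersected with the unit sphere). A matroid polytope is the convex hull of the characteristic vectors of the bases of a matroid on $[n]$; a matroid subdivision of $\Delta(k,n)$ is a polytopal subdivision all of whose maximal cells are matroid polytopes. The tropical pre-Grassmannian fan is the subfan of the secondary fan of $\Delta(k,n)$ consisting of the weight functions that induce matroid subdivisions. *)

theory Defs
  imports "HOL-Analysis.Analysis"
begin

section \<open>Subdivisions and splits of a polytope\<close>

definition vertices :: "'a::euclidean_space set \<Rightarrow> 'a set" where
  "vertices P = {v. v extreme_point_of P}"

text \<open>As in the library, the empty set is a face of every convex set, so a subdivision always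
  contains the empty cell.\<close>

definition polytopal_subdivision :: "'a::euclidean_space set \<Rightarrow> 'a set set \<Rightarrow> bool" where
  "polytopal_subdivision P \<Sigma> \<longleftrightarrow>
     finite \<Sigma> \<and> \<Union>\<Sigma> = P \<and> (\<forall>C\<in>\<Sigma>. polytope C) \<and>
     (\<forall>C\<in>\<Sigma>. \<forall>F. F face_of C \<longrightarrow> F \<in> \<Sigma>) \<and>
     (\<forall>C\<in>\<Sigma>. \<forall>D\<in>\<Sigma>. (C \<inter> D) face_of C \<and> (C \<inter> D) face_of D)"

definition maximal_cells :: "'a set set \<Rightarrow> 'a set set" where
  "maximal_cells \<Sigma> = {C\<in>\<Sigma>. \<forall>D\<in>\<Sigma>. C \<subseteq> D \<longrightarrow> D = C}"

definition is_split :: "'a::euclidean_space set \<Rightarrow> 'a set set \<Rightarrow> bool" where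
  "is_split P S \<longleftrightarrow>
     polytopal_subdivision P S \<and> (\<forall>C\<in>S. vertices C \<subseteq> vertices P) \<and>
     card (maximal_cells S) = 2"

text \<open>The linear span of the intersection of the two maximal cells. This is the split hyperplane
  if the affine hull of the polytope is a hyperplane that misses the origin.\<close>

definition split_hyperplane :: "'a::euclidean_space set set \<Rightarrow> 'a set" where
  "split_hyperplane S = span (\<Inter>(maximal_cells S))"

text \<open>\<open>split_weight P S \<omega>\<close>: on the vertices of \<open>P\<close>, \<open>\<omega>\<close> is the split weight of \<open>S\<close> for some choice
  of the normal vector \<open>a\<close> and of the names \<open>Sp\<close>, \<open>Sm\<close> of the two maximal cells.\<close>

definition split_weight ::
  "'a::euclidean_space set \<Rightarrow> 'a set set \<Rightarrow> ('a \<Rightarrow> real) \<Rightarrow> bool" where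
  "split_weight P S \<omega> \<longleftrightarrow>
     (\<exists>Sp Sm a. maximal_cells S = {Sp, Sm} \<and> Sp \<noteq> Sm \<and>
        a \<noteq> 0 \<and> split_hyperplane S = {x. a \<bullet> x = 0} \<and>
        (\<forall>v\<in>vertices P. (v \<in> Sp \<longrightarrow> \<omega> v = \<bar>a \<bullet> v\<bar>) \<and> (v \<in> Sm \<longrightarrow> \<omega> v = 0)))"

definition compatible_splits ::
  "'a::euclidean_space set \<Rightarrow> 'a set set \<Rightarrow> 'a set set \<Rightarrow> bool" where
  "compatible_splits P S T \<longleftrightarrow>
     split_hyperplane S \<inter> split_hyperplane T \<inter> rel_interior P = {}"

definition split_complex :: "'a::euclidean_space set \<Rightarrow> 'a set set set set" where
  "split_complex P =
     {\<S>. (\<forall>S\<in>\<S>. is_split P S) \<and> pairwise (compatible_splits P) \<S>}"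


section \<open>Regular subdivisions\<close>

definition lifted_polytope ::
  "'a::euclidean_space set \<Rightarrow> ('a \<Rightarrow> real) \<Rightarrow> ('a \<times> real) set" where
  "lifted_polytope P \<omega> = convex hull ((\<lambda>v. (v, \<omega> v)) ` vertices P)"

text \<open>A lower face is cut out by a supporting hyperplane with a normal vector pointing upwards,
  normalised here to have last coordinate 1.\<close>

definition lower_faces :: "('a::euclidean_space \<times> real) set \<Rightarrow> ('a \<times> real) set set" where
  "lower_faces Q =
     {F. \<exists>y c. (\<forall>q\<in>Q. c \<le> (y, 1) \<bullet> q) \<and> F = {q\<in>Q. (y, 1) \<bullet> q = c}}"

definition regular_subdivision ::
  "'a::euclidean_space set \<Rightarrow> ('a \<Rightarrow> real) \<Rightarrow> 'a set set" where
  "regular_subdivision P \<omega> = (\<lambda>F. fst ` F) ` lower_faces (lifted_polytope P \<omega>)"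


section \<open>Hypersimplices and matroid subdivisions\<close>

definition hypersimplex :: "nat \<Rightarrow> (real^'n) set" where
  "hypersimplex k = {x. (\<forall>i. 0 \<le> x $ i \<and> x $ i \<le> 1) \<and> (\<Sum>i\<in>UNIV. x $ i) = real k}"

definition char_vec :: "'n set \<Rightarrow> real^'n" where
  "char_vec A = (\<chi> i. if i \<in> A then 1 else 0)"

definition matroid_bases :: "'n set set \<Rightarrow> bool" where
  "matroid_bases \<B> \<longleftrightarrow> \<B> \<noteq> {} \<and>
     (\<forall>A\<in>\<B>. \<forall>B\<in>\<B>. \<forall>a\<in>A - B. \<exists>b\<in>B - A. insert b (A - {a}) \<in> \<B>)"

definition matroid_polytope :: "(real^'n) set \<Rightarrow> bool" where
  "matroid_polytope C \<longleftrightarrow> (\<exists>\<B>. matroid_bases \<B> \<and> C = convex hull (char_vec ` \<B>))"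

definition matroid_subdivision :: "nat \<Rightarrow> (real^'n) set set \<Rightarrow> bool" where
  "matroid_subdivision k \<Sigma> \<longleftrightarrow>
     polytopal_subdivision (hypersimplex k) \<Sigma> \<and> (\<forall>C\<in>maximal_cells \<Sigma>. matroid_polytope C)"


section \<open>The secondary fan of a hypersimplex and the tropical pre-Grassmannian\<close>

text \<open>The vertices of \<open>hypersimplex k\<close> are the vectors \<open>char_vec A\<close> with \<open>card A = k\<close>. The space of
  weight functions on these vertices is represented as the coordinate subspace of
  \<open>real^('n set)\<close> given by the coordinates \<open>A\<close> with \<open>card A = k\<close>, so that the topology, the inner
  product and the unit sphere are the standard ones.\<close>

definition weight_space :: "nat \<Rightarrow> (real^('n::finite set)) set" where
  "weight_space k = {w. \<forall>A. card A \<noteq> k \<longrightarrow> w $ A = 0}"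

text \<open>The value of a weight at the vertex \<open>char_vec A\<close> is its coordinate \<open>A\<close>.\<close>

definition weight_fun :: "real^('n::finite set) \<Rightarrow> real^'n \<Rightarrow> real" where
  "weight_fun w v = w $ {i. v $ i = 1}"

definition induced_subdivision :: "nat \<Rightarrow> real^('n::finite set) \<Rightarrow> (real^'n) set set" where
  "induced_subdivision k w = regular_subdivision (hypersimplex k) (weight_fun w)"

definition secondary_cone :: "nat \<Rightarrow> real^('n::finite set) \<Rightarrow> (real^('n set)) set" where
  "secondary_cone k w =
     closure {w' \<in> weight_space k. induced_subdivision k w' = induced_subdivision k w}"

definition lineality :: "nat \<Rightarrow> (real^('n::finite set)) set" where
  "lineality k = {w \<in> weight_space k.
     \<exists>(c :: real^'n) d. \<forall>A. card A = k \<longrightarrow> w $ A = c \<bullet> char_vec A + d}"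

definition secondary_fan :: "nat \<Rightarrow> (real^('n::finite set)) set set" where
  "secondary_fan k = secondary_cone k ` weight_space k"

definition pre_grassmannian_fan :: "nat \<Rightarrow> (real^('n::finite set)) set set" where
  "pre_grassmannian_fan k =
     {C \<in> secondary_fan k.
        \<exists>w\<in>weight_space k. C = secondary_cone k w \<and> matroid_subdivision k (induced_subdivision k w)}"

text \<open>The quotient by the lineality space is identified with its orthogonal complement.\<close>

definition spherical_cell ::
  "nat \<Rightarrow> (real^('n::finite set)) set \<Rightarrow> (real^('n set)) set" where
  "spherical_cell k C = C \<inter> (lineality k)\<^sup>\<bottom> \<inter> sphere 0 1"

definition pre_grassmannian :: "nat \<Rightarrow> (real^('n::finite set)) set set" where
  "pre_grassmannian k = spherical_cell k ` pre_grassmannian_fan k"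


section \<open>Spherical polytopal complexes\<close>

definition pointed_fan :: "'a::euclidean_space set set \<Rightarrow> bool" where
  "pointed_fan \<F> \<longleftrightarrow>
     finite \<F> \<and>
     (\<forall>C\<in>\<F>. polyhedron C \<and> convex_cone C \<and> (\<forall>x\<in>C. - x \<in> C \<longrightarrow> x = 0)) \<and>
     (\<forall>C\<in>\<F>. \<forall>F. F face_of C \<and> F \<noteq> {} \<longrightarrow> F \<in> \<F>) \<and>
     (\<forall>C\<in>\<F>. \<forall>D\<in>\<F>. (C \<inter> D) face_of C \<and> (C \<inter> D) face_of D)"

definition spherical_polytopal_complex :: "'a::euclidean_space set set \<Rightarrow> bool" where
  "spherical_polytopal_complex \<K> \<longleftrightarrow>
     (\<exists>\<F>. pointed_fan \<F> \<and> \<K> = (\<lambda>C. C \<inter> sphere 0 1) ` \<F>)"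

definition polytopal_subcomplex :: "'a::euclidean_space set set \<Rightarrow> 'a set set \<Rightarrow> bool" where
  "polytopal_subcomplex \<L> \<K> \<longleftrightarrow> spherical_polytopal_complex \<L> \<and> \<L> \<subseteq> \<K>"


section \<open>The realization of the split complex\<close>

text \<open>The cone spanned by the split weights \<open>w S\<close>, taken modulo the lineality space, that is, as a
  cone which contains the lineality space like the cones of the secondary fan do.\<close>

definition split_cone ::
  "nat \<Rightarrow> ((real^'n) set set \<Rightarrow> real^('n::finite set)) \<Rightarrow> (real^'n) set set set \<Rightarrow>
     (real^('n set)) set" where
  "split_cone k w \<S> = {x + l |x l. x \<in> convex_cone hull (w ` \<S>) \<and> l \<in> lineality k}"

definition split_cell ::
  "nat \<Rightarrow> ((real^'n) set set \<Rightarrow> real^('n::finite set)) \<Rightarrow> (real^'n) set set set \<Rightarrow>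
     (real^('n set)) set" where
  "split_cell k w \<S> = spherical_cell k (split_cone k w \<S>)"

end

(* Normalise the normal vector a_S of a split S so that its cells are the parts of the polytope where
   a_S >= 0 and a_S <= 0 and its weight is v |-> max 0 (a_S . v). If S and T are compatible, some
   combination s a_S + t a_T with s, t nonzero is nonnegative on the polytope (separation in the plane).
   Everything follows from this nesting. The common refinement of compatible splits has no new
   vertices, so a weight sum c_S w_S is extended by the convex piecewise linear function
   sum c_S max 0 (a_S . x), whose second difference at a relative interior point of the hyperplane
   of S recovers S and c_S; hence compatible split weights span simplicial cones that meet in common
   faces. A weight inducing the same subdivision is linear on each chamber, and as its jump across each
   hyperplane is a constant multiple of a_S, it is a positive combination of the w_S up to linear
   functions; so these cones are cones of the secondary fan. Finally, the vertices of a chamber of the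
   hypersimplex satisfy basis exchange because no split hyperplane cuts an edge and no two compatible
   ones cross in an octahedral face. *)
theory Submission
  imports Defs
begin

section \<open>Tie sets and regular subdivisions\<close>

text \<open>Cells are handled through their vertex sets, the tie sets of affine minorants of the
  weight. A cell determines its tie set, so two weights induce the same subdivision exactly if they
  have the same tie sets. The polytope lies at level 1 of a linear form \<open>u\<close>, so affine
  functions can be written as linear ones. The obstacle is that weights live on vertices, whereas
  second differences need relative interior points. Chambers are hulls of vertices of the polytope,
  which lets inequalities at vertices spread inward. The weights of the theorem come with an
  arbitrary scale and an arbitrary order of the two cells. Both are absorbed into the normals, so
  splits can be compared only up to a positive factor and a sign, through the absolute values of
  their forms. For basis exchange it is not enough to find an element that suits each split
  separately: one element has to serve all of them. Hence the total violation is minimised over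
  whole bijections.\<close>

definition tie_set :: "'a::euclidean_space set \<Rightarrow> ('a \<Rightarrow> real) \<Rightarrow> 'a set \<Rightarrow> bool" where
  "tie_set V \<omega> E \<longleftrightarrow>
     (\<exists>m b. (\<forall>v\<in>V. m \<bullet> v + b \<le> \<omega> v) \<and> E = {v\<in>V. \<omega> v = m \<bullet> v + b})"

lemma tie_set_subset: "tie_set V \<omega> E \<Longrightarrow> E \<subseteq> V"
  by (auto simp: tie_set_def)

text \<open>A face of the hull of finitely many points is the hull of some of them; here these must
  lie on the supporting hyperplane.\<close>

lemma convex_hull_exposed_subset:
  fixes E :: "'a::euclidean_space set"
  assumes "finite E" and "\<And>x. x \<in> E \<Longrightarrow> b \<le> m \<bullet> x"
  shows "convex hull E \<inter> {x. m \<bullet> x = b} = convex hull (E \<inter> {x. m \<bullet> x = b})"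
    and "convex hull (E \<inter> {x. m \<bullet> x = b}) face_of convex hull E"
proof -
  have "convex hull E \<subseteq> {x. b \<le> m \<bullet> x}"
    using assms(2) by (intro hull_minimal convex_halfspace_ge) auto
  then have f: "convex hull E \<inter> {x. m \<bullet> x = b} face_of convex hull E"
    by (intro face_of_Int_supporting_hyperplane_ge) auto
  obtain E' where E': "E' \<subseteq> E" "convex hull E \<inter> {x. m \<bullet> x = b} = convex hull E'"
    using face_of_convex_hull_subset[OF finite_imp_compact[OF assms(1)] f] by auto
  then have "E' \<subseteq> E \<inter> {x. m \<bullet> x = b}"
    using hull_subset[of E' convex] by auto
  then have "convex hull E' \<subseteq> convex hull (E \<inter> {x. m \<bullet> x = b})"
    by (rule hull_mono)
  moreover have "convex hull (E \<inter> {x. m \<bullet> x = b}) \<subseteq> convex hull E \<inter> {x. m \<bullet> x = b}"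
    by (intro hull_minimal convex_Int convex_hyperplane) (auto intro: hull_inc)
  ultimately show "convex hull E \<inter> {x. m \<bullet> x = b} = convex hull (E \<inter> {x. m \<bullet> x = b})"
    using E' by auto
  then show "convex hull (E \<inter> {x. m \<bullet> x = b}) face_of convex hull E"
    using f by simp
qed

text \<open>The lower face is spanned by the lifted vertices on the supporting hyperplane, and
  \<open>fst\<close>, being linear, commutes with convex hulls.\<close>

lemma lower_face_projection:
  fixes V :: "'a::euclidean_space set"
  assumes "finite V" and "\<And>v. v \<in> V \<Longrightarrow> c \<le> y \<bullet> v + \<omega> v"
  shows "fst ` {q \<in> convex hull ((\<lambda>v. (v, \<omega> v)) ` V). (y, 1) \<bullet> q = c} =
         convex hull {v\<in>V. y \<bullet> v + \<omega> v = c}"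
proof -
  let ?g = "\<lambda>v. (v, \<omega> v)"
  have "{q \<in> convex hull (?g ` V). (y, 1) \<bullet> q = c} =
        convex hull (?g ` V) \<inter> {q. (y, 1) \<bullet> q = c}"
    by blast
  also have "\<dots> = convex hull (?g ` V \<inter> {q. (y, 1) \<bullet> q = c})"
    by (rule convex_hull_exposed_subset(1)) (use assms in auto)
  also have "?g ` V \<inter> {q. (y, 1) \<bullet> q = c} = ?g ` {v\<in>V. y \<bullet> v + \<omega> v = c}"
    by auto
  also have "fst ` (convex hull \<dots>) = convex hull (fst ` \<dots>)"
    by (rule convex_hull_linear_image[OF linear_fst])
  finally show ?thesis
    by (simp add: image_image)
qed

text \<open>An upward normal (y, 1) with bound c is the same datum as the affine minorant with slope
  - y and constant c.\<close>

lemma regular_subdivision_eq: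
  assumes fin: "finite (vertices P)"
  shows "regular_subdivision P \<omega> = (hull) convex ` {E. tie_set (vertices P) \<omega> E}"
proof -
  let ?V = "vertices P" and ?Q = "lifted_polytope P \<omega>"
  have below: "(\<forall>q\<in>?Q. c \<le> (y, 1) \<bullet> q) \<longleftrightarrow> (\<forall>v\<in>?V. c \<le> y \<bullet> v + \<omega> v)" for y c
  proof
    show "\<forall>v\<in>?V. c \<le> y \<bullet> v + \<omega> v" if "\<forall>q\<in>?Q. c \<le> (y, 1) \<bullet> q"
      using that by (force simp: lifted_polytope_def intro: hull_inc)
    show "\<forall>q\<in>?Q. c \<le> (y, 1) \<bullet> q" if "\<forall>v\<in>?V. c \<le> y \<bullet> v + \<omega> v"
    proof -
      have "?Q \<subseteq> {q. (y, 1) \<bullet> q \<ge> c}"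
        unfolding lifted_polytope_def using that
        by (intro hull_minimal convex_halfspace_ge) auto
      then show ?thesis by auto
    qed
  qed
  show ?thesis
  proof (intro equalityI subsetI)
    fix C assume "C \<in> regular_subdivision P \<omega>"
    then obtain y c where yc: "\<forall>q\<in>?Q. c \<le> (y, 1) \<bullet> q"
      and C: "C = fst ` {q\<in>?Q. (y, 1) \<bullet> q = c}"
      unfolding regular_subdivision_def lower_faces_def by auto
    have v: "\<forall>v\<in>?V. c \<le> y \<bullet> v + \<omega> v" using yc below by simp
    have "C = convex hull {v\<in>?V. y \<bullet> v + \<omega> v = c}"
      unfolding C lifted_polytope_def by (rule lower_face_projection) (use fin v in auto)
    moreover have "tie_set ?V \<omega> {v\<in>?V. y \<bullet> v + \<omega> v = c}"
      unfolding tie_set_def using v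
      by (intro exI[of _ "- y"] exI[of _ c]) (auto simp: algebra_simps)
    ultimately show "C \<in> (hull) convex ` {E. tie_set ?V \<omega> E}" by auto
  next
    fix C assume "C \<in> (hull) convex ` {E. tie_set ?V \<omega> E}"
    then obtain m b where mb: "\<forall>v\<in>?V. m \<bullet> v + b \<le> \<omega> v"
      and C: "C = convex hull {v\<in>?V. \<omega> v = m \<bullet> v + b}"
      by (auto simp: tie_set_def)
    have "{v\<in>?V. \<omega> v = m \<bullet> v + b} = {v\<in>?V. (- m) \<bullet> v + \<omega> v = b}"
      by auto
    then have "C = fst ` {q\<in>?Q. (- m, 1) \<bullet> q = b}"
      unfolding C lifted_polytope_def using lower_face_projection[of ?V b "- m" \<omega>] fin mb
      by (auto simp: algebra_simps)
    moreover have "\<forall>q\<in>?Q. b \<le> (- m, 1) \<bullet> q"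
      unfolding below using mb by (auto simp: algebra_simps)
    ultimately show "C \<in> regular_subdivision P \<omega>"
      unfolding regular_subdivision_def lower_faces_def by blast
  qed
qed

text \<open>Recovers a tie set from its cell: an extreme point of P stays extreme in a smaller hull
  containing it, hence is one of the generators.\<close>

lemma vertices_Int_convex_hull:
  assumes "convex P" and "E \<subseteq> vertices P"
  shows "vertices P \<inter> convex hull E = E"
proof (intro equalityI subsetI)
  fix v assume v: "v \<in> vertices P \<inter> convex hull E"
  have "E \<subseteq> P" using assms(2) by (auto simp: vertices_def extreme_point_of_def)
  then have "convex hull E \<subseteq> P"
    using assms(1) by (rule hull_minimal)
  with v have "v extreme_point_of convex hull E"
    by (auto simp: vertices_def extreme_point_of_def)
  then show "v \<in> E" by (rule extreme_point_of_convex_hull)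
qed (use assms(2) in \<open>auto intro: hull_inc\<close>)

text \<open>Source of the step sizes in later perturbation arguments: finitely many strict
  inequalities survive a small step of either sign.\<close>

lemma exists_small_scaling:
  fixes p q :: "'a \<Rightarrow> real"
  assumes "finite A" and "\<And>v. v \<in> A \<Longrightarrow> 0 < p v"
  obtains e where "e > 0" "\<And>v t. v \<in> A \<Longrightarrow> \<bar>t\<bar> \<le> e \<Longrightarrow> t * q v < p v"
proof -
  have "\<exists>e>0. \<forall>v\<in>A. \<forall>t. \<bar>t\<bar> \<le> e \<longrightarrow> t * q v < p v"
    using assms
  proof (induction A rule: finite_induct)
    case empty
    then show ?case by (auto intro: exI[of _ 1])
  next
    case (insert v A)
    then obtain e where e: "e > 0" "\<forall>v\<in>A. \<forall>t. \<bar>t\<bar> \<le> e \<longrightarrow> t * q v < p v" by auto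
    define d where "d = p v / (\<bar>q v\<bar> + 1)"
    have d: "d > 0" "d * \<bar>q v\<bar> < p v"
      using insert.prems[of v] by (auto simp: d_def field_simps)
    have "t * q v < p v" if "\<bar>t\<bar> \<le> d" for t
    proof -
      have "t * q v \<le> \<bar>t\<bar> * \<bar>q v\<bar>" by (metis abs_ge_self abs_mult)
      also have "\<dots> \<le> d * \<bar>q v\<bar>" using that by (intro mult_right_mono) auto
      finally show ?thesis using d by linarith
    qed
    then show ?case using e d by (intro exI[of _ "min e d"]) auto
  qed
  then show ?thesis using that by blast
qed

text \<open>Covering is left as a hypothesis, to be supplied by the chambers. Faces of cells are
  cells because a minorant can be tilted slightly; two cells meet where their minorants
  agree.\<close>

lemma polytopal_subdivision_regular_subdivision:
  assumes conv: "convex P" and fin: "finite (vertices P)"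
    and cover: "P \<subseteq> \<Union>(regular_subdivision P \<omega>)"
  shows "polytopal_subdivision P (regular_subdivision P \<omega>)"
proof -
  let ?V = "vertices P" and ?R = "regular_subdivision P \<omega>"
  note eq = regular_subdivision_eq[OF fin]
  have VP: "?V \<subseteq> P" by (auto simp: vertices_def extreme_point_of_def)
  have finE: "finite E" if "tie_set ?V \<omega> E" for E
    using finite_subset[OF tie_set_subset[OF that] fin] .
  have "{E. tie_set ?V \<omega> E} \<subseteq> Pow ?V" using tie_set_subset by blast
  then have "finite ?R"
    unfolding eq using fin by (meson finite_Pow_iff finite_imageI finite_subset)
  moreover have "\<Union>?R = P"
  proof
    show "\<Union>?R \<subseteq> P"
    proof
      fix x assume "x \<in> \<Union>?R"
      then obtain E where E: "tie_set ?V \<omega> E" "x \<in> convex hull E"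
        unfolding eq by auto
      have "convex hull E \<subseteq> P"
        using tie_set_subset[OF E(1)] VP by (intro hull_minimal conv) auto
      then show "x \<in> P" using E(2) by auto
    qed
  qed (use cover in auto)
  moreover have "\<forall>C\<in>?R. polytope C"
    unfolding eq polytope_def using finE by auto
  moreover have "F \<in> ?R" if "C \<in> ?R" "F face_of C" for C F
  proof -
    obtain E where E: "tie_set ?V \<omega> E" and C: "C = convex hull E"
      using \<open>C \<in> ?R\<close> unfolding eq by auto
    then obtain m b where mb: "\<And>v. v \<in> ?V \<Longrightarrow> m \<bullet> v + b \<le> \<omega> v"
        and Eeq: "E = {v\<in>?V. \<omega> v = m \<bullet> v + b}"
      by (auto simp: tie_set_def)
    have "polyhedron C"
      unfolding C using finE[OF E] by (simp add: polyhedron_convex_hull)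
    then have "F exposed_face_of C" using that(2) by (simp add: exposed_face_of_polyhedron)
    then obtain n d where nd: "C \<subseteq> {x. n \<bullet> x \<le> d}" and F: "F = C \<inter> {x. n \<bullet> x = d}"
      by (auto simp: exposed_face_of_def)
    have nd': "n \<bullet> v \<le> d" if "v \<in> E" for v
      using that nd hull_inc[of v E convex] by (auto simp: C)
    \<comment> \<open>The tilt is e (n . x - d). It is nonpositive on E and zero there exactly on F,
      while off E the slack p of the old minorant dominates it.\<close>
    define p where "p v = \<omega> v - (m \<bullet> v + b)" for v
    define q where "q v = n \<bullet> v - d" for v
    have "0 < p v" if "v \<in> ?V - E" for v
      using mb[of v] that by (auto simp: p_def Eeq less_le)
    then obtain e where e: "e > 0" "\<And>v t. v \<in> ?V - E \<Longrightarrow> \<bar>t\<bar> \<le> e \<Longrightarrow> t * q v < p v"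
      using exists_small_scaling[of "?V - E" p q] fin by auto
    have q: "e * q v < p v" if "v \<in> ?V - E" for v
      using e(2)[OF that, of e] e(1) by auto
    have p: "p v = 0" if "v \<in> E" for v
      using that by (auto simp: p_def Eeq)
    have val: "\<omega> v - ((m + e *\<^sub>R n) \<bullet> v + (b - e * d)) = p v - e * q v" for v
      by (simp add: p_def q_def algebra_simps inner_add_left)
    have ge: "0 \<le> p v - e * q v" if "v \<in> ?V" for v
    proof (cases "v \<in> E")
      case True
      then show ?thesis using p nd'[of v] e(1) by (auto simp: q_def mult_le_0_iff)
    qed (use q[of v] that in auto)
    have iff: "p v - e * q v = 0 \<longleftrightarrow> v \<in> E \<and> n \<bullet> v = d" if "v \<in> ?V" for v
    proof (cases "v \<in> E")
      case True
      then show ?thesis using p e(1) by (auto simp: q_def)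
    qed (use q[of v] that in auto)
    have "tie_set ?V \<omega> (E \<inter> {x. n \<bullet> x = d})"
      unfolding tie_set_def
    proof (intro exI conjI ballI)
      fix v assume "v \<in> ?V"
      then show "(m + e *\<^sub>R n) \<bullet> v + (b - e * d) \<le> \<omega> v" using val[of v] ge[of v] by linarith
    next
      have "\<omega> v = (m + e *\<^sub>R n) \<bullet> v + (b - e * d) \<longleftrightarrow> v \<in> E \<and> n \<bullet> v = d" if "v \<in> ?V" for v
        using val[of v] iff[OF that] by linarith
      then show "E \<inter> {x. n \<bullet> x = d} = {v\<in>?V. \<omega> v = (m + e *\<^sub>R n) \<bullet> v + (b - e * d)}"
        using tie_set_subset[OF E] by auto
    qed
    moreover have "F = convex hull (E \<inter> {x. n \<bullet> x = d})"
      using convex_hull_exposed_subset(1)[of E "- d" "- n"] finE[OF E] nd' by (auto simp: F C)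
    ultimately show ?thesis unfolding eq by auto
  qed
  moreover have "(C \<inter> D) face_of C" if "C \<in> ?R" "D \<in> ?R" for C D
  proof -
    obtain E1 E2 where E: "tie_set ?V \<omega> E1" "tie_set ?V \<omega> E2"
      and C: "C = convex hull E1" and D: "D = convex hull E2"
      using \<open>C \<in> ?R\<close> \<open>D \<in> ?R\<close> unfolding eq by blast
    obtain m b where mb: "\<And>v. v \<in> ?V \<Longrightarrow> m \<bullet> v + b \<le> \<omega> v"
        and E1: "E1 = {v\<in>?V. \<omega> v = m \<bullet> v + b}"
      using E by (auto simp: tie_set_def)
    obtain n d where nd: "\<And>v. v \<in> ?V \<Longrightarrow> n \<bullet> v + d \<le> \<omega> v"
        and E2: "E2 = {v\<in>?V. \<omega> v = n \<bullet> v + d}"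
      using E by (auto simp: tie_set_def)
    \<comment> \<open>On the first tie set the minorant m . v + b is exact and so lies above the
      other one; on the second the order is reversed. Common points thus lie on ?H.\<close>
    have ge: "d - b \<le> (m - n) \<bullet> v" if "v \<in> E1" for v
      using that nd[of v] by (auto simp: E1 inner_diff_left)
    have le: "(m - n) \<bullet> v \<le> d - b" if "v \<in> E2" for v
      using that mb[of v] by (auto simp: E2 inner_diff_left)
    let ?H = "{x. (m - n) \<bullet> x = d - b}"
    have "E1 \<inter> ?H \<subseteq> E2"
      by (auto simp: E1 E2 inner_diff_left)
    then have "convex hull (E1 \<inter> ?H) \<subseteq> C \<inter> D"
      unfolding C D by (simp add: hull_mono)
    moreover have "C \<subseteq> {x. (m - n) \<bullet> x \<ge> d - b}" "D \<subseteq> {x. (m - n) \<bullet> x \<le> d - b}"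
      unfolding C D using ge le
      by (intro hull_minimal convex_halfspace_ge convex_halfspace_le subsetI; simp)+
    then have "C \<inter> D \<subseteq> C \<inter> ?H" by fastforce
    ultimately have "C \<inter> D = convex hull (E1 \<inter> ?H)"
      using convex_hull_exposed_subset(1)[OF finE[OF E(1)] ge] by (auto simp: C)
    then show ?thesis
      unfolding C using convex_hull_exposed_subset(2)[OF finE[OF E(1)] ge] by auto
  qed
  ultimately show ?thesis
    unfolding polytopal_subdivision_def by (metis Int_commute)
qed

section \<open>Compatible splits and their chambers\<close>

text \<open>Both signs of t are allowed, so that x gets neighbours in P symmetric about it, as
  second differences require.\<close>

lemma convex_prolong_through_rel_interior:
  fixes P :: "'a::euclidean_space set"
  assumes "x \<in> rel_interior P" and "y \<in> P"
  obtains e where "e > 0" "\<And>t. \<bar>t\<bar> \<le> e \<Longrightarrow> x + t *\<^sub>R (y - x) \<in> P"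
proof -
  obtain d where d: "d > 0" "ball x d \<inter> affine hull P \<subseteq> P" and x: "x \<in> P"
    using assms(1) by (auto simp: mem_rel_interior_ball)
  define e where "e = d / (norm (y - x) + 1)"
  have e: "e > 0" "e * norm (y - x) < d"
    using d(1) by (auto simp: e_def field_simps add_pos_nonneg)
  show ?thesis
  proof (rule that[OF e(1)])
    fix t :: real assume t: "\<bar>t\<bar> \<le> e"
    have "norm (t *\<^sub>R (y - x)) \<le> e * norm (y - x)"
      using t by (simp add: mult_right_mono)
    then have "x + t *\<^sub>R (y - x) \<in> ball x d"
      using e(2) by (simp add: dist_norm norm_minus_commute)
    moreover have "x + t *\<^sub>R (y - x) \<in> affine hull P"
      by (intro mem_affine_3_minus affine_affine_hull hull_inc x assms(2))
    ultimately show "x + t *\<^sub>R (y - x) \<in> P" using d(2) by blast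
  qed
qed

lemma not_extreme_point_symmetric:
  assumes "w \<noteq> 0" "v - w \<in> S" "v + w \<in> S"
  shows "\<not> v extreme_point_of S"
proof
  assume v: "v extreme_point_of S"
  have "w + w \<noteq> 0" using assms(1) by (metis scaleR_2 scaleR_eq_0_iff zero_neq_numeral)
  then have "v \<in> open_segment (v - w) (v + w)"
    by (auto simp: in_segment eq_neg_iff_add_eq_0 algebra_simps
        simp flip: scaleR_add_left intro!: exI[of _ "1/2"])
  then show False using v assms by (auto simp: extreme_point_of_def)
qed

text \<open>The normals of the splits of a polytope, in a form independent of subdivisions.
  \<open>split_vertices\<close> encodes the absence of new vertices; \<open>split_span\<close> makes
  a form that vanishes on a splitting section a multiple of its normal; \<open>split_unique\<close>
  identifies a split from the size of its form on P.\<close>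

locale split_system =
  fixes P :: "'a::euclidean_space set" and X :: "'i set" and a :: "'i \<Rightarrow> 'a" and u :: 'a
  assumes compact_P: "compact P" and convex_P: "convex P"
    and finite_vertices: "finite (vertices P)"
    and level: "x \<in> P \<Longrightarrow> u \<bullet> x = 1"
    and split_pos: "S \<in> X \<Longrightarrow> \<exists>x\<in>P. 0 < a S \<bullet> x"
    and split_neg: "S \<in> X \<Longrightarrow> \<exists>x\<in>P. a S \<bullet> x < 0"
    and split_vertices: "S \<in> X \<Longrightarrow> vertices (P \<inter> {x. a S \<bullet> x = 0}) \<subseteq> vertices P"
    and split_span: "S \<in> X \<Longrightarrow> span (P \<inter> {x. a S \<bullet> x = 0}) = {x. a S \<bullet> x = 0}"
    and split_unique:
      "S \<in> X \<Longrightarrow> T \<in> X \<Longrightarrow> 0 < c \<Longrightarrow> (\<And>y. y \<in> P \<Longrightarrow> c * \<bar>a S \<bullet> y\<bar> = \<bar>a T \<bullet> y\<bar>) \<Longrightarrow> S = T"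
begin

definition compatible :: "'i \<Rightarrow> 'i \<Rightarrow> bool" where
  "compatible S T \<longleftrightarrow> {x. a S \<bullet> x = 0} \<inter> {x. a T \<bullet> x = 0} \<inter> rel_interior P = {}"

definition compatible_family :: "'i set \<Rightarrow> bool" where
  "compatible_family \<S> \<longleftrightarrow> finite \<S> \<and> \<S> \<subseteq> X \<and> pairwise compatible \<S>"

definition chamber :: "'i set \<Rightarrow> ('i \<Rightarrow> real) \<Rightarrow> 'a set" where
  "chamber \<S> \<sigma> = {x\<in>P. \<forall>S\<in>\<S>. 0 \<le> \<sigma> S * (a S \<bullet> x)}"

definition sign_vector :: "('i \<Rightarrow> real) \<Rightarrow> bool" where
  "sign_vector \<sigma> \<longleftrightarrow> (\<forall>S. \<sigma> S = 1 \<or> \<sigma> S = -1)"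

definition split_sum :: "'i set \<Rightarrow> ('i \<Rightarrow> real) \<Rightarrow> 'a \<Rightarrow> real" where
  "split_sum \<S> c x = (\<Sum>S\<in>\<S>. c S * max 0 (a S \<bullet> x))"

text \<open>The normal of the linear function which \<open>split_sum \<S> c\<close> restricts to on \<open>chamber \<S> \<sigma>\<close>.\<close>

definition chamber_normal :: "'i set \<Rightarrow> ('i \<Rightarrow> real) \<Rightarrow> ('i \<Rightarrow> real) \<Rightarrow> 'a" where
  "chamber_normal \<S> c \<sigma> = (\<Sum>S\<in>\<S>. (c S * (1 + \<sigma> S) / 2) *\<^sub>R a S)"

lemma vertices_subset: "vertices P \<subseteq> P"
  by (auto simp: vertices_def extreme_point_of_def)

section \<open>Compatibility and nesting of splits\<close>

lemma compatible_family_subset: "compatible_family \<S> \<Longrightarrow> \<T> \<subseteq> \<S> \<Longrightarrow> compatible_family \<T>"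
  by (auto simp: compatible_family_def intro: finite_subset pairwise_subset)

lemma rel_interior_dense: "P \<subseteq> closure (rel_interior P)"
  using closure_subset[of P] convex_closure_rel_interior[OF convex_P] by simp

text \<open>The image of the relative interior under the two forms is convex and misses the origin,
  so a vector (s, t) separates it. Neither entry vanishes, as P has points strictly on both sides of
  each split.\<close>

lemma compatible_nested:
  assumes "S \<in> X" "T \<in> X" "compatible S T"
  obtains s t where "s \<noteq> 0" "t \<noteq> 0" "\<And>x. x \<in> P \<Longrightarrow> 0 \<le> s * (a S \<bullet> x) + t * (a T \<bullet> x)"
proof -
  let ?f = "\<lambda>x. (a S \<bullet> x, a T \<bullet> x)"
  have "linear ?f" by (auto intro!: linearI simp: inner_add_right)
  then have "convex (?f ` rel_interior P)"
    using convex_P by (simp add: convex_linear_image convex_rel_interior)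
  moreover have "0 \<notin> ?f ` rel_interior P"
    using assms(3) by (auto simp: compatible_def zero_prod_def)
  ultimately obtain p where p: "p \<noteq> 0" "\<forall>x\<in>?f ` rel_interior P. 0 \<le> p \<bullet> x"
    using separating_hyperplane_set_0 by blast
  obtain s t where st: "p = (s, t)" by fastforce
  have "rel_interior P \<subseteq> {x. 0 \<le> (s *\<^sub>R a S + t *\<^sub>R a T) \<bullet> x}"
    using p(2) by (auto simp: st inner_add_left)
  then have "closure (rel_interior P) \<subseteq> {x. 0 \<le> (s *\<^sub>R a S + t *\<^sub>R a T) \<bullet> x}"
    by (rule closure_minimal) (rule closed_halfspace_ge)
  then have ge: "0 \<le> s * (a S \<bullet> x) + t * (a T \<bullet> x)" if "x \<in> P" for x
    using that rel_interior_dense by (auto simp: inner_add_left)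
  have sgn: "r = 0" if "R \<in> X" "\<And>x. x \<in> P \<Longrightarrow> 0 \<le> r * (a R \<bullet> x)" for r R
    using split_pos[OF that(1)] split_neg[OF that(1)] that(2)
    by (metis less_eq_real_def linorder_not_less mult_less_0_iff)
  have "s \<noteq> 0" using ge sgn[of T t] assms(2) p(1) by (auto simp: st zero_prod_def)
  moreover have "t \<noteq> 0" using ge sgn[of S s] assms(1) p(1) by (auto simp: st zero_prod_def)
  ultimately show ?thesis using ge that by blast
qed

text \<open>The relative interior is dense in P, so it too has points strictly on both sides; the
  segment between them crosses the hyperplane.\<close>

lemma split_rel_interior_point:
  assumes "S \<in> X"
  obtains x where "x \<in> rel_interior P" "a S \<bullet> x = 0"
proof -
  have "\<exists>x\<in>rel_interior P. 0 < b \<bullet> x" if "\<exists>x\<in>P. 0 < b \<bullet> x" for b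
  proof (rule ccontr)
    assume "\<not> ?thesis"
    then have "rel_interior P \<subseteq> {x. b \<bullet> x \<le> 0}" by (auto simp: not_less)
    then have "closure (rel_interior P) \<subseteq> {x. b \<bullet> x \<le> 0}"
      by (rule closure_minimal) (rule closed_halfspace_le)
    then show False using that rel_interior_dense by force
  qed
  from this[of "a S"] this[of "- a S"] obtain p q
    where p: "p \<in> rel_interior P" "0 < a S \<bullet> p" and q: "q \<in> rel_interior P" "a S \<bullet> q < 0"
    using split_pos[OF assms] split_neg[OF assms] by auto
  define r where "r = a S \<bullet> p / (a S \<bullet> p - a S \<bullet> q)"
  have r: "0 \<le> r" "r \<le> 1" using p q by (auto simp: r_def divide_simps)
  have "(1 - r) *\<^sub>R p + r *\<^sub>R q \<in> rel_interior P"
    using convexD_alt[OF convex_rel_interior[OF convex_P] p(1) q(1) r] .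
  moreover have "a S \<bullet> ((1 - r) *\<^sub>R p + r *\<^sub>R q) = 0"
    unfolding inner_add_right inner_scaleR_right using p q by (simp add: r_def field_simps)
  ultimately show ?thesis using that by blast
qed

section \<open>Chambers and their vertices\<close>

lemma chamber_subset: "chamber \<S> \<sigma> \<subseteq> P"
  by (auto simp: chamber_def)

lemma convex_chamber: "convex (chamber \<S> \<sigma>)" and compact_chamber: "compact (chamber \<S> \<sigma>)"
proof -
  have eq: "chamber \<S> \<sigma> = P \<inter> (\<Inter>S\<in>\<S>. {x. 0 \<le> (\<sigma> S *\<^sub>R a S) \<bullet> x})"
    by (auto simp: chamber_def)
  show "convex (chamber \<S> \<sigma>)"
    unfolding eq by (intro convex_Int convex_P convex_INT convex_halfspace_ge)
  show "compact (chamber \<S> \<sigma>)"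
    unfolding eq by (intro compact_Int_closed compact_P closed_INT ballI closed_halfspace_ge)
qed

text \<open>The common refinement of compatible splits has no new vertices: if several hyperplanes of the
  family pass through \<open>v\<close>, then any two of them restrict a segment in the other one that contains
  \<open>v\<close> to lie in both, so a segment through \<open>v\<close> in one of them stays in the chamber.\<close>

lemma vertices_chamber_subset:
  assumes fam: "compatible_family \<S>"
  shows "vertices (chamber \<S> \<sigma>) \<subseteq> vertices P"
proof (rule ccontr)
  assume "\<not> ?thesis"
  then obtain v where v: "v extreme_point_of chamber \<S> \<sigma>" and nv: "v \<notin> vertices P"
    by (auto simp: vertices_def)
  have vC: "v \<in> chamber \<S> \<sigma>" using v by (simp add: extreme_point_of_def)
  define \<T> where "\<T> = {S\<in>\<S>. a S \<bullet> v = 0}"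
  have "\<exists>x\<in>P. \<exists>y\<in>P. v \<in> open_segment x y \<and> (\<forall>S\<in>\<T>. a S \<bullet> x = 0 \<and> a S \<bullet> y = 0)"
  proof (cases "\<T> = {}")
    case True
    then show ?thesis
      using nv vC chamber_subset[of \<S> \<sigma>] by (auto simp: vertices_def extreme_point_of_def)
  next
    case False
    then obtain S where S: "S \<in> \<S>" "S \<in> X" "a S \<bullet> v = 0" "S \<in> \<T>"
      using fam by (auto simp: \<T>_def compatible_family_def)
    have "\<not> v extreme_point_of (P \<inter> {x. a S \<bullet> x = 0})"
      using nv split_vertices[OF S(2)] by (auto simp: vertices_def)
    then obtain x y where xy: "x \<in> P" "a S \<bullet> x = 0" "y \<in> P" "a S \<bullet> y = 0"
        and vxy: "v \<in> open_segment x y"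
      using vC chamber_subset[of \<S> \<sigma>] S(3) by (auto simp: extreme_point_of_def)
    have "a T \<bullet> x = 0 \<and> a T \<bullet> y = 0" if T: "T \<in> \<T>" for T
    proof (cases "T = S")
      case False
      then have "compatible S T"
        using T S fam by (auto simp: \<T>_def compatible_family_def pairwise_def)
      then obtain s t where st: "s \<noteq> 0" "t \<noteq> 0"
          "\<And>x. x \<in> P \<Longrightarrow> 0 \<le> s * (a S \<bullet> x) + t * (a T \<bullet> x)"
        using compatible_nested[of S T] S T fam by (auto simp: \<T>_def compatible_family_def)
      \<comment> \<open>The form of S vanishes at both ends, so the form of T has the same weak sign
        there. It vanishes at v strictly between them, hence at both ends.\<close>
      have ge: "0 \<le> t * (a T \<bullet> x)" "0 \<le> t * (a T \<bullet> y)"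
        using st(3)[of x] st(3)[of y] xy by auto
      obtain r where r: "0 < r" "r < 1" "v = (1 - r) *\<^sub>R x + r *\<^sub>R y"
        using vxy by (auto simp: in_segment)
      have "(1 - r) * (t * (a T \<bullet> x)) + r * (t * (a T \<bullet> y)) = t * (a T \<bullet> v)"
        by (simp add: r(3) inner_add_right algebra_simps)
      also have "\<dots> = 0" using T by (simp add: \<T>_def)
      finally have "(1 - r) * (t * (a T \<bullet> x)) = 0" "r * (t * (a T \<bullet> y)) = 0"
        using ge r by (auto simp: add_nonneg_eq_0_iff)
      then show ?thesis using r st(2) by auto
    qed (use xy in auto)
    then show ?thesis using xy vxy by blast
  qed
  then obtain x y where xy: "x \<in> P" "y \<in> P" "v \<in> open_segment x y"
      and zero: "\<And>S. S \<in> \<T> \<Longrightarrow> a S \<bullet> x = 0 \<and> a S \<bullet> y = 0" by blast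
  obtain r where r: "0 < r" "r < 1" "v = (1 - r) *\<^sub>R x + r *\<^sub>R y" "x \<noteq> y"
    using xy(3) by (auto simp: in_segment)
  \<comment> \<open>Forms in \<T> vanish along the whole segment and a sign 0 imposes nothing; only
    the remaining, strict constraints limit the step.\<close>
  have "0 < \<sigma> S * (a S \<bullet> v)" if "S \<in> {S\<in>\<S>. \<sigma> S \<noteq> 0 \<and> S \<notin> \<T>}" for S
    using that vC by (auto simp: chamber_def \<T>_def less_le)
  then obtain e where e: "e > 0"
      "\<And>S t. S \<in> {S\<in>\<S>. \<sigma> S \<noteq> 0 \<and> S \<notin> \<T>} \<Longrightarrow> \<bar>t\<bar> \<le> e \<Longrightarrow>
          t * (\<sigma> S * (a S \<bullet> (y - x))) < \<sigma> S * (a S \<bullet> v)"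
    using exists_small_scaling[of "{S\<in>\<S>. \<sigma> S \<noteq> 0 \<and> S \<notin> \<T>}"
        "\<lambda>S. \<sigma> S * (a S \<bullet> v)" "\<lambda>S. \<sigma> S * (a S \<bullet> (y - x))"] fam
    by (auto simp: compatible_family_def)
  define d where "d = min e (min r (1 - r))"
  have d: "0 < d" "d \<le> e" "d \<le> r" "d \<le> 1 - r" using e(1) r by (auto simp: d_def)
  have mem: "v + t *\<^sub>R (y - x) \<in> chamber \<S> \<sigma>" if t: "\<bar>t\<bar> \<le> d" for t
  proof -
    have "v + t *\<^sub>R (y - x) = (1 - (r + t)) *\<^sub>R x + (r + t) *\<^sub>R y"
      by (simp add: r(3) algebra_simps)
    moreover have "0 \<le> r + t" "r + t \<le> 1" using t d by auto
    ultimately have "v + t *\<^sub>R (y - x) \<in> P"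
      using convexD_alt[OF convex_P xy(1,2)] by simp
    moreover have "0 \<le> \<sigma> S * (a S \<bullet> (v + t *\<^sub>R (y - x)))" if "S \<in> \<S>" for S
    proof (cases "\<sigma> S = 0 \<or> S \<in> \<T>")
      case True
      then show ?thesis using zero by (auto simp: \<T>_def inner_add_right inner_diff_right)
    next
      case False
      then have "(- t) * (\<sigma> S * (a S \<bullet> (y - x))) < \<sigma> S * (a S \<bullet> v)"
        using e(2)[of S "- t"] t d that by auto
      then show ?thesis by (simp add: inner_add_right algebra_simps)
    qed
    ultimately show ?thesis by (simp add: chamber_def)
  qed
  have "\<not> v extreme_point_of chamber \<S> \<sigma>"
    using not_extreme_point_symmetric[of "d *\<^sub>R (y - x)" v] mem[of d] mem[of "- d"] d(1) r(4)
    by auto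
  then show False using v by simp
qed

text \<open>Krein-Milman without new vertices. This carries linear information given at vertices to
  every point of a chamber.\<close>

lemma chamber_eq_convex_hull:
  assumes "compatible_family \<S>"
  shows "chamber \<S> \<sigma> = convex hull (vertices P \<inter> chamber \<S> \<sigma>)"
proof
  have "chamber \<S> \<sigma> = convex hull (vertices (chamber \<S> \<sigma>))"
    unfolding vertices_def
    using Krein_Milman_Minkowski[OF compact_chamber[of \<S> \<sigma>] convex_chamber] .
  also have "\<dots> \<subseteq> convex hull (vertices P \<inter> chamber \<S> \<sigma>)"
    using vertices_chamber_subset[OF assms, of \<sigma>]
    by (intro hull_mono) (auto simp: vertices_def extreme_point_of_def)
  finally show "chamber \<S> \<sigma> \<subseteq> convex hull (vertices P \<inter> chamber \<S> \<sigma>)" .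
qed (intro hull_minimal convex_chamber, auto)

lemma chamber_exists:
  assumes "x \<in> P"
  obtains \<sigma> where "sign_vector \<sigma>" "x \<in> chamber \<S> \<sigma>"
proof
  show "sign_vector (\<lambda>S. if 0 \<le> a S \<bullet> x then 1 else -1)" by (auto simp: sign_vector_def)
  show "x \<in> chamber \<S> (\<lambda>S. if 0 \<le> a S \<bullet> x then 1 else -1)"
    using assms by (auto simp: chamber_def)
qed

section \<open>Weight sums as piecewise linear functions\<close>

lemma split_sum_eq_chamber_normal:
  assumes "sign_vector \<sigma>" "x \<in> chamber \<S> \<sigma>"
  shows "split_sum \<S> c x = chamber_normal \<S> c \<sigma> \<bullet> x"
  unfolding split_sum_def chamber_normal_def inner_sum_left
proof (rule sum.cong[OF refl])
  fix S assume "S \<in> \<S>"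
  moreover have "\<sigma> S = 1 \<or> \<sigma> S = -1" using assms(1) by (simp add: sign_vector_def)
  ultimately show "c S * max 0 (a S \<bullet> x) = ((c S * (1 + \<sigma> S) / 2) *\<^sub>R a S) \<bullet> x"
    using assms(2) by (auto simp: chamber_def max_def)
qed

text \<open>The factor (1 + \<sigma> S) / 2 is 0 or 1, and both 0 and a S . x lie below the positive
  part, so the linear form of any chamber is a global minorant.\<close>

lemma split_sum_ge_chamber_normal:
  assumes "sign_vector \<sigma>" "\<And>S. S \<in> \<S> \<Longrightarrow> 0 \<le> c S"
  shows "chamber_normal \<S> c \<sigma> \<bullet> x \<le> split_sum \<S> c x"
  unfolding split_sum_def chamber_normal_def inner_sum_left
proof (rule sum_mono)
  fix S assume "S \<in> \<S>"
  moreover have "\<sigma> S = 1 \<or> \<sigma> S = -1" using assms(1) by (simp add: sign_vector_def)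
  ultimately show "((c S * (1 + \<sigma> S) / 2) *\<^sub>R a S) \<bullet> x \<le> c S * max 0 (a S \<bullet> x)"
    using assms(2)[of S] by (auto simp: mult_left_mono)
qed

text \<open>A violated sign makes its own summand strict, because its coefficient is
  positive.\<close>

lemma split_sum_gt_chamber_normal:
  assumes "finite \<S>" "sign_vector \<sigma>" "\<And>S. S \<in> \<S> \<Longrightarrow> 0 < c S" "x \<in> P" "x \<notin> chamber \<S> \<sigma>"
  shows "chamber_normal \<S> c \<sigma> \<bullet> x < split_sum \<S> c x"
proof -
  have sg: "\<sigma> S = 1 \<or> \<sigma> S = -1" for S using assms(2) by (simp add: sign_vector_def)
  obtain T where T: "T \<in> \<S>" "\<sigma> T * (a T \<bullet> x) < 0"
    using assms(4,5) by (auto simp: chamber_def not_le)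
  show ?thesis
    unfolding split_sum_def chamber_normal_def inner_sum_left
  proof (rule sum_strict_mono_ex1[OF assms(1)])
    show "\<forall>S\<in>\<S>. ((c S * (1 + \<sigma> S) / 2) *\<^sub>R a S) \<bullet> x \<le> c S * max 0 (a S \<bullet> x)"
    proof
      fix S assume "S \<in> \<S>"
      then show "((c S * (1 + \<sigma> S) / 2) *\<^sub>R a S) \<bullet> x \<le> c S * max 0 (a S \<bullet> x)"
        using sg[of S] assms(3)[of S] by (auto simp: mult_left_mono)
    qed
    show "\<exists>S\<in>\<S>. ((c S * (1 + \<sigma> S) / 2) *\<^sub>R a S) \<bullet> x < c S * max 0 (a S \<bullet> x)"
      using T sg[of T] assms(3)[OF T(1)]
      by (intro bexI[OF _ T(1)]) (auto simp: mult_pos_neg)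
  qed
qed

text \<open>Phrased as convexity of a set so that an inequality at vertices spreads to their hull by
  minimality of the hull.\<close>

lemma convex_split_sum_sublevel:
  assumes "\<And>S. S \<in> \<S> \<Longrightarrow> 0 \<le> c S"
  shows "convex {x. split_sum \<S> c x \<le> m \<bullet> x}"
proof -
  have "convex_on UNIV (\<lambda>x. c S * max 0 (a S \<bullet> x))" if "S \<in> \<S>" for S
  proof (rule convex_onI)
    fix t x y assume t: "0 < (t::real)" "t < 1"
    have "max 0 (a S \<bullet> ((1 - t) *\<^sub>R x + t *\<^sub>R y))
        \<le> (1 - t) * max 0 (a S \<bullet> x) + t * max 0 (a S \<bullet> y)"
      using t by (auto simp: inner_add_right intro!: add_mono mult_left_mono add_nonneg_nonneg)
    from mult_left_mono[OF this assms[OF that]]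
    show "c S * max 0 (a S \<bullet> ((1 - t) *\<^sub>R x + t *\<^sub>R y))
        \<le> (1 - t) * (c S * max 0 (a S \<bullet> x)) + t * (c S * max 0 (a S \<bullet> y))"
      by (simp add: algebra_simps)
  qed simp
  then have cvx: "split_sum \<S> c ((1 - t) *\<^sub>R x + t *\<^sub>R y)
      \<le> (1 - t) * split_sum \<S> c x + t * split_sum \<S> c y"
    if "0 \<le> t" "t \<le> 1" for t x y
    unfolding split_sum_def sum_distrib_left sum.distrib[symmetric]
    using that by (intro sum_mono) (auto dest!: convex_onD[where A=UNIV])
  show ?thesis
    unfolding convex_alt
  proof (intro ballI allI impI CollectI)
    fix x y and t :: real
    assume "x \<in> {x. split_sum \<S> c x \<le> m \<bullet> x}" "y \<in> {x. split_sum \<S> c x \<le> m \<bullet> x}"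
      and t: "0 \<le> t \<and> t \<le> 1"
    then have "(1 - t) * split_sum \<S> c x + t * split_sum \<S> c y
        \<le> (1 - t) * (m \<bullet> x) + t * (m \<bullet> y)"
      by (auto intro!: add_mono mult_left_mono)
    then show "split_sum \<S> c ((1 - t) *\<^sub>R x + t *\<^sub>R y) \<le> m \<bullet> ((1 - t) *\<^sub>R x + t *\<^sub>R y)"
      using cvx[of t x y] t by (auto simp: inner_add_right)
  qed
qed

text \<open>A sum of compatible split weights is the lower hull of its values at the vertices.\<close>

lemma split_sum_le_from_vertices:
  assumes fam: "compatible_family \<S>" and nn: "\<And>S. S \<in> \<T> \<Longrightarrow> 0 \<le> d S"
    and le: "\<And>v. v \<in> vertices P \<Longrightarrow> split_sum \<T> d v + m \<bullet> v \<le> split_sum \<S> c v"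
    and x: "x \<in> P"
  shows "split_sum \<T> d x + m \<bullet> x \<le> split_sum \<S> c x"
proof -
  obtain \<sigma> where \<sigma>: "sign_vector \<sigma>" "x \<in> chamber \<S> \<sigma>" using chamber_exists[OF x] .
  \<comment> \<open>On the chamber containing x the right-hand side is linear, so a convex function
    is compared with a linear one over a hull of vertices.\<close>
  let ?l = "chamber_normal \<S> c \<sigma>"
  have "vertices P \<inter> chamber \<S> \<sigma> \<subseteq> {x. split_sum \<T> d x \<le> (?l - m) \<bullet> x}"
    using le split_sum_eq_chamber_normal[OF \<sigma>(1)] by (force simp: inner_diff_left)
  then have "convex hull (vertices P \<inter> chamber \<S> \<sigma>) \<subseteq> {x. split_sum \<T> d x \<le> (?l - m) \<bullet> x}"
    by (rule hull_minimal) (rule convex_split_sum_sublevel[OF nn])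
  then have "split_sum \<T> d x \<le> (?l - m) \<bullet> x"
    using \<sigma>(2) chamber_eq_convex_hull[OF fam] by auto
  then show ?thesis
    using split_sum_eq_chamber_normal[OF \<sigma>, of c] by (simp add: inner_diff_left)
qed

text \<open>A summand whose hyperplane misses x is linear near x and cancels. One whose hyperplane
  contains x has a kink there and contributes its absolute value, with a S . (y - x) = a S .
  y.\<close>

lemma split_sum_second_difference:
  assumes "finite \<S>" and x: "x \<in> rel_interior P" and y: "y \<in> P"
  shows "\<exists>e>0. \<forall>t. 0 \<le> t \<and> t \<le> e \<longrightarrow>
      split_sum \<S> c (x + t *\<^sub>R (y - x)) + split_sum \<S> c (x - t *\<^sub>R (y - x)) - 2 * split_sum \<S> c x
      = t * (\<Sum>S\<in>{S\<in>\<S>. a S \<bullet> x = 0}. c S * \<bar>a S \<bullet> y\<bar>)"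
proof -
  let ?A = "{S\<in>\<S>. a S \<bullet> x \<noteq> 0}"
  obtain e where e: "e > 0"
    "\<And>S t. S \<in> ?A \<Longrightarrow> \<bar>t\<bar> \<le> e \<Longrightarrow> t * (a S \<bullet> (y - x)) < \<bar>a S \<bullet> x\<bar>"
    using exists_small_scaling[of ?A "\<lambda>S. \<bar>a S \<bullet> x\<bar>" "\<lambda>S. a S \<bullet> (y - x)"] assms(1) by auto
  show ?thesis
  proof (intro exI[of _ e] conjI allI impI e(1))
    fix t :: real assume t: "0 \<le> t \<and> t \<le> e"
    let ?z = "t *\<^sub>R (y - x)"
    let ?h = "\<lambda>S. max 0 (a S \<bullet> (x + ?z)) + max 0 (a S \<bullet> (x - ?z)) - 2 * max 0 (a S \<bullet> x)"
    have "split_sum \<S> c (x + ?z) + split_sum \<S> c (x - ?z) - 2 * split_sum \<S> c x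
        = (\<Sum>S\<in>\<S>. c S * ?h S)"
      by (simp add: split_sum_def sum_distrib_left sum.distrib sum_subtractf algebra_simps)
    also have "\<dots> = (\<Sum>S\<in>\<S>. if a S \<bullet> x = 0 then t * (c S * \<bar>a S \<bullet> y\<bar>) else 0)"
    proof (rule sum.cong[OF refl])
      fix S assume S: "S \<in> \<S>"
      show "c S * ?h S = (if a S \<bullet> x = 0 then t * (c S * \<bar>a S \<bullet> y\<bar>) else 0)"
      proof (cases "a S \<bullet> x = 0")
        case True
        then have "?h S = \<bar>t * (a S \<bullet> y)\<bar>"
          by (simp add: inner_add_right inner_diff_right max_def)
        then show ?thesis using True t by (simp add: abs_mult)
      next
        case False
        then have "\<bar>t * (a S \<bullet> (y - x))\<bar> < \<bar>a S \<bullet> x\<bar>"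
          using e(2)[of S t] e(2)[of S "- t"] t S by auto
        then have "?h S = 0"
          by (simp add: inner_add_right inner_diff_right max_def algebra_simps abs_if
              split: if_splits)
        then show ?thesis using False by simp
      qed
    qed
    also have "\<dots> = t * (\<Sum>S\<in>{S\<in>\<S>. a S \<bullet> x = 0}. c S * \<bar>a S \<bullet> y\<bar>)"
      using assms(1) by (auto simp: sum_distrib_left sum.inter_filter intro!: sum.cong)
    finally show "split_sum \<S> c (x + ?z) + split_sum \<S> c (x - ?z) - 2 * split_sum \<S> c x
        = t * (\<Sum>S\<in>{S\<in>\<S>. a S \<bullet> x = 0}. c S * \<bar>a S \<bullet> y\<bar>)" .
  qed
qed

lemma compatible_family_at_point:
  assumes fam: "compatible_family \<S>" and "S \<in> \<S>" and "x \<in> rel_interior P" "a S \<bullet> x = 0"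
  shows "{T\<in>\<S>. a T \<bullet> x = 0} = {S}"
proof -
  have "T = S" if "T \<in> \<S>" "a T \<bullet> x = 0" for T
  proof (rule ccontr)
    assume "T \<noteq> S"
    then have "compatible T S"
      using fam that(1) assms(2) by (auto simp: compatible_family_def pairwise_def)
    then show False using that(2) assms(3,4) by (auto simp: compatible_def)
  qed
  then show ?thesis using assms(2,4) by blast
qed

text \<open>The second difference at a relative interior point of a split hyperplane recovers the split
  and its coefficient.\<close>

lemma split_sum_unique:
  assumes S: "compatible_family \<S>" "\<And>S. S \<in> \<S> \<Longrightarrow> 0 \<le> c S"
    and T: "compatible_family \<T>" "\<And>S. S \<in> \<T> \<Longrightarrow> 0 \<le> d S"
    and eq: "\<And>v. v \<in> vertices P \<Longrightarrow> split_sum \<S> c v = split_sum \<T> d v + m \<bullet> v"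
    and R: "R \<in> \<S>" "0 < c R"
  shows "R \<in> \<T> \<and> d R = c R"
proof -
  have finite: "finite \<S>" "finite \<T>" using S(1) T(1) by (auto simp: compatible_family_def)
  have RX: "R \<in> X" using R S(1) by (auto simp: compatible_family_def)
  \<comment> \<open>Equality at vertices extends to P by the lower hull estimate in both directions,
    with the linear term moved across.\<close>
  have eqP: "split_sum \<S> c x = split_sum \<T> d x + m \<bullet> x" if "x \<in> P" for x
  proof (rule antisym)
    show "split_sum \<S> c x \<le> split_sum \<T> d x + m \<bullet> x"
      using split_sum_le_from_vertices[OF T(1), of \<S> c "- m" d x] S(2) eq that by auto
    show "split_sum \<T> d x + m \<bullet> x \<le> split_sum \<S> c x"
      using split_sum_le_from_vertices[OF S(1), of \<T> d m c x] T(2) eq that by auto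
  qed
  obtain x where x: "x \<in> rel_interior P" "a R \<bullet> x = 0" using split_rel_interior_point[OF RX] .
  let ?D = "\<lambda>\<S> c y. \<Sum>S\<in>{S\<in>\<S>. a S \<bullet> x = 0}. c S * \<bar>a S \<bullet> y\<bar>"
  have D: "?D \<S> c y = ?D \<T> d y" if y: "y \<in> P" for y
  proof -
    obtain e1 where e1: "e1 > 0" "\<forall>t. 0 \<le> t \<and> t \<le> e1 \<longrightarrow>
      split_sum \<S> c (x + t *\<^sub>R (y - x)) + split_sum \<S> c (x - t *\<^sub>R (y - x)) - 2 * split_sum \<S> c x
      = t * ?D \<S> c y"
      using split_sum_second_difference[OF finite(1) x(1) y, of c] by blast
    obtain e2 where e2: "e2 > 0" "\<forall>t. 0 \<le> t \<and> t \<le> e2 \<longrightarrow>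
      split_sum \<T> d (x + t *\<^sub>R (y - x)) + split_sum \<T> d (x - t *\<^sub>R (y - x)) - 2 * split_sum \<T> d x
      = t * ?D \<T> d y"
      using split_sum_second_difference[OF finite(2) x(1) y, of d] by blast
    obtain e3 where e3: "e3 > 0" "\<And>t. \<bar>t\<bar> \<le> e3 \<Longrightarrow> x + t *\<^sub>R (y - x) \<in> P"
      using convex_prolong_through_rel_interior[OF x(1) y] by blast
    define t where "t = min e1 (min e2 e3)"
    have t: "0 < t" "t \<le> e1" "t \<le> e2" "t \<le> e3" using e1(1) e2(1) e3(1) by (auto simp: t_def)
    have P: "x + t *\<^sub>R (y - x) \<in> P" "x - t *\<^sub>R (y - x) \<in> P" "x \<in> P"
      using e3(2)[of t] e3(2)[of "- t"] e3(2)[of 0] t by auto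
    have "t * ?D \<S> c y = t * ?D \<T> d y"
      using e1(2)[rule_format, of t] e2(2)[rule_format, of t] t eqP[OF P(1)] eqP[OF P(2)] eqP[OF P(3)]
      unfolding inner_add_right inner_diff_right by linarith
    then show ?thesis using t by simp
  qed
  have DS: "?D \<S> c y = c R * \<bar>a R \<bullet> y\<bar>" for y
    using compatible_family_at_point[OF S(1) R(1) x] by simp
  \<comment> \<open>Without a hyperplane of \<T> through x the right-hand function would have no
    kink at x, although c R > 0 gives the left one a kink.\<close>
  have "\<exists>T\<in>\<T>. a T \<bullet> x = 0"
  proof (rule ccontr)
    assume "\<not> ?thesis"
    then have "{S\<in>\<T>. a S \<bullet> x = 0} = {}" by auto
    then have "?D \<T> d y = 0" for y by (simp only: sum.empty)
    then have "c R * \<bar>a R \<bullet> y\<bar> = 0" if "y \<in> P" for y using D[OF that] unfolding DS by simp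
    then show False using split_pos[OF RX] R(2) by fastforce
  qed
  then obtain T' where T': "T' \<in> \<T>" "a T' \<bullet> x = 0" by auto
  have DT: "?D \<T> d y = d T' * \<bar>a T' \<bullet> y\<bar>" for y
    using compatible_family_at_point[OF T(1) T'(1) x(1) T'(2)] by simp
  have cd: "c R * \<bar>a R \<bullet> y\<bar> = d T' * \<bar>a T' \<bullet> y\<bar>" if "y \<in> P" for y
    using D[OF that] unfolding DS DT .
  obtain p where p: "p \<in> P" "0 < a R \<bullet> p" using split_pos[OF RX] by auto
  have "0 < c R * \<bar>a R \<bullet> p\<bar>" using p(2) R(2) by simp
  then have "d T' \<noteq> 0" using cd[OF p(1)] by auto
  then have dT: "d T' > 0" using T(2)[OF T'(1)] by simp
  \<comment> \<open>Equal kinks make the two forms proportional in absolute value on P, which is the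
    hypothesis of \<open>split_unique\<close>.\<close>
  have "c R / d T' * \<bar>a R \<bullet> y\<bar> = \<bar>a T' \<bullet> y\<bar>" if "y \<in> P" for y
    using cd[OF that] dT by (simp add: field_simps)
  moreover have "T' \<in> X" using T'(1) T(1) by (auto simp: compatible_family_def)
  ultimately have "R = T'"
    using split_unique[OF RX, of T' "c R / d T'"] R(2) dT by simp
  then show ?thesis using T'(1) cd[OF p(1)] p(2) by simp
qed

end

section \<open>Weights inducing the subdivision of compatible splits\<close>

lemma tie_set_add_linear:
  "tie_set V (\<lambda>v. \<omega> v + l \<bullet> v) E \<longleftrightarrow> tie_set V \<omega> E"
proof -
  have *: "tie_set V (\<lambda>v. \<omega> v + l \<bullet> v) E" if "tie_set V \<omega> E" for \<omega> l
  proof -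
    obtain m b where "\<forall>v\<in>V. m \<bullet> v + b \<le> \<omega> v" "E = {v\<in>V. \<omega> v = m \<bullet> v + b}"
      using \<open>tie_set V \<omega> E\<close> by (auto simp: tie_set_def)
    then show ?thesis
      unfolding tie_set_def by (intro exI[of _ "m + l"] exI[of _ b]) (auto simp: inner_add_left)
  qed
  show ?thesis
  proof
    assume "tie_set V (\<lambda>v. \<omega> v + l \<bullet> v) E"
    from *[OF this, of "- l"] show "tie_set V \<omega> E" by simp
  qed (rule *)
qed

text \<open>With c the projection coefficient, n - c a lies in the kernel of a, hence in that of n,
  and is therefore orthogonal to itself.\<close>

lemma linear_form_multiple:
  fixes a n :: "'a::euclidean_space"
  assumes "\<And>x. a \<bullet> x = 0 \<Longrightarrow> n \<bullet> x = 0"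
  obtains c where "n = c *\<^sub>R a"
proof (cases "a = 0")
  case True
  then have "n \<bullet> n = 0" using assms by simp
  then show ?thesis using that[of 0] by simp
next
  case False
  define c where "c = (n \<bullet> a) / (a \<bullet> a)"
  let ?w = "n - c *\<^sub>R a"
  have "a \<bullet> ?w = 0"
    using False by (simp add: c_def inner_diff_right inner_commute)
  then have "?w \<bullet> ?w = 0"
    using assms[of ?w] by (simp add: inner_diff_left)
  then show ?thesis using that[of c] by simp
qed

context split_system
begin

text \<open>The constant b of a minorant is absorbed as b (u . v), since u . v = 1 on P.\<close>

lemma tie_set_linear:
  assumes "tie_set (vertices P) \<omega> E"
  obtains m where "\<And>v. v \<in> vertices P \<Longrightarrow> m \<bullet> v \<le> \<omega> v"
    "E = {v\<in>vertices P. \<omega> v = m \<bullet> v}"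
proof -
  obtain m b where mb: "\<And>v. v \<in> vertices P \<Longrightarrow> m \<bullet> v + b \<le> \<omega> v"
    "E = {v\<in>vertices P. \<omega> v = m \<bullet> v + b}"
    using assms by (auto simp: tie_set_def)
  have "(m + b *\<^sub>R u) \<bullet> v = m \<bullet> v + b" if "v \<in> vertices P" for v
    using level[of v] that vertices_subset by (auto simp: inner_add_left)
  then have "(m + b *\<^sub>R u) \<bullet> v \<le> \<omega> v" "\<omega> v = (m + b *\<^sub>R u) \<bullet> v \<longleftrightarrow> \<omega> v = m \<bullet> v + b"
    if "v \<in> vertices P" for v
    using mb(1)[OF that] that by simp_all
  then show ?thesis using that[of "m + b *\<^sub>R u"] mb(2) by blast
qed

lemma tie_set_linearI:
  assumes "\<And>v. v \<in> vertices P \<Longrightarrow> m \<bullet> v \<le> \<omega> v"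
  shows "tie_set (vertices P) \<omega> {v\<in>vertices P. \<omega> v = m \<bullet> v}"
  unfolding tie_set_def using assms by (intro exI[of _ m] exI[of _ 0]) auto

lemma tie_set_chamber:
  assumes "finite \<S>" "\<And>S. S \<in> \<S> \<Longrightarrow> 0 < c S" "sign_vector \<sigma>"
  shows "tie_set (vertices P) (split_sum \<S> c) (vertices P \<inter> chamber \<S> \<sigma>)"
proof -
  have "chamber_normal \<S> c \<sigma> \<bullet> v \<le> split_sum \<S> c v" for v
    using split_sum_ge_chamber_normal[OF assms(3)] assms(2) by (simp add: less_imp_le)
  from tie_set_linearI[OF this]
  have "tie_set (vertices P) (split_sum \<S> c)
      {v\<in>vertices P. split_sum \<S> c v = chamber_normal \<S> c \<sigma> \<bullet> v}" .
  also have "{v\<in>vertices P. split_sum \<S> c v = chamber_normal \<S> c \<sigma> \<bullet> v} =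
      vertices P \<inter> chamber \<S> \<sigma>"
    using split_sum_eq_chamber_normal[OF assms(3), of _ \<S> c] vertices_subset
      split_sum_gt_chamber_normal[OF assms(1,3,2)] by fastforce
  finally show ?thesis .
qed

text \<open>Two points of E strictly on opposite sides of a split would push the convex sum at their
  midpoint strictly below the minorant m, which is valid on all of P.\<close>

lemma tie_set_within_chamber:
  assumes fam: "compatible_family \<S>" and pos: "\<And>S. S \<in> \<S> \<Longrightarrow> 0 < c S"
    and tie: "tie_set (vertices P) (split_sum \<S> c) E"
  obtains \<sigma> where "sign_vector \<sigma>" "E \<subseteq> chamber \<S> \<sigma>"
proof -
  obtain m where m: "\<And>v. v \<in> vertices P \<Longrightarrow> m \<bullet> v \<le> split_sum \<S> c v"
    and E: "E = {v\<in>vertices P. split_sum \<S> c v = m \<bullet> v}"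
    using tie_set_linear[OF tie] by blast
  \<comment> \<open>With the empty family on the left, the vertex comparison says that m is a
    minorant on all of P.\<close>
  have m': "m \<bullet> x \<le> split_sum \<S> c x" if "x \<in> P" for x
    using split_sum_le_from_vertices[OF fam, of "{}" "\<lambda>_. 0" m c x] m that by (simp add: split_sum_def)
  have same: False
    if S: "S \<in> \<S>" and v: "v \<in> E" "0 < a S \<bullet> v" and v': "v' \<in> E" "a S \<bullet> v' < 0" for S v v'
  proof -
    define z where "z = (1/2) *\<^sub>R v + (1/2) *\<^sub>R v'"
    have "z \<in> P"
      unfolding z_def using v v' vertices_subset by (intro convexD[OF convex_P]) (auto simp: E)
    have zi: "b \<bullet> z = (b \<bullet> v + b \<bullet> v') / 2" for b
      by (simp add: z_def inner_add_right)
    have "split_sum \<S> c z < (\<Sum>S\<in>\<S>. (c S * max 0 (a S \<bullet> v) + c S * max 0 (a S \<bullet> v')) / 2)"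
      unfolding split_sum_def
    proof (rule sum_strict_mono_ex1)
      show "finite \<S>" using fam by (simp add: compatible_family_def)
      show "\<forall>S\<in>\<S>. c S * max 0 (a S \<bullet> z) \<le> (c S * max 0 (a S \<bullet> v) + c S * max 0 (a S \<bullet> v')) / 2"
      proof
        fix S assume "S \<in> \<S>"
        have "max 0 (a S \<bullet> z) \<le> (max 0 (a S \<bullet> v) + max 0 (a S \<bullet> v')) / 2"
          by (auto simp: zi max_def)
        from mult_left_mono[OF this less_imp_le[OF pos[OF \<open>S \<in> \<S>\<close>]]]
        show "c S * max 0 (a S \<bullet> z) \<le> (c S * max 0 (a S \<bullet> v) + c S * max 0 (a S \<bullet> v')) / 2"
          by (simp add: algebra_simps)
      qed
      have "max 0 (a S \<bullet> z) < (max 0 (a S \<bullet> v) + max 0 (a S \<bullet> v')) / 2"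
        using v v' by (auto simp: zi max_def)
      from mult_strict_left_mono[OF this pos[OF S]]
      show "\<exists>S\<in>\<S>. c S * max 0 (a S \<bullet> z) < (c S * max 0 (a S \<bullet> v) + c S * max 0 (a S \<bullet> v')) / 2"
        by (intro bexI[OF _ S]) (simp add: algebra_simps)
    qed
    also have "\<dots> = (split_sum \<S> c v + split_sum \<S> c v') / 2"
      by (simp add: split_sum_def sum.distrib flip: sum_divide_distrib)
    also have "\<dots> = m \<bullet> z" using v v' by (simp add: zi E)
    finally show False using m'[OF \<open>z \<in> P\<close>] by simp
  qed
  \<comment> \<open>A split with no point of E on its negative side gets the sign 1, also if E lies
    in its hyperplane.\<close>
  define \<sigma> :: "'i \<Rightarrow> real" where "\<sigma> S = (if \<exists>v\<in>E. a S \<bullet> v < 0 then - 1 else 1)" for S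
  show ?thesis
  proof
    show "sign_vector \<sigma>" by (auto simp: sign_vector_def \<sigma>_def)
    show "E \<subseteq> chamber \<S> \<sigma>"
      using same vertices_subset by (fastforce simp: chamber_def \<sigma>_def E not_less)
  qed
qed

text \<open>The linear function realising the tie set for \<open>d\<close> is the one of the chamber, perturbed by
  a small multiple of the functional cutting out the tie set for \<open>c\<close> in the chamber.\<close>

lemma tie_set_positive_coefficients:
  assumes fam: "compatible_family \<S>"
    and c: "\<And>S. S \<in> \<S> \<Longrightarrow> 0 < c S" and d: "\<And>S. S \<in> \<S> \<Longrightarrow> 0 < d S"
    and tie: "tie_set (vertices P) (split_sum \<S> c) E"
  shows "tie_set (vertices P) (split_sum \<S> d) E"
proof -
  have fin: "finite \<S>" using fam by (simp add: compatible_family_def)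
  obtain \<sigma> where \<sigma>: "sign_vector \<sigma>" "E \<subseteq> chamber \<S> \<sigma>"
    using tie_set_within_chamber[OF fam c tie] .
  obtain m where m: "\<And>v. v \<in> vertices P \<Longrightarrow> m \<bullet> v \<le> split_sum \<S> c v"
    and E: "E = {v\<in>vertices P. split_sum \<S> c v = m \<bullet> v}"
    using tie_set_linear[OF tie] by blast
  define n where "n = m - chamber_normal \<S> c \<sigma>"
  let ?p = "\<lambda>v. split_sum \<S> d v - chamber_normal \<S> d \<sigma> \<bullet> v"
  have n: "n \<bullet> v \<le> 0" "n \<bullet> v = 0 \<longleftrightarrow> v \<in> E" if "v \<in> vertices P \<inter> chamber \<S> \<sigma>" for v
    using m[of v] that split_sum_eq_chamber_normal[OF \<sigma>(1), of v \<S> c]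
    by (auto simp: n_def inner_diff_left E)
  have p: "?p v = 0" if "v \<in> chamber \<S> \<sigma>" for v
    using split_sum_eq_chamber_normal[OF \<sigma>(1) that] by simp
  have "0 < ?p v" if "v \<in> vertices P - chamber \<S> \<sigma>" for v
    using split_sum_gt_chamber_normal[OF fin \<sigma>(1) d, where x = v] that vertices_subset by auto
  then obtain e where e: "e > 0"
      "\<And>v t. v \<in> vertices P - chamber \<S> \<sigma> \<Longrightarrow> \<bar>t\<bar> \<le> e \<Longrightarrow> t * (n \<bullet> v) < ?p v"
    using exists_small_scaling[of "vertices P - chamber \<S> \<sigma>" ?p "\<lambda>v. n \<bullet> v"] finite_vertices
    by auto
  let ?m = "chamber_normal \<S> d \<sigma> + e *\<^sub>R n"
  have off: "?m \<bullet> v < split_sum \<S> d v" if "v \<in> vertices P - chamber \<S> \<sigma>" for v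
    using e(2)[OF that, of e] e(1) by (simp add: inner_add_left)
  have on: "?m \<bullet> v \<le> split_sum \<S> d v" "split_sum \<S> d v = ?m \<bullet> v \<longleftrightarrow> v \<in> E"
    if "v \<in> vertices P \<inter> chamber \<S> \<sigma>" for v
    using n[OF that] p[of v] that e(1) by (auto simp: inner_add_left mult_le_0_iff)
  have "?m \<bullet> v \<le> split_sum \<S> d v" if "v \<in> vertices P" for v
    using off[of v] on(1)[of v] that by force
  from tie_set_linearI[OF this]
  have "tie_set (vertices P) (split_sum \<S> d) {v\<in>vertices P. split_sum \<S> d v = ?m \<bullet> v}" .
  also have "{v\<in>vertices P. split_sum \<S> d v = ?m \<bullet> v} = E"
    using off on(2) \<sigma>(2) E by force
  finally show ?thesis .
qed

text \<open>Singles out the chamber \<tau> of the other splits that the hyperplane of S crosses: at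
  a relative interior point of P on it, compatibility keeps every other form nonzero.\<close>

lemma split_base_point:
  assumes fam: "compatible_family (insert S \<S>)" and S: "S \<notin> \<S>"
  obtains x \<tau> where "x \<in> rel_interior P" "a S \<bullet> x = 0" "sign_vector \<tau>"
    "\<And>T. T \<in> \<S> \<Longrightarrow> 0 < \<tau> T * (a T \<bullet> x)"
proof -
  have "S \<in> X" using fam by (auto simp: compatible_family_def)
  then obtain x where x: "x \<in> rel_interior P" "a S \<bullet> x = 0" using split_rel_interior_point by blast
  define \<tau> :: "'i \<Rightarrow> real" where "\<tau> T = (if 0 \<le> a T \<bullet> x then 1 else -1)" for T
  have "sign_vector \<tau>" by (auto simp: sign_vector_def \<tau>_def)
  moreover have "0 < \<tau> T * (a T \<bullet> x)" if "T \<in> \<S>" for T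
    using compatible_family_at_point[OF fam _ x] that S by (fastforce simp: \<tau>_def)
  ultimately show ?thesis using that x by blast
qed

text \<open>By induction on the number of splits. The jump \<open>c\<close> across the hyperplane of one split \<open>S\<close>
  is the same everywhere, because that hyperplane only meets a single chamber \<open>\<tau>\<close> of the others;
  subtracting it makes \<open>g\<close> linear on the chambers of the other splits.\<close>

lemma linear_on_chambers_decomposition:
  assumes "finite \<S>" "compatible_family \<S>"
    and "\<And>\<sigma>. sign_vector \<sigma> \<Longrightarrow> \<exists>m. \<forall>v\<in>vertices P \<inter> chamber \<S> \<sigma>. g v = m \<bullet> v"
  shows "\<exists>c m. \<forall>v\<in>vertices P. g v = split_sum \<S> c v + m \<bullet> v"
  using assms
proof (induction \<S> arbitrary: g rule: finite_induct)
  case empty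
  have "sign_vector (\<lambda>_. 1)" by (simp add: sign_vector_def)
  from empty.prems(2)[OF this] obtain m where "\<forall>v\<in>vertices P \<inter> chamber {} (\<lambda>_. 1). g v = m \<bullet> v" ..
  then show ?case
    using vertices_subset by (intro exI[of _ "\<lambda>_. 0"] exI[of _ m]) (auto simp: chamber_def split_sum_def)
next
  case (insert S \<S>)
  have SX: "S \<in> X" "\<S> \<subseteq> X" and comp: "\<And>T. T \<in> \<S> \<Longrightarrow> compatible S T"
    using insert.prems(1) insert.hyps by (auto simp: compatible_family_def pairwise_insert)
  obtain x \<tau> where x: "x \<in> rel_interior P" "a S \<bullet> x = 0" and \<tau>: "sign_vector \<tau>"
    and pos: "\<And>T. T \<in> \<S> \<Longrightarrow> 0 < \<tau> T * (a T \<bullet> x)"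
    using split_base_point[OF insert.prems(1) insert.hyps(2)] by blast
  have xP: "x \<in> P" using x rel_interior_subset by blast
  \<comment> \<open>At x the form of S vanishes, so the nesting inequality makes t agree in sign
    with \<open>\<tau> T\<close>.\<close>
  have nested: "\<exists>s t. s \<noteq> 0 \<and> 0 < \<tau> T * t \<and> (\<forall>x\<in>P. 0 \<le> s * (a S \<bullet> x) + t * (a T \<bullet> x))"
    if T: "T \<in> \<S>" for T
  proof -
    obtain s t where st: "s \<noteq> 0" "t \<noteq> 0" "\<And>x. x \<in> P \<Longrightarrow> 0 \<le> s * (a S \<bullet> x) + t * (a T \<bullet> x)"
      using compatible_nested[OF SX(1) _ comp[OF T]] SX T by blast
    have "0 \<le> t * (a T \<bullet> x)" using st(3)[OF xP] x by simp
    then have "0 < \<tau> T * t"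
      using pos[OF T] st(2) by (auto simp: zero_less_mult_iff zero_le_mult_iff)
    then show ?thesis using st by blast
  qed
  define hi lo where "hi = \<tau>(S := 1)" and "lo = \<tau>(S := -1)"
  have sv: "sign_vector hi" "sign_vector lo"
    using \<tau> by (auto simp: sign_vector_def hi_def lo_def)
  \<comment> \<open>Where the form of S vanishes, nesting gives all other forms the signs \<tau>, so
    the whole section borders both chambers.\<close>
  have face: "P \<inter> {x. a S \<bullet> x = 0} \<subseteq> chamber (insert S \<S>) hi \<inter> chamber (insert S \<S>) lo"
  proof -
    have "0 \<le> \<tau> T * (a T \<bullet> y)" if y: "y \<in> P" "a S \<bullet> y = 0" and T: "T \<in> \<S>" for y T
    proof -
      obtain s t where "0 < \<tau> T * t" "0 \<le> s * (a S \<bullet> y) + t * (a T \<bullet> y)"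
        using nested[OF T] y(1) by blast
      then show ?thesis using y(2) by (auto simp: zero_less_mult_iff zero_le_mult_iff)
    qed
    then show ?thesis using insert.hyps(2) by (auto simp: chamber_def hi_def lo_def)
  qed
  obtain m1 where m1: "\<And>v. v \<in> vertices P \<inter> chamber (insert S \<S>) hi \<Longrightarrow> g v = m1 \<bullet> v"
    using insert.prems(2)[OF sv(1)] by blast
  obtain m2 where m2: "\<And>v. v \<in> vertices P \<inter> chamber (insert S \<S>) lo \<Longrightarrow> g v = m2 \<bullet> v"
    using insert.prems(2)[OF sv(2)] by blast
  \<comment> \<open>The two linear pieces agree at the vertices of the section, which are vertices
    of P, hence on its hull and then on its span, the full hyperplane.\<close>
  have "P \<inter> {x. a S \<bullet> x = 0} \<subseteq> {x. (m1 - m2) \<bullet> x = 0}"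
  proof -
    let ?F = "P \<inter> {x. a S \<bullet> x = 0}"
    have F: "convex ?F" "compact ?F"
      by (auto intro!: convex_Int convex_P convex_hyperplane compact_Int_closed compact_P closed_hyperplane)
    have "vertices ?F \<subseteq> {x. (m1 - m2) \<bullet> x = 0}"
    proof
      fix v assume v: "v \<in> vertices ?F"
      then have "v \<in> ?F" "v \<in> vertices P"
        using split_vertices[OF SX(1)] by (auto simp: vertices_def extreme_point_of_def)
      moreover from this have "v \<in> chamber (insert S \<S>) hi" "v \<in> chamber (insert S \<S>) lo"
        using face by blast+
      ultimately show "v \<in> {x. (m1 - m2) \<bullet> x = 0}"
        using m1[of v] m2[of v] by (auto simp: inner_diff_left)
    qed
    then have "convex hull (vertices ?F) \<subseteq> {x. (m1 - m2) \<bullet> x = 0}"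
      by (rule hull_minimal) (rule convex_hyperplane)
    then show ?thesis
      unfolding vertices_def using Krein_Milman_Minkowski[OF F(2,1)] by simp
  qed
  then have "span (P \<inter> {x. a S \<bullet> x = 0}) \<subseteq> {x. (m1 - m2) \<bullet> x = 0}"
    by (rule span_minimal) (rule subspace_hyperplane)
  then obtain c where c: "m1 - m2 = c *\<^sub>R a S"
    using linear_form_multiple[of "a S" "m1 - m2"] unfolding split_span[OF SX(1)] by blast
  define h where "h v = g v - c * max 0 (a S \<bullet> v)" for v
  have "\<exists>d m. \<forall>v\<in>vertices P. h v = split_sum \<S> d v + m \<bullet> v"
  proof (rule insert.IH)
    show "compatible_family \<S>" using compatible_family_subset[OF insert.prems(1)] by blast
    fix \<sigma> assume \<sigma>: "sign_vector \<sigma>"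
    show "\<exists>m. \<forall>v\<in>vertices P \<inter> chamber \<S> \<sigma>. h v = m \<bullet> v"
    proof (cases "\<forall>T\<in>\<S>. \<sigma> T = \<tau> T")
      case True
      \<comment> \<open>In the crossed chamber the correction turns the piece m1 on the positive
        side into m2, so one linear form serves both sides.\<close>
      have "h v = m2 \<bullet> v" if v: "v \<in> vertices P" "v \<in> chamber \<S> \<sigma>" for v
      proof (cases "0 \<le> a S \<bullet> v")
        case pos: True
        then have "v \<in> chamber (insert S \<S>) hi"
          using v True insert.hyps(2) by (auto simp: chamber_def hi_def)
        then have "h v = m1 \<bullet> v - c * (a S \<bullet> v)" using m1[of v] v pos by (simp add: h_def)
        also have "\<dots> = m1 \<bullet> v - (m1 - m2) \<bullet> v" by (simp add: c)
        finally show ?thesis by (simp add: inner_diff_left)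
      next
        case False
        then have "v \<in> chamber (insert S \<S>) lo"
          using v True insert.hyps(2) by (auto simp: chamber_def lo_def)
        then show ?thesis using m2[of v] v False by (simp add: h_def)
      qed
      then show ?thesis by blast
    next
      case False
      then obtain T where T: "T \<in> \<S>" "\<sigma> T \<noteq> \<tau> T" by blast
      then have opp: "\<sigma> T = - \<tau> T" using \<sigma> \<tau> by (metis sign_vector_def minus_minus)
      obtain s t where st: "s \<noteq> 0" "0 < \<tau> T * t"
          "\<forall>x\<in>P. 0 \<le> s * (a S \<bullet> x) + t * (a T \<bullet> x)" using nested[OF T(1)] by blast
      \<comment> \<open>Beyond another split T, nesting pins the form of S to the sign of s: the
        hyperplane of S does not cut this chamber.\<close>
      have side: "0 \<le> s * (a S \<bullet> v)" if "v \<in> chamber \<S> \<sigma>" for v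
      proof -
        have "\<tau> T * (a T \<bullet> v) \<le> 0" "v \<in> P" using that T opp by (auto simp: chamber_def)
        then have "t * (a T \<bullet> v) \<le> 0"
          using st(2) by (auto simp: zero_less_mult_iff mult_le_0_iff)
        then show ?thesis using st(3) \<open>v \<in> P\<close> by force
      qed
      define \<sigma>' where "\<sigma>' = \<sigma>(S := sgn s)"
      have "sign_vector \<sigma>'" using \<sigma> st(1) by (auto simp: sign_vector_def \<sigma>'_def sgn_if)
      then obtain m where m: "\<forall>v\<in>vertices P \<inter> chamber (insert S \<S>) \<sigma>'. g v = m \<bullet> v"
        using insert.prems(2) by blast
      have sub: "chamber \<S> \<sigma> \<subseteq> chamber (insert S \<S>) \<sigma>'"
        using side st(1) insert.hyps(2)
        by (fastforce simp: chamber_def \<sigma>'_def sgn_if zero_le_mult_iff)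
      have "h v = (m - (if 0 < s then c else 0) *\<^sub>R a S) \<bullet> v"
        if v: "v \<in> vertices P" "v \<in> chamber \<S> \<sigma>" for v
        using m sub v side[OF v(2)] st(1)
        by (auto simp: h_def inner_diff_left zero_le_mult_iff max_def)
      then show ?thesis by blast
    qed
  qed
  then obtain d m where dm: "\<And>v. v \<in> vertices P \<Longrightarrow> h v = split_sum \<S> d v + m \<bullet> v" by blast
  define d' where "d' = d(S := c)"
  have "split_sum (insert S \<S>) d' v = c * max 0 (a S \<bullet> v) + split_sum \<S> d v" for v
    using insert.hyps by (auto simp: split_sum_def d'_def intro!: sum.cong)
  then have "\<forall>v\<in>vertices P. g v = split_sum (insert S \<S>) d' v + m \<bullet> v"
    using dm by (simp add: h_def algebra_simps)
  then show ?case by blast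
qed

text \<open>The linear form n that is exact on the chamber on the negative side of S lies strictly
  below the extension G of g at p on the positive side. So the second difference at x is positive,
  and it is a positive multiple of c S.\<close>

lemma coefficient_pos_of_tie_sets:
  assumes fam: "compatible_family \<S>" and S: "S \<in> \<S>"
    and g: "\<And>v. v \<in> vertices P \<Longrightarrow> g v = split_sum \<S> c v + m \<bullet> v"
    and tie: "\<And>\<sigma>. sign_vector \<sigma> \<Longrightarrow> tie_set (vertices P) g (vertices P \<inter> chamber \<S> \<sigma>)"
  shows "0 < c S"
proof -
  have SX: "S \<in> X" and fin: "finite \<S>" using fam S by (auto simp: compatible_family_def)
  have ins: "insert S (\<S> - {S}) = \<S>" using S by auto
  obtain x \<tau> where x: "x \<in> rel_interior P" "a S \<bullet> x = 0" and \<tau>: "sign_vector \<tau>"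
    and pos: "\<And>T. T \<in> \<S> - {S} \<Longrightarrow> 0 < \<tau> T * (a T \<bullet> x)"
    using split_base_point[of S "\<S> - {S}"] fam unfolding ins by blast
  have xP: "x \<in> P" using x rel_interior_subset by blast
  obtain y where y: "y \<in> P" "0 < a S \<bullet> y" using split_pos[OF SX] by blast
  obtain e1 where e1: "e1 > 0" "\<And>T t. T \<in> \<S> - {S} \<Longrightarrow> \<bar>t\<bar> \<le> e1 \<Longrightarrow>
      t * - (\<tau> T * (a T \<bullet> (y - x))) < \<tau> T * (a T \<bullet> x)"
    using exists_small_scaling[of "\<S> - {S}" "\<lambda>T. \<tau> T * (a T \<bullet> x)" "\<lambda>T. - (\<tau> T * (a T \<bullet> (y - x)))"]
      fin pos by blast
  obtain e2 where e2: "e2 > 0" "\<forall>t. 0 \<le> t \<and> t \<le> e2 \<longrightarrow>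
      split_sum \<S> c (x + t *\<^sub>R (y - x)) + split_sum \<S> c (x - t *\<^sub>R (y - x)) - 2 * split_sum \<S> c x
      = t * (\<Sum>S\<in>{S\<in>\<S>. a S \<bullet> x = 0}. c S * \<bar>a S \<bullet> y\<bar>)"
    using split_sum_second_difference[OF fin x(1) y(1), of c] by blast
  obtain e3 where e3: "e3 > 0" "\<And>t. \<bar>t\<bar> \<le> e3 \<Longrightarrow> x + t *\<^sub>R (y - x) \<in> P"
    using convex_prolong_through_rel_interior[OF x(1) y(1)] by blast
  define t where "t = min e1 (min e2 e3)"
  have t: "0 < t" "t \<le> e1" "t \<le> e2" "t \<le> e3" using e1(1) e2(1) e3(1) by (auto simp: t_def)
  define p q where "p = x + t *\<^sub>R (y - x)" and "q = x - t *\<^sub>R (y - x)"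
  define hi lo where "hi = \<tau>(S := 1)" and "lo = \<tau>(S := -1)"
  have sv: "sign_vector hi" "sign_vector lo"
    using \<tau> by (auto simp: sign_vector_def hi_def lo_def)
  have pq: "p \<in> P" "q \<in> P" using e3(2)[of t] e3(2)[of "- t"] t by (auto simp: p_def q_def)
  have others: "0 \<le> \<tau> T * (a T \<bullet> p)" "0 \<le> \<tau> T * (a T \<bullet> q)" if "T \<in> \<S> - {S}" for T
    using e1(2)[OF that, of t] e1(2)[OF that, of "- t"] t
    by (auto simp: p_def q_def inner_add_right inner_diff_right algebra_simps)
  have Sp: "a S \<bullet> p > 0" "a S \<bullet> q < 0"
    using x y t by (auto simp: p_def q_def inner_add_right inner_diff_right)
  have p: "p \<in> chamber \<S> hi" and q: "q \<in> chamber \<S> lo" and xhl: "x \<in> chamber \<S> hi" "x \<in> chamber \<S> lo"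
    using pq others Sp xP x(2) pos by (auto simp: chamber_def hi_def lo_def less_imp_le)
  obtain n where n: "\<And>v. v \<in> vertices P \<Longrightarrow> n \<bullet> v \<le> g v"
    and lo: "vertices P \<inter> chamber \<S> lo = {v\<in>vertices P. g v = n \<bullet> v}"
    using tie_set_linear[OF tie[OF sv(2)]] by blast
  define G where "G z = split_sum \<S> c z + m \<bullet> z" for z
  have Glo: "G z = n \<bullet> z" if "z \<in> chamber \<S> lo" for z
  proof -
    let ?k = "chamber_normal \<S> c lo + m - n"
    have "vertices P \<inter> chamber \<S> lo \<subseteq> {z. ?k \<bullet> z = 0}"
    proof
      fix v assume v: "v \<in> vertices P \<inter> chamber \<S> lo"
      then have "g v = n \<bullet> v" using lo by blast
      then show "v \<in> {z. ?k \<bullet> z = 0}"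
        using v g[of v] split_sum_eq_chamber_normal[OF sv(2), of v \<S> c]
        by (simp add: inner_add_left inner_diff_left)
    qed
    then have "convex hull (vertices P \<inter> chamber \<S> lo) \<subseteq> {z. ?k \<bullet> z = 0}"
      by (rule hull_minimal) (rule convex_hyperplane)
    then have "?k \<bullet> z = 0" using that chamber_eq_convex_hull[OF fam, of lo] by blast
    then show ?thesis
      using split_sum_eq_chamber_normal[OF sv(2) that, of c]
      by (simp add: G_def inner_add_left inner_diff_left)
  qed
  have "n \<bullet> p < G p"
  proof -
    let ?k = "chamber_normal \<S> c hi + m - n" and ?E = "vertices P \<inter> chamber \<S> hi"
    have kv: "?k \<bullet> v = g v - n \<bullet> v" if "v \<in> ?E" for v
      using that g[of v] split_sum_eq_chamber_normal[OF sv(1), of v \<S> c]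
      by (simp add: inner_add_left inner_diff_left)
    have ge: "0 \<le> ?k \<bullet> v" if "v \<in> ?E" for v
      using kv[OF that] n[of v] that by simp
    have hull: "p \<in> convex hull ?E" using p chamber_eq_convex_hull[OF fam, of hi] by blast
    have "convex hull ?E \<subseteq> {z. 0 \<le> ?k \<bullet> z}"
      using ge by (intro hull_minimal convex_halfspace_ge) auto
    then have "0 \<le> ?k \<bullet> p" using hull by blast
    \<comment> \<open>Contact at p would write p as a combination of vertices in the tie set of the
      lower chamber, where the form of S is nonpositive.\<close>
    moreover have "?k \<bullet> p \<noteq> 0"
    proof
      assume "?k \<bullet> p = 0"
      then have "p \<in> convex hull (?E \<inter> {z. ?k \<bullet> z = 0})"
        using convex_hull_exposed_subset(1)[of ?E 0 ?k] finite_vertices ge hull by blast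
      moreover have "?E \<inter> {z. ?k \<bullet> z = 0} \<subseteq> {z. a S \<bullet> z \<le> 0}"
      proof
        fix v assume v: "v \<in> ?E \<inter> {z. ?k \<bullet> z = 0}"
        then have "g v = n \<bullet> v" using kv[of v] by simp
        then have "v \<in> chamber \<S> lo" using v lo by blast
        then show "v \<in> {z. a S \<bullet> z \<le> 0}" using S by (auto simp: chamber_def lo_def)
      qed
      then have "convex hull (?E \<inter> {z. ?k \<bullet> z = 0}) \<subseteq> {z. a S \<bullet> z \<le> 0}"
        by (rule hull_minimal) (rule convex_halfspace_le)
      ultimately show False using Sp(1) by force
    qed
    ultimately show ?thesis
      using split_sum_eq_chamber_normal[OF sv(1) p, of c]
      by (simp add: G_def inner_add_left inner_diff_left)
  qed
  moreover have "n \<bullet> p + n \<bullet> q - 2 * (n \<bullet> x) = 0" "m \<bullet> p + m \<bullet> q - 2 * (m \<bullet> x) = 0"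
    by (auto simp: p_def q_def inner_add_right inner_diff_right)
  ultimately have "0 < split_sum \<S> c p + split_sum \<S> c q - 2 * split_sum \<S> c x"
    using Glo[OF q] Glo[OF xhl(2)] unfolding G_def by linarith
  also have "\<dots> = t * (c S * \<bar>a S \<bullet> y\<bar>)"
    using e2(2)[rule_format, of t] t unfolding compatible_family_at_point[OF fam S x]
    by (simp add: p_def q_def)
  finally show ?thesis using t y by (simp add: zero_less_mult_iff)
qed

text \<open>Bounds the secondary cone from outside. Each chamber carries a tie set of g, so g is
  linear on its vertices and decomposes; tie sets also force positive coefficients.\<close>

lemma same_tie_sets_imp_positive_combination:
  assumes fam: "compatible_family \<S>" and c: "\<And>S. S \<in> \<S> \<Longrightarrow> 0 < c S"
    and same: "\<And>E. tie_set (vertices P) g E \<longleftrightarrow> tie_set (vertices P) (split_sum \<S> c) E"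
  obtains d m where "\<And>S. S \<in> \<S> \<Longrightarrow> 0 < d S"
    "\<And>v. v \<in> vertices P \<Longrightarrow> g v = split_sum \<S> d v + m \<bullet> v"
proof -
  have fin: "finite \<S>" using fam by (simp add: compatible_family_def)
  have tie: "tie_set (vertices P) g (vertices P \<inter> chamber \<S> \<sigma>)" if "sign_vector \<sigma>" for \<sigma>
    using tie_set_chamber[OF fin c that] by (simp add: same)
  have "\<exists>m. \<forall>v\<in>vertices P \<inter> chamber \<S> \<sigma>. g v = m \<bullet> v" if \<sigma>: "sign_vector \<sigma>" for \<sigma>
  proof -
    obtain m where "vertices P \<inter> chamber \<S> \<sigma> = {v\<in>vertices P. g v = m \<bullet> v}"
      using tie_set_linear[OF tie[OF \<sigma>]] by metis
    then show ?thesis by blast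
  qed
  then obtain d m where dm: "\<And>v. v \<in> vertices P \<Longrightarrow> g v = split_sum \<S> d v + m \<bullet> v"
    using linear_on_chambers_decomposition[OF fin fam, of g] by blast
  have "0 < d S" if "S \<in> \<S>" for S
    using coefficient_pos_of_tie_sets[OF fam that dm tie] .
  then show ?thesis using that dm by blast
qed

end

section \<open>The exchange property\<close>

lemma sum_swap_one:
  fixes f :: "'a \<Rightarrow> real"
  assumes "finite A" "i \<in> A" "j \<notin> A"
  shows "sum f (insert j (A - {i})) = sum f A + f j - f i"
  using assms by (simp add: sum_diff1)

text \<open>The exchange element for \<open>a\<close> is \<open>\<pi> a\<close>, where \<open>\<pi>\<close> is a bijection from \<open>A - B\<close> to \<open>B - A\<close>
  minimising the total violation of the constraints that are tight at \<open>A\<close>. If there were a violation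
  at \<open>i0\<close>, some \<open>i1\<close> would compensate for it, and swapping the images of \<open>i0\<close> and \<open>i1\<close> would
  decrease the total: in the octahedron spanned by \<open>A\<close> and the two exchanges, a constraint for which
  the swap is worse would cross the violated one at the centre, against \<open>nested\<close>.\<close>

lemma exchange_of_nested_halfspaces:
  fixes \<beta> :: "'i \<Rightarrow> 'n::finite \<Rightarrow> real" and k :: nat
  assumes fin: "finite \<T>"
    and nocut: "\<And>T A i j. T \<in> \<T> \<Longrightarrow> card A = k \<Longrightarrow> i \<in> A \<Longrightarrow> j \<notin> A \<Longrightarrow>
        0 \<le> sum (\<beta> T) A * sum (\<beta> T) (insert j (A - {i}))"
    and nested: "\<And>T T'. T \<in> \<T> \<Longrightarrow> T' \<in> \<T> \<Longrightarrow> T \<noteq> T' \<Longrightarrow>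
        \<exists>s t. s \<noteq> 0 \<and> t \<noteq> 0 \<and> (\<forall>A. card A = k \<longrightarrow> 0 \<le> s * sum (\<beta> T) A + t * sum (\<beta> T') A)"
    and A: "card A = k" "\<And>T. T \<in> \<T> \<Longrightarrow> 0 \<le> sum (\<beta> T) A"
    and B: "card B = k" "\<And>T. T \<in> \<T> \<Longrightarrow> 0 \<le> sum (\<beta> T) B"
    and a: "a \<in> A - B"
  shows "\<exists>b\<in>B - A. card (insert b (A - {a})) = k \<and>
      (\<forall>T\<in>\<T>. 0 \<le> sum (\<beta> T) (insert b (A - {a})))"
proof -
  \<comment> \<open>Constraints with slack at A are left aside: an exchange is a step along an edge,
    where \<open>nocut\<close> excludes a change of sign.\<close>
  define \<T>' where "\<T>' = {T\<in>\<T>. sum (\<beta> T) A = 0}"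
  have card_swap: "card (insert j (A' - {i})) = k" if "card A' = k" "i \<in> A'" "j \<notin> A'" for A' :: "'n set" and i j
    using that card_Suc_Diff1[of A' i] by simp
  have val: "sum (\<beta> T) (insert j (A - {i})) = \<beta> T j - \<beta> T i"
    if "T \<in> \<T>'" "i \<in> A" "j \<notin> A" for T i j
    using that sum_swap_one[of A i j "\<beta> T"] by (simp add: \<T>'_def)
  define bad where
    "bad \<pi> = (\<Sum>T\<in>\<T>'. \<Sum>i\<in>A - B. max 0 (\<beta> T i - \<beta> T (\<pi> i)))" for \<pi> :: "'n \<Rightarrow> 'n"
  let ?\<Pi> = "{\<pi>. bij_betw \<pi> (A - B) (B - A)}"
  have "card (A - B) = card (B - A)"
    using A(1) B(1) by (simp add: card_Diff_subset_Int Int_commute)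
  then have "?\<Pi> \<noteq> {}"
    using finite_same_card_bij[of "A - B" "B - A"] by auto
  moreover have "finite ?\<Pi>" by simp
  ultimately obtain \<pi> where \<pi>: "bij_betw \<pi> (A - B) (B - A)"
    and min: "\<And>\<rho>. bij_betw \<rho> (A - B) (B - A) \<Longrightarrow> bad \<pi> \<le> bad \<rho>"
    using ex_min_if_finite[of "bad ` ?\<Pi>"] by (auto simp: not_less)
  have \<pi>mem: "\<pi> i \<in> B - A" if "i \<in> A - B" for i
    using \<pi> that by (auto simp: bij_betw_def)
  have good: "\<beta> T i \<le> \<beta> T (\<pi> i)" if "T \<in> \<T>'" "i \<in> A - B" for T i
  proof (rule ccontr)
    assume neg: "\<not> ?thesis"
    define T0 i0 j0 where "T0 = T" and "i0 = i" and "j0 = \<pi> i"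
    note defs = T0_def i0_def j0_def
    have T0: "T0 \<in> \<T>'" "i0 \<in> A - B" "\<beta> T0 j0 < \<beta> T0 i0" "j0 \<in> B - A"
      using that neg \<pi>mem by (auto simp: defs)
    \<comment> \<open>The total change along \<pi> is the value of T0 at B minus its value 0 at A.
      Being nonnegative, it must offset the loss at i0 by a gain elsewhere.\<close>
    have "(\<Sum>i\<in>A - B. \<beta> T0 (\<pi> i)) = sum (\<beta> T0) (B - A)"
      using sum.reindex_bij_betw[OF \<pi>] .
    then have "(\<Sum>i\<in>A - B. \<beta> T0 (\<pi> i) - \<beta> T0 i) = sum (\<beta> T0) (B - A) - sum (\<beta> T0) (A - B)"
      by (simp add: sum_subtractf)
    also have "\<dots> = sum (\<beta> T0) B - sum (\<beta> T0) A"
      using sum.Int_Diff[of A "\<beta> T0" B] sum.Int_Diff[of B "\<beta> T0" A] by (simp add: Int_commute)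
    also have "\<dots> \<ge> 0" using T0(1) B(2) by (auto simp: \<T>'_def)
    finally have sum_nonneg: "0 \<le> (\<Sum>i\<in>A - B. \<beta> T0 (\<pi> i) - \<beta> T0 i)" .
    have "\<exists>i1\<in>A - B. \<beta> T0 i1 < \<beta> T0 (\<pi> i1)"
    proof (rule ccontr)
      assume "\<not> ?thesis"
      then have "(\<Sum>i\<in>A - B. \<beta> T0 (\<pi> i) - \<beta> T0 i) < (\<Sum>i\<in>A - B. 0)"
        using T0 by (intro sum_strict_mono_ex1) (auto simp: defs not_less)
      then show False using sum_nonneg by simp
    qed
    then obtain i1 j1 where T1: "i1 \<in> A - B" "\<beta> T0 i1 < \<beta> T0 j1" "j1 \<in> B - A" "j1 = \<pi> i1"
      using \<pi>mem by auto
    have "i0 \<noteq> i1" using T0(3) T1(2,4) by (auto simp: defs)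
    moreover from this have "j0 \<noteq> j1"
      using inj_on_eq_iff[OF bij_betw_imp_inj_on[OF \<pi>] T0(2) T1(1)] T1(4) by (simp add: defs)
    ultimately have neq: "i0 \<noteq> i1" "j0 \<noteq> j1" by auto
    \<comment> \<open>Each product pairs the values of T at two adjacent vertices of the octahedron:
      an unmixed exchange (\<open>i0\<close> for \<open>j0\<close>, or \<open>i1\<close> for
      \<open>j1\<close>) and a mixed one.\<close>
    have same_sign:
      "0 \<le> (\<beta> T j0 - \<beta> T i0) * (\<beta> T j1 - \<beta> T i0)"
      "0 \<le> (\<beta> T j0 - \<beta> T i0) * (\<beta> T j0 - \<beta> T i1)"
      "0 \<le> (\<beta> T j1 - \<beta> T i1) * (\<beta> T j1 - \<beta> T i0)"
      "0 \<le> (\<beta> T j1 - \<beta> T i1) * (\<beta> T j0 - \<beta> T i1)"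
      if T: "T \<in> \<T>'" for T
    proof -
      have T': "T \<in> \<T>" using T by (simp add: \<T>'_def)
      have j_swap: "0 \<le> (\<beta> T j - \<beta> T i) * (\<beta> T j' - \<beta> T i)"
        if "i \<in> A" "j \<notin> A" "j' \<notin> A" "j \<noteq> j'" for i j j'
      proof -
        have "insert j' (insert j (A - {i}) - {j}) = insert j' (A - {i})" using that by auto
        then show ?thesis
          using nocut[OF T' card_swap[OF A(1) that(1,2)], of j j'] val[OF T] that by auto
      qed
      have i_swap: "0 \<le> (\<beta> T j - \<beta> T i) * (\<beta> T j - \<beta> T i')"
        if "i \<in> A" "i' \<in> A" "j \<notin> A" "i \<noteq> i'" for i i' j
      proof -
        have "insert i (insert j (A - {i}) - {i'}) = insert j (A - {i'})" using that by auto
        then show ?thesis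
          using nocut[OF T' card_swap[OF A(1) that(1,3)], of i' i] val[OF T] that by auto
      qed
      show "0 \<le> (\<beta> T j0 - \<beta> T i0) * (\<beta> T j1 - \<beta> T i0)"
        "0 \<le> (\<beta> T j0 - \<beta> T i0) * (\<beta> T j0 - \<beta> T i1)"
        "0 \<le> (\<beta> T j1 - \<beta> T i1) * (\<beta> T j1 - \<beta> T i0)"
        "0 \<le> (\<beta> T j1 - \<beta> T i1) * (\<beta> T j0 - \<beta> T i1)"
        using j_swap[of i0 j0 j1] i_swap[of i0 i1 j0] i_swap[of i1 i0 j1] j_swap[of i1 j1 j0]
          T0 T1 neq by (auto simp: mult.commute)
    qed
    \<comment> \<open>The unmixed values of T0 have opposite strict signs and no mixed value may
      oppose either of them, so the mixed values are 0.\<close>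
    have eq0: "\<beta> T0 j1 = \<beta> T0 i0" "\<beta> T0 j0 = \<beta> T0 i1"
      using same_sign[OF T0(1)] T0(3) T1(2) by (auto simp: zero_le_mult_iff)
    have step: "max 0 (\<beta> T i0 - \<beta> T j1) + max 0 (\<beta> T i1 - \<beta> T j0)
        \<le> max 0 (\<beta> T i0 - \<beta> T j0) + max 0 (\<beta> T i1 - \<beta> T j1)" if T: "T \<in> \<T>'" for T
    proof (cases "(\<beta> T i0 - \<beta> T j1) * (\<beta> T i1 - \<beta> T j0) < 0")
      case True
      \<comment> \<open>Mixed values of opposite signs force both unmixed values of T to be 0.
        Nesting with T0, whose unmixed values have opposite signs, then forces t = 0.\<close>
      then have 0: "\<beta> T j0 = \<beta> T i0" "\<beta> T j1 = \<beta> T i1" "\<beta> T i0 \<noteq> \<beta> T i1"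
        using same_sign[OF T] by (auto simp: zero_le_mult_iff mult_less_0_iff)
      then have "T \<noteq> T0" using T0(3) by auto
      then obtain s t where st: "s \<noteq> 0" "t \<noteq> 0"
          "\<forall>A. card A = k \<longrightarrow> 0 \<le> s * sum (\<beta> T) A + t * sum (\<beta> T0) A"
        using nested[of T T0] T T0(1) by (auto simp: \<T>'_def)
      have ge: "0 \<le> s * (\<beta> T j - \<beta> T i) + t * (\<beta> T0 j - \<beta> T0 i)" if "i \<in> A" "j \<notin> A" for i j
        using st(3) card_swap[OF A(1) that] val[OF T that] val[OF T0(1) that] by metis
      have "0 \<le> t * (\<beta> T0 j0 - \<beta> T0 i0)" "0 \<le> t * (\<beta> T0 j1 - \<beta> T0 i1)"
        using ge[of i0 j0] ge[of i1 j1] 0 T0 T1 by auto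
      then have "t = 0" using T0(3) T1(2) by (auto simp: zero_le_mult_iff)
      then show ?thesis using st(2) by simp
    next
      case False
      \<comment> \<open>Both pairings have the same total. Mixed values of equal sign have positive
        parts adding up to the positive part of this total, which is subadditive.\<close>
      then show ?thesis by (auto simp: not_less zero_le_mult_iff max_def)
    qed
    define \<rho> where "\<rho> = \<pi>(i0 := j1, i1 := j0)"
    have "\<rho> = \<pi> \<circ> Transposition.transpose i0 i1"
      using neq T1(4) by (auto simp: \<rho>_def defs Transposition.transpose_def fun_eq_iff)
    moreover have "bij_betw (Transposition.transpose i0 i1) (A - B) (A - B)"
      using T0(2) T1(1) by (auto simp: bij_betw_def inj_on_def Transposition.transpose_def image_iff split: if_splits)
    ultimately have \<rho>: "bij_betw \<rho> (A - B) (B - A)"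
      using \<pi> bij_betw_trans by metis
    define D where "D = A - B - {i0, i1}"
    have split: "sum f (A - B) = f i0 + f i1 + sum f D" for f :: "'n \<Rightarrow> real"
    proof -
      have "sum f (A - B) = sum f (insert i0 (insert i1 D))"
        using T0(2) T1(1) by (intro arg_cong[where f = "sum f"]) (auto simp: D_def)
      also have "\<dots> = f i0 + (f i1 + sum f D)"
        using neq by (simp add: D_def)
      finally show ?thesis by (simp add: add.assoc)
    qed
    have rest: "(\<Sum>i\<in>D. max 0 (\<beta> T i - \<beta> T (\<rho> i))) = (\<Sum>i\<in>D. max 0 (\<beta> T i - \<beta> T (\<pi> i)))" for T
      by (rule sum.cong) (auto simp: D_def \<rho>_def)
    have \<rho>01: "\<rho> i0 = j1" "\<rho> i1 = j0" "\<pi> i0 = j0" "\<pi> i1 = j1"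
      using neq T1(4) by (auto simp: \<rho>_def defs)
    have "bad \<rho> < bad \<pi>"
      unfolding bad_def
    proof (rule sum_strict_mono_ex1)
      show "finite \<T>'" using fin by (simp add: \<T>'_def)
      show "\<forall>T\<in>\<T>'. (\<Sum>i\<in>A - B. max 0 (\<beta> T i - \<beta> T (\<rho> i)))
          \<le> (\<Sum>i\<in>A - B. max 0 (\<beta> T i - \<beta> T (\<pi> i)))"
        unfolding split rest \<rho>01 using step by auto
      \<comment> \<open>For T0 the positive violation at i0 is traded for two mixed values equal to
        0.\<close>
      show "\<exists>T\<in>\<T>'. (\<Sum>i\<in>A - B. max 0 (\<beta> T i - \<beta> T (\<rho> i)))
          < (\<Sum>i\<in>A - B. max 0 (\<beta> T i - \<beta> T (\<pi> i)))"
        unfolding split rest \<rho>01 using T0(3) T1(2) eq0 by (intro bexI[OF _ T0(1)]) auto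
    qed
    then show False using min[OF \<rho>] by simp
  qed
  show ?thesis
  proof (intro bexI conjI ballI)
    show mem: "\<pi> a \<in> B - A" using \<pi>mem[OF a] .
    show "card (insert (\<pi> a) (A - {a})) = k" using card_swap A(1) a mem by auto
    fix T assume T: "T \<in> \<T>"
    show "0 \<le> sum (\<beta> T) (insert (\<pi> a) (A - {a}))"
    proof (cases "T \<in> \<T>'")
      case True
      then show ?thesis using val[OF True] good[OF True a] a mem by auto
    next
      case False
      then have "0 < sum (\<beta> T) A" using T A(2)[OF T] by (auto simp: \<T>'_def less_le)
      then show ?thesis
        using nocut[OF T A(1), of a "\<pi> a"] a mem by (auto simp: zero_le_mult_iff)
    qed
  qed
qed

section \<open>Simplicial fans modulo a subspace\<close>

text \<open>Combinations are indexed by the members of \<S>, not by their images, as w may fail to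
  be injective.\<close>

lemma convex_cone_hull_image_finite:
  fixes w :: "'i \<Rightarrow> 'b::euclidean_space"
  assumes "finite \<S>"
  shows "convex_cone hull (w ` \<S>) = {\<Sum>S\<in>\<S>. c S *\<^sub>R w S | c. \<forall>S\<in>\<S>. 0 \<le> c S}" (is "_ = ?R")
proof
  have "convex_cone ?R"
    unfolding convex_cone_iff
  proof (intro conjI ballI allI impI)
    show "0 \<in> ?R" by (auto intro!: exI[of _ "\<lambda>_. 0"])
  next
    fix x y assume "x \<in> ?R" "y \<in> ?R"
    then obtain c d where "\<forall>S\<in>\<S>. 0 \<le> c S" "x = (\<Sum>S\<in>\<S>. c S *\<^sub>R w S)"
      "\<forall>S\<in>\<S>. 0 \<le> d S" "y = (\<Sum>S\<in>\<S>. d S *\<^sub>R w S)" by blast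
    then show "x + y \<in> ?R"
      by (auto intro!: exI[of _ "\<lambda>S. c S + d S"] simp: scaleR_add_left sum.distrib)
  next
    fix x and r :: real assume "x \<in> ?R" "0 \<le> r"
    then obtain c where "\<forall>S\<in>\<S>. 0 \<le> c S" "x = (\<Sum>S\<in>\<S>. c S *\<^sub>R w S)" by blast
    then show "r *\<^sub>R x \<in> ?R" using \<open>0 \<le> r\<close>
      by (auto intro!: exI[of _ "\<lambda>S. r * c S"] simp: scaleR_sum_right)
  qed
  moreover have "w ` \<S> \<subseteq> ?R"
  proof
    fix x assume "x \<in> w ` \<S>"
    then obtain S where S: "S \<in> \<S>" "x = w S" by blast
    have "(\<Sum>T\<in>\<S>. (if T = S then 1 else 0) *\<^sub>R w T) = (\<Sum>T\<in>\<S>. if T = S then w T else 0)"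
      by (intro sum.cong) auto
    also have "\<dots> = x" using S assms by simp
    finally show "x \<in> ?R" by (auto intro!: exI[of _ "\<lambda>T. if T = S then 1 else 0"])
  qed
  ultimately show "convex_cone hull (w ` \<S>) \<subseteq> ?R" by (intro hull_minimal)
next
  have "(\<Sum>S\<in>\<S>. c S *\<^sub>R w S) \<in> convex_cone hull (w ` \<S>)" if "\<forall>S\<in>\<S>. 0 \<le> c S" for c
  proof -
    have "(\<Sum>S\<in>\<T>. c S *\<^sub>R w S) \<in> convex_cone hull (w ` \<S>)" if "finite \<T>" "\<T> \<subseteq> \<S>" for \<T>
      using that
    proof (induction \<T> rule: finite_induct)
      case empty
      then show ?case by (simp add: convex_cone_hull_contains_0)
    next
      case (insert T \<T>)
      then have "w T \<in> convex_cone hull (w ` \<S>)" "0 \<le> c T"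
        using \<open>\<forall>S\<in>\<S>. 0 \<le> c S\<close> by (auto intro: hull_inc)
      then show ?case
        using insert by (simp add: convex_cone_hull_add convex_cone_hull_mul)
    qed
    then show ?thesis using assms by blast
  qed
  then show "?R \<subseteq> convex_cone hull (w ` \<S>)" by blast
qed

text \<open>\<open>unique\<close> reads off every positive coefficient of a vector, whichever member
  of K represents it. It yields linear independence of the generators of each cone and also controls
  how different cones meet.\<close>

locale simplicial_family =
  fixes K :: "'i set set" and w :: "'i \<Rightarrow> 'b::euclidean_space"
  assumes finite_K: "finite K" and finite_member: "\<S> \<in> K \<Longrightarrow> finite \<S>"
    and down: "\<S> \<in> K \<Longrightarrow> \<T> \<subseteq> \<S> \<Longrightarrow> \<T> \<in> K"
    and unique: "\<lbrakk>\<S> \<in> K; \<T> \<in> K; \<And>S. S \<in> \<S> \<Longrightarrow> 0 \<le> c S; \<And>S. S \<in> \<T> \<Longrightarrow> 0 \<le> d S;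
       (\<Sum>S\<in>\<S>. c S *\<^sub>R w S) = (\<Sum>S\<in>\<T>. d S *\<^sub>R w S); S \<in> \<S>; 0 < c S\<rbrakk>
       \<Longrightarrow> S \<in> \<T> \<and> d S = c S"
begin

definition cone_of :: "'i set \<Rightarrow> 'b set" where
  "cone_of \<S> = convex_cone hull (w ` \<S>)"

lemma cone_ofE:
  assumes "x \<in> cone_of \<S>" "\<S> \<in> K"
  obtains c where "\<And>S. S \<in> \<S> \<Longrightarrow> 0 \<le> c S" "x = (\<Sum>S\<in>\<S>. c S *\<^sub>R w S)"
proof -
  have "\<exists>c. x = (\<Sum>S\<in>\<S>. c S *\<^sub>R w S) \<and> (\<forall>S\<in>\<S>. 0 \<le> c S)"
    using assms(1)
    unfolding cone_of_def convex_cone_hull_image_finite[OF finite_member[OF assms(2)]] mem_Collect_eq .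
  then show ?thesis using that by metis
qed

lemma cone_ofI:
  assumes "\<S> \<in> K" "\<And>S. S \<in> \<S> \<Longrightarrow> 0 \<le> c S"
  shows "(\<Sum>S\<in>\<S>. c S *\<^sub>R w S) \<in> cone_of \<S>"
  unfolding cone_of_def convex_cone_hull_image_finite[OF finite_member[OF assms(1)]] mem_Collect_eq
  using assms(2) by (intro exI[of _ c]) simp

lemma cone_of_subI:
  assumes "\<S> \<in> K" "\<T> \<subseteq> \<S>" "\<And>S. S \<in> \<S> \<Longrightarrow> 0 \<le> c S" "\<And>S. S \<in> \<S> - \<T> \<Longrightarrow> c S = 0"
  shows "(\<Sum>S\<in>\<S>. c S *\<^sub>R w S) \<in> cone_of \<T>"
proof -
  have "(\<Sum>S\<in>\<S>. c S *\<^sub>R w S) = (\<Sum>S\<in>\<T>. c S *\<^sub>R w S)"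
    using assms finite_member by (intro sum.mono_neutral_right) auto
  then show ?thesis using cone_ofI[of \<T> c] assms down by auto
qed

lemma convex_cone_cone_of: "convex_cone (cone_of \<S>)"
  by (simp add: cone_of_def convex_cone_convex_cone_hull)

lemma cone_of_mono: "\<T> \<subseteq> \<S> \<Longrightarrow> cone_of \<T> \<subseteq> cone_of \<S>"
  by (simp add: cone_of_def hull_mono image_mono)

lemma cone_of_pointed:
  assumes "\<S> \<in> K" "x \<in> cone_of \<S>" "- x \<in> cone_of \<S>"
  shows "x = 0"
proof -
  obtain c where c: "\<And>S. S \<in> \<S> \<Longrightarrow> 0 \<le> c S" "x = (\<Sum>S\<in>\<S>. c S *\<^sub>R w S)"
    using cone_ofE[OF assms(2,1)] by blast
  obtain d where d: "\<And>S. S \<in> \<S> \<Longrightarrow> 0 \<le> d S" "- x = (\<Sum>S\<in>\<S>. d S *\<^sub>R w S)"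
    using cone_ofE[OF assms(3,1)] by blast
  have "(\<Sum>S\<in>\<S>. (c S + d S) *\<^sub>R w S) = x + - x"
    by (simp add: scaleR_add_left sum.distrib flip: c(2) d(2))
  then have 0: "(\<Sum>S\<in>\<S>. (c S + d S) *\<^sub>R w S) = (\<Sum>S\<in>{}. 0 *\<^sub>R w S)" by simp
  have "c S = 0" if "S \<in> \<S>" for S
  proof (rule ccontr)
    assume "c S \<noteq> 0"
    then have "0 < c S + d S" using c(1)[OF that] d(1)[OF that] by linarith
    then show False
      using unique[OF assms(1) down[OF assms(1) empty_subsetI] _ _ 0 that] c(1) d(1) by simp
  qed
  then show ?thesis using c(2) by simp
qed

lemma cone_of_Int:
  assumes "\<S> \<in> K" "\<T> \<in> K"
  shows "cone_of \<S> \<inter> cone_of \<T> = cone_of (\<S> \<inter> \<T>)"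
proof
  show "cone_of \<S> \<inter> cone_of \<T> \<subseteq> cone_of (\<S> \<inter> \<T>)"
  proof
    fix x assume x: "x \<in> cone_of \<S> \<inter> cone_of \<T>"
    obtain c where c: "\<And>S. S \<in> \<S> \<Longrightarrow> 0 \<le> c S" "x = (\<Sum>S\<in>\<S>. c S *\<^sub>R w S)"
      using x cone_ofE[OF _ assms(1)] by blast
    obtain d where d: "\<And>S. S \<in> \<T> \<Longrightarrow> 0 \<le> d S" "x = (\<Sum>S\<in>\<T>. d S *\<^sub>R w S)"
      using x cone_ofE[OF _ assms(2)] by blast
    have "c S = 0" if "S \<in> \<S> - \<S> \<inter> \<T>" for S
    proof (rule ccontr)
      assume "c S \<noteq> 0"
      then have "0 < c S" using c(1)[of S] that by auto
      moreover have "(\<Sum>S\<in>\<S>. c S *\<^sub>R w S) = (\<Sum>S\<in>\<T>. d S *\<^sub>R w S)"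
        using c(2) d(2) by simp
      ultimately show False
        using unique[OF assms c(1) d(1), where S = S] that by simp
    qed
    then show "x \<in> cone_of (\<S> \<inter> \<T>)"
      unfolding c(2) by (intro cone_of_subI[OF assms(1) _ c(1)]) auto
  qed
qed (simp add: cone_of_mono)

text \<open>If a point of the smaller cone lies strictly between two points, its coefficients
  outside \<T> are positive mixtures of theirs. They vanish by uniqueness, hence so do those of both
  end points.\<close>

lemma cone_of_face:
  assumes "\<S> \<in> K" "\<T> \<subseteq> \<S>"
  shows "cone_of \<T> face_of cone_of \<S>"
  unfolding face_of_def
proof (intro conjI ballI impI)
  show "cone_of \<T> \<subseteq> cone_of \<S>" using assms(2) by (rule cone_of_mono)
  show "convex (cone_of \<T>)" by (simp add: cone_of_def convex_convex_cone_hull)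
  fix a b x assume a: "a \<in> cone_of \<S>" and b: "b \<in> cone_of \<S>" and x: "x \<in> cone_of \<T>"
    and "x \<in> open_segment a b"
  then obtain t where t: "0 < t" "t < 1" "x = (1 - t) *\<^sub>R a + t *\<^sub>R b"
    by (auto simp: in_segment)
  have T: "\<T> \<in> K" using down[OF assms] .
  obtain c where c: "\<And>S. S \<in> \<S> \<Longrightarrow> 0 \<le> c S" "a = (\<Sum>S\<in>\<S>. c S *\<^sub>R w S)"
    using cone_ofE[OF a assms(1)] by blast
  obtain d where d: "\<And>S. S \<in> \<S> \<Longrightarrow> 0 \<le> d S" "b = (\<Sum>S\<in>\<S>. d S *\<^sub>R w S)"
    using cone_ofE[OF b assms(1)] by blast
  obtain e where e: "\<And>S. S \<in> \<T> \<Longrightarrow> 0 \<le> e S" "x = (\<Sum>S\<in>\<T>. e S *\<^sub>R w S)"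
    using cone_ofE[OF x T] by blast
  let ?f = "\<lambda>S. (1 - t) * c S + t * d S"
  have f: "0 \<le> ?f S" if "S \<in> \<S>" for S
    using that c(1) d(1) t by simp
  have eq: "(\<Sum>S\<in>\<S>. ?f S *\<^sub>R w S) = (\<Sum>S\<in>\<T>. e S *\<^sub>R w S)"
    unfolding e(2)[symmetric] t(3) c(2) d(2)
    by (simp add: scaleR_sum_right sum.distrib scaleR_add_left)
  have "c S = 0 \<and> d S = 0" if "S \<in> \<S> - \<T>" for S
  proof -
    have "\<not> 0 < ?f S" using unique[OF assms(1) T f e(1) eq, where S = S] that by blast
    moreover have "0 \<le> (1 - t) * c S" "0 \<le> t * d S" using c(1)[of S] d(1)[of S] t that by auto
    ultimately have "(1 - t) * c S = 0" "t * d S = 0" by linarith+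
    then show ?thesis using t by simp
  qed
  then show "a \<in> cone_of \<T>" "b \<in> cone_of \<T>"
    unfolding c(2) d(2) using cone_of_subI[OF assms c(1)] cone_of_subI[OF assms d(1)] by auto
qed

text \<open>A nonempty face of a cone is closed under nonnegative scaling and under passing to
  summands, so it contains each generator that one of its points uses with a positive
  coefficient.\<close>

lemma face_of_cone_of:
  assumes S: "\<S> \<in> K" and F: "F face_of cone_of \<S>" and ne: "F \<noteq> {}"
  shows "F = cone_of {S\<in>\<S>. w S \<in> F}"
proof -
  have sub: "F \<subseteq> cone_of \<S>" and "convex F"
    using F by (auto simp: face_of_def)
  have seg: "a \<in> F \<and> b \<in> F"
    if "a \<in> cone_of \<S>" "b \<in> cone_of \<S>" "x \<in> F" "x \<in> open_segment a b" for a b x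
    using F that unfolding face_of_def by blast
  have cc: "0 \<in> cone_of \<S>" "\<And>x y. x \<in> cone_of \<S> \<Longrightarrow> y \<in> cone_of \<S> \<Longrightarrow> x + y \<in> cone_of \<S>"
      "\<And>x r. x \<in> cone_of \<S> \<Longrightarrow> 0 \<le> r \<Longrightarrow> r *\<^sub>R x \<in> cone_of \<S>"
    using convex_cone_cone_of[of \<S>] by (auto simp: convex_cone_iff)
  have ray: "0 \<in> F \<and> r *\<^sub>R x \<in> F" if "x \<in> F" "x \<noteq> 0" "1 < r" for x r
  proof (rule seg)
    show "x \<in> open_segment 0 (r *\<^sub>R x)"
      using that by (auto simp: in_segment intro!: exI[of _ "1 / r"])
  qed (use that sub cc in auto)
  obtain y where y: "y \<in> F" using ne by blast
  have F0: "0 \<in> F" using y ray[of y 2] by (cases "y = 0") auto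
  have scale: "r *\<^sub>R x \<in> F" if x: "x \<in> F" and r: "0 \<le> r" for x r
  proof (cases "r \<le> 1")
    case True
    then show ?thesis using convexD_alt[OF \<open>convex F\<close> F0 x, of r] r by simp
  next
    case False
    then show ?thesis using ray[of x r] x F0 by (cases "x = 0") auto
  qed
  have add: "x + y \<in> F" if "x \<in> F" "y \<in> F" for x y
  proof -
    have "(1/2) *\<^sub>R x + (1/2) *\<^sub>R y \<in> F"
      using that by (intro convexD[OF \<open>convex F\<close>]) auto
    from scale[OF this, of 2] show ?thesis by (simp add: scaleR_add_right)
  qed
  \<comment> \<open>The midpoint of a and b lies in F by scaling, and strictly between them unless a
    = b.\<close>
  have summand: "a \<in> F" if "a \<in> cone_of \<S>" "b \<in> cone_of \<S>" "a + b \<in> F" for a b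
  proof -
    have half: "(1/2) *\<^sub>R (a + b) \<in> F" using scale that(3) by simp
    show ?thesis
    proof (cases "a = b")
      case True
      then have "(1/2) *\<^sub>R (a + b) = a" by (simp flip: scaleR_2)
      then show ?thesis using half by simp
    next
      case False
      then have "(1/2) *\<^sub>R (a + b) \<in> open_segment a b"
        by (auto simp: in_segment scaleR_add_right intro!: exI[of _ "1/2"])
      then show ?thesis using seg[OF that(1,2) half] by blast
    qed
  qed
  show ?thesis
  proof
    show "F \<subseteq> cone_of {S\<in>\<S>. w S \<in> F}"
    proof
      fix x assume x: "x \<in> F"
      then obtain c where c: "\<And>S. S \<in> \<S> \<Longrightarrow> 0 \<le> c S" "x = (\<Sum>S\<in>\<S>. c S *\<^sub>R w S)"
        using cone_ofE[OF _ S] sub by blast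
      have "c S = 0" if "S \<in> \<S> - {S\<in>\<S>. w S \<in> F}" for S
      proof (rule ccontr)
        assume nz: "c S \<noteq> 0"
        have SS: "S \<in> \<S>" using that by auto
        have "x = c S *\<^sub>R w S + (\<Sum>S\<in>\<S> - {S}. c S *\<^sub>R w S)"
          unfolding c(2) by (rule sum.remove[OF finite_member[OF S] SS])
        moreover have "(\<Sum>S\<in>\<S> - {S}. c S *\<^sub>R w S) \<in> cone_of \<S>"
          using cone_ofI[of "\<S> - {S}" c] down[OF S] c(1) cone_of_mono[of "\<S> - {S}" \<S>] by blast
        moreover have "w S \<in> cone_of \<S>" using SS by (auto simp: cone_of_def intro: hull_inc)
        then have "c S *\<^sub>R w S \<in> cone_of \<S>" using cc(3) c(1)[OF SS] by blast
        ultimately have "c S *\<^sub>R w S \<in> F" using summand x by metis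
        from scale[OF this, of "1 / c S"] have "w S \<in> F" using nz c(1)[OF SS] by simp
        then show False using that by auto
      qed
      then show "x \<in> cone_of {S\<in>\<S>. w S \<in> F}"
        unfolding c(2) by (intro cone_of_subI[OF S _ c(1)]) auto
    qed
    have "convex_cone F" using F0 add scale by (auto simp: convex_cone_iff)
    then show "cone_of {S\<in>\<S>. w S \<in> F} \<subseteq> F"
      unfolding cone_of_def by (intro hull_minimal) auto
  qed
qed

theorem pointed_fan_cones: "pointed_fan (cone_of ` K)"
  unfolding pointed_fan_def
proof (intro conjI ballI allI impI)
  show "finite (cone_of ` K)" using finite_K by simp
next
  fix C assume "C \<in> cone_of ` K"
  then show "polyhedron C"
    using finite_member by (auto simp: cone_of_def intro!: polyhedron_convex_cone_hull)
next
  fix C assume "C \<in> cone_of ` K"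
  then show "convex_cone C" by (auto simp: convex_cone_cone_of)
next
  fix C x assume "C \<in> cone_of ` K" "x \<in> C" "- x \<in> C"
  then show "x = 0" using cone_of_pointed by blast
next
  fix C F assume "C \<in> cone_of ` K" "F face_of C \<and> F \<noteq> {}"
  then obtain \<S> where S: "\<S> \<in> K" "F face_of cone_of \<S>" "F \<noteq> {}" by blast
  have "{S\<in>\<S>. w S \<in> F} \<in> K" using down[OF S(1)] by simp
  with face_of_cone_of[OF S] show "F \<in> cone_of ` K" by (rule image_eqI)
next
  fix C D assume "C \<in> cone_of ` K" "D \<in> cone_of ` K"
  then obtain \<S> \<T> where ST: "\<S> \<in> K" "C = cone_of \<S>" "\<T> \<in> K" "D = cone_of \<T>" by blast
  show "C \<inter> D face_of C" "C \<inter> D face_of D"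
    unfolding ST(2,4) cone_of_Int[OF ST(1,3)] using cone_of_face ST(1,3) by auto
qed

text \<open>A generator is nonzero, so its ray meets the sphere; inclusion of the cells puts it into
  the other cone, where uniqueness finds it among the generators.\<close>

lemma sphere_subset_iff:
  assumes "\<S> \<in> K" "\<T> \<in> K"
  shows "cone_of \<S> \<inter> sphere 0 1 \<subseteq> cone_of \<T> \<inter> sphere 0 1 \<longleftrightarrow> \<S> \<subseteq> \<T>"
proof
  assume sub: "cone_of \<S> \<inter> sphere 0 1 \<subseteq> cone_of \<T> \<inter> sphere 0 1"
  show "\<S> \<subseteq> \<T>"
  proof
    fix S assume SS: "S \<in> \<S>"
    have sK: "{S} \<in> K" using down[OF assms(1)] SS by blast
    have nz: "w S \<noteq> 0"
      using unique[OF sK down[OF sK empty_subsetI], of "\<lambda>_. 1" "\<lambda>_. 0" S] by auto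
    have "w S \<in> cone_of \<S>" using SS by (auto simp: cone_of_def intro: hull_inc)
    then have "(1 / norm (w S)) *\<^sub>R w S \<in> cone_of \<S> \<inter> sphere 0 1"
      using convex_cone_cone_of[of \<S>] nz by (auto simp: convex_cone_iff)
    then have "(1 / norm (w S)) *\<^sub>R w S \<in> cone_of \<T>" using sub by blast
    then have "norm (w S) *\<^sub>R (1 / norm (w S)) *\<^sub>R w S \<in> cone_of \<T>"
      using convex_cone_cone_of[of \<T>] unfolding convex_cone_iff by (metis norm_ge_zero)
    then have "w S \<in> cone_of \<T>" using nz by simp
    then obtain d where d: "\<And>S. S \<in> \<T> \<Longrightarrow> 0 \<le> d S" "w S = (\<Sum>S\<in>\<T>. d S *\<^sub>R w S)"
      using cone_ofE[OF _ assms(2)] by blast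
    show "S \<in> \<T>"
      using unique[OF sK assms(2), of "\<lambda>_. 1" d S] d by auto
  qed
qed (use cone_of_mono in blast)

end

section \<open>Passing to the quotient by a linear subspace\<close>

lemma exists_orthogonal_projection:
  fixes L :: "'b::euclidean_space set"
  assumes "subspace L"
  obtains p :: "'b \<Rightarrow> 'b" where "linear p" "\<And>x. p x \<in> L\<^sup>\<bottom>" "\<And>x. x - p x \<in> L"
    "\<And>x. x \<in> L\<^sup>\<bottom> \<Longrightarrow> p x = x" "\<And>x. x \<in> L \<Longrightarrow> p x = 0"
proof -
  obtain B where B: "B \<subseteq> L" "pairwise orthogonal B" "\<And>x. x \<in> B \<Longrightarrow> norm x = 1"
    "independent B" "card B = dim L" "span B = L"
    using orthonormal_basis_subspace[OF assms] by blast
  have fin: "finite B" using B(4) by (rule independent_imp_finite)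
  define q where "q x = (\<Sum>b\<in>B. (b \<bullet> x) *\<^sub>R b)" for x
  have linq: "linear q"
    by (auto intro!: linearI simp: q_def inner_add_right scaleR_add_left sum.distrib scaleR_sum_right)
  have qL: "q x \<in> L" for x
    unfolding q_def using B(1) assms by (auto intro!: subspace_sum subspace_scale)
  have bq: "b \<bullet> q x = b \<bullet> x" if "b \<in> B" for b x
  proof -
    have "b \<bullet> q x = (\<Sum>b'\<in>B. if b' = b then b \<bullet> x else 0)"
      unfolding q_def inner_sum_right
    proof (rule sum.cong[OF refl])
      fix b' assume "b' \<in> B"
      then show "b \<bullet> ((b' \<bullet> x) *\<^sub>R b') = (if b' = b then b \<bullet> x else 0)"
        using B(2) B(3)[OF that] that
        by (auto simp: pairwise_def orthogonal_def norm_eq_1 inner_commute)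
    qed
    then show ?thesis using that fin by simp
  qed
  have orth: "x - q x \<in> L\<^sup>\<bottom>" for x
  proof -
    have "B \<subseteq> {y. y \<bullet> (x - q x) = 0}" using bq by (auto simp: inner_diff_right)
    moreover have "subspace {y. y \<bullet> (x - q x) = 0}"
      using subspace_hyperplane[of "x - q x"] by (simp add: inner_commute)
    ultimately have "span B \<subseteq> {y. y \<bullet> (x - q x) = 0}" by (rule span_minimal)
    then show ?thesis using B(6) by (auto simp: orthogonal_comp_def orthogonal_def)
  qed
  have perp0: "z = 0" if "z \<in> L" "z \<in> L\<^sup>\<bottom>" for z
    using that by (auto simp: orthogonal_comp_def orthogonal_def)
  show ?thesis
  proof (rule that[of "\<lambda>x. x - q x"])
    show "linear (\<lambda>x. x - q x)" using linq by (simp add: linear_compose_sub linear_id[unfolded id_def])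
    show "x - q x \<in> L\<^sup>\<bottom>" for x by (rule orth)
    show "x - (x - q x) \<in> L" for x using qL by simp
    show "x - q x = x" if "x \<in> L\<^sup>\<bottom>" for x
    proof -
      have "x - (x - q x) \<in> L\<^sup>\<bottom>"
        using subspace_diff[OF subspace_orthogonal_comp] that orth by blast
      then have "q x \<in> L\<^sup>\<bottom>" by simp
      then show ?thesis using perp0[OF qL] by simp
    qed
    show "x - q x = 0" if "x \<in> L" for x
      using perp0[OF subspace_diff[OF assms that qL] orth] .
  qed
qed

context
  fixes L :: "'b::euclidean_space set" and p :: "'b \<Rightarrow> 'b"
  assumes L: "subspace L" and linear_p: "linear p" and p_orth: "\<And>x. p x \<in> L\<^sup>\<bottom>"
    and p_diff: "\<And>x. x - p x \<in> L" and p_id: "\<And>x. x \<in> L\<^sup>\<bottom> \<Longrightarrow> p x = x" and p_0: "\<And>x. x \<in> L \<Longrightarrow> p x = 0"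
begin

text \<open>The preimage form gives closedness, from that of finitely generated cones, and the trace
  on the orthogonal complement.\<close>

lemma cone_plus_subspace_eq_vimage:
  "{x + l | x l. x \<in> convex_cone hull A \<and> l \<in> L} = p -` (convex_cone hull (p ` A))"
proof (intro equalityI subsetI)
  fix z assume "z \<in> {x + l | x l. x \<in> convex_cone hull A \<and> l \<in> L}"
  then obtain x l where "z = x + l" "x \<in> convex_cone hull A" "l \<in> L" by blast
  then show "z \<in> p -` (convex_cone hull (p ` A))"
    using linear_add[OF linear_p] p_0 by (simp add: convex_cone_hull_linear_image[OF linear_p])
next
  fix z assume "z \<in> p -` (convex_cone hull (p ` A))"
  then obtain x where x: "x \<in> convex_cone hull A" "p z = p x"
    by (auto simp: convex_cone_hull_linear_image[OF linear_p])
  have "(z - p z) - (x - p x) \<in> L" using p_diff L subspace_diff by blast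
  then have "z - x \<in> L" using x(2) by simp
  moreover have "z = x + (z - x)" by simp
  ultimately show "z \<in> {x + l | x l. x \<in> convex_cone hull A \<and> l \<in> L}"
    using x(1) by blast
qed

lemma closed_cone_plus_subspace:
  assumes "finite A"
  shows "closed {x + l | x l. x \<in> convex_cone hull A \<and> l \<in> L}"
  unfolding cone_plus_subspace_eq_vimage
  using closed_vimage[OF closed_convex_cone_hull[OF finite_imageI[OF assms]]
      linear_continuous_on[OF linear_p[unfolded linear_conv_bounded_linear], of UNIV]] .

lemma cone_plus_subspace_Int_orthogonal:
  "{x + l | x l. x \<in> convex_cone hull A \<and> l \<in> L} \<inter> L\<^sup>\<bottom> = convex_cone hull (p ` A)"
proof -
  have "convex_cone hull (p ` A) \<subseteq> L\<^sup>\<bottom>"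
    unfolding convex_cone_hull_linear_image[OF linear_p] using p_orth by blast
  then show ?thesis
    unfolding cone_plus_subspace_eq_vimage using p_id by force
qed

end

lemma closure_positive_combinations:
  fixes w :: "'i \<Rightarrow> 'b::euclidean_space"
  assumes L: "subspace L" and fin: "finite \<S>"
  shows "closure {(\<Sum>S\<in>\<S>. c S *\<^sub>R w S) + l | c l. (\<forall>S\<in>\<S>. 0 < c S) \<and> l \<in> L} =
    {x + l | x l. x \<in> convex_cone hull (w ` \<S>) \<and> l \<in> L}" (is "closure ?Z = ?Q")
proof
  obtain p :: "'b \<Rightarrow> 'b" where p: "linear p" "\<And>x. p x \<in> L\<^sup>\<bottom>" "\<And>x. x - p x \<in> L"
    "\<And>x. x \<in> L\<^sup>\<bottom> \<Longrightarrow> p x = x" "\<And>x. x \<in> L \<Longrightarrow> p x = 0"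
    using exists_orthogonal_projection[OF L] by blast
  have "?Z \<subseteq> ?Q"
    unfolding convex_cone_hull_image_finite[OF fin] using less_imp_le by blast
  then show "closure ?Z \<subseteq> ?Q"
    using closed_cone_plus_subspace[OF L p finite_imageI[OF fin], of w] by (rule closure_minimal)
  show "?Q \<subseteq> closure ?Z"
  proof
    fix z assume "z \<in> ?Q"
    then obtain c l where c: "\<forall>S\<in>\<S>. 0 \<le> c S" "l \<in> L" "z = (\<Sum>S\<in>\<S>. c S *\<^sub>R w S) + l"
      unfolding convex_cone_hull_image_finite[OF fin] by blast
    \<comment> \<open>Raising every coefficient by 1 / (n + 1) makes it positive and approximates
      the given point.\<close>
    define z' where "z' n = z + inverse (real (Suc n)) *\<^sub>R (\<Sum>S\<in>\<S>. w S)" for n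
    have "z' n \<in> ?Z" for n
    proof -
      have "z' n = (\<Sum>S\<in>\<S>. (c S + inverse (real (Suc n))) *\<^sub>R w S) + l"
        by (simp add: z'_def c(3) scaleR_add_left sum.distrib scaleR_sum_right algebra_simps)
      moreover have "\<forall>S\<in>\<S>. 0 < c S + inverse (real (Suc n))"
        using c(1) by (auto intro!: add_nonneg_pos)
      ultimately show ?thesis
        using c(2) by (intro CollectI exI[of _ "\<lambda>S. c S + inverse (real (Suc n))"] exI[of _ l]) simp
    qed
    moreover have "z' \<longlonglongrightarrow> z + 0 *\<^sub>R (\<Sum>S\<in>\<S>. w S)"
      unfolding z'_def by (intro tendsto_intros LIMSEQ_inverse_real_of_nat)
    ultimately show "z \<in> closure ?Z" unfolding closure_sequential by auto
  qed
qed

section \<open>Cells of a split\<close>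

lemma polytopal_subdivision_maximal_cell:
  assumes "polytopal_subdivision P S" "C \<in> S"
  obtains D where "D \<in> maximal_cells S" "C \<subseteq> D"
proof -
  have "finite S" using assms(1) by (simp add: polytopal_subdivision_def)
  then obtain D where "D \<in> S" "C \<subseteq> D" "\<forall>E\<in>S. D \<subseteq> E \<longrightarrow> D = E"
    using finite_has_maximal2[OF _ assms(2)] by blast
  then have "D \<in> maximal_cells S" unfolding maximal_cells_def by blast
  then show ?thesis using that \<open>C \<subseteq> D\<close> by blast
qed

text \<open>A cell lies in a maximal one and meets it in a face, so the maximal cells determine the
  subdivision.\<close>

lemma polytopal_subdivision_eq_faces:
  assumes "polytopal_subdivision P S"
  shows "S = {F. \<exists>C\<in>maximal_cells S. F face_of C}"
proof (intro equalityI subsetI)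
  fix D assume D: "D \<in> S"
  obtain C where C: "C \<in> maximal_cells S" "D \<subseteq> C"
    using polytopal_subdivision_maximal_cell[OF assms D] by blast
  then have "(D \<inter> C) face_of C"
    using assms D by (auto simp: polytopal_subdivision_def maximal_cells_def)
  then show "D \<in> {F. \<exists>C\<in>maximal_cells S. F face_of C}"
    using C by (auto simp: Int_absorb2)
qed (use assms in \<open>auto simp: polytopal_subdivision_def maximal_cells_def\<close>)

lemma polytopal_subdivision_Union_maximal:
  assumes "polytopal_subdivision P S"
  shows "\<Union>(maximal_cells S) = P"
proof
  show "\<Union>(maximal_cells S) \<subseteq> P"
    using assms by (auto simp: polytopal_subdivision_def maximal_cells_def)
  show "P \<subseteq> \<Union>(maximal_cells S)"
  proof
    fix x assume "x \<in> P"
    then obtain C where "C \<in> S" "x \<in> C" using assms by (auto simp: polytopal_subdivision_def)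
    then show "x \<in> \<Union>(maximal_cells S)"
      using polytopal_subdivision_maximal_cell[OF assms] by blast
  qed
qed

text \<open>Applying u to a linear combination of points at level 1 gives the sum of the
  coefficients, which is therefore 1.\<close>

lemma span_Int_level_subset_affine_hull:
  fixes F :: "'a::euclidean_space set"
  assumes F: "\<And>x. x \<in> F \<Longrightarrow> u \<bullet> x = 1" and x: "x \<in> span F" "u \<bullet> x = 1"
  shows "x \<in> affine hull F"
proof -
  obtain t r where t: "finite t" "t \<subseteq> F" "x = (\<Sum>b\<in>t. r b *\<^sub>R b)"
    using x(1) unfolding span_explicit by blast
  have "u \<bullet> x = (\<Sum>b\<in>t. r b * (u \<bullet> b))" by (simp add: t(3) inner_sum_right)
  also have "\<dots> = sum r t" using t(2) F by (intro sum.cong) auto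
  finally have "sum r t = 1" using x(2) by simp
  moreover from this have "t \<noteq> {}" by auto
  ultimately show ?thesis
    using t unfolding affine_hull_explicit by blast
qed

lemma segment_zero:
  fixes b :: "'a::euclidean_space"
  assumes "0 < b \<bullet> y" "b \<bullet> z < 0"
  obtains r where "0 < r" "r < 1" "b \<bullet> ((1 - r) *\<^sub>R y + r *\<^sub>R z) = 0"
proof
  let ?r = "(b \<bullet> y) / (b \<bullet> y - b \<bullet> z)"
  show "0 < ?r" "?r < 1" using assms by (auto simp: divide_simps)
  show "b \<bullet> ((1 - ?r) *\<^sub>R y + ?r *\<^sub>R z) = 0"
    unfolding inner_add_right inner_scaleR_right using assms by (simp add: field_simps)
qed

text \<open>The splitting hyperplane meets the polytope exactly in the common face \<open>F\<close> of the two cells,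
  since the affine hull of \<open>F\<close> is the part of that hyperplane at level 1.\<close>

lemma split_cells_halfspaces:
  fixes P :: "'a::euclidean_space set"
  assumes conv: "convex P" and level: "\<And>x. x \<in> P \<Longrightarrow> u \<bullet> x = 1"
    and sub: "polytopal_subdivision P S"
    and max: "maximal_cells S = {Sp, Sm}" and ne: "Sp \<noteq> Sm"
    and sp: "split_hyperplane S = {x. a \<bullet> x = 0}"
  obtains b where "b = a \<or> b = - a" "Sp = P \<inter> {x. 0 \<le> b \<bullet> x}" "Sm = P \<inter> {x. b \<bullet> x \<le> 0}"
    "\<exists>x\<in>P. 0 < b \<bullet> x" "\<exists>x\<in>P. b \<bullet> x < 0" "P \<inter> {x. b \<bullet> x = 0} \<in> S"
    "span (P \<inter> {x. b \<bullet> x = 0}) = {x. b \<bullet> x = 0}"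
proof -
  define F where "F = Sp \<inter> Sm"
  have span: "span F = {x. a \<bullet> x = 0}"
    using sp max by (simp add: split_hyperplane_def F_def)
  have mem: "Sp \<in> S" "Sm \<in> S" "\<And>D. D \<in> S \<Longrightarrow> Sp \<subseteq> D \<Longrightarrow> D = Sp" "\<And>D. D \<in> S \<Longrightarrow> Sm \<subseteq> D \<Longrightarrow> D = Sm"
  proof -
    have "Sp \<in> maximal_cells S" "Sm \<in> maximal_cells S" by (simp_all add: max)
    then show "Sp \<in> S" "Sm \<in> S" "\<And>D. D \<in> S \<Longrightarrow> Sp \<subseteq> D \<Longrightarrow> D = Sp" "\<And>D. D \<in> S \<Longrightarrow> Sm \<subseteq> D \<Longrightarrow> D = Sm"
      unfolding maximal_cells_def by blast+
  qed
  have cover: "P = Sp \<union> Sm" using polytopal_subdivision_Union_maximal[OF sub] max by auto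
  have face: "F face_of Sp" "F face_of Sm" and FS: "F \<in> S"
    using sub mem(1,2) unfolding F_def polytopal_subdivision_def by blast+
  have cc: "convex Sp" "convex Sm" "closed Sp" "closed Sm"
    using sub mem(1,2) by (auto simp: polytopal_subdivision_def polytope_imp_convex polytope_imp_closed)
  have F_zero: "a \<bullet> x = 0" if "x \<in> F" for x
    using span_superset[of F] span that by blast
  have zero_F: "x \<in> F" if x: "x \<in> P" "a \<bullet> x = 0" for x
  proof -
    have "x \<in> affine hull F"
      using span_Int_level_subset_affine_hull[of F u x] level x span by (auto simp: F_def cover)
    moreover have "F = affine hull F \<inter> Sp" "F = affine hull F \<inter> Sm"
      using face_of_imp_eq_affine_Int cc face by blast+
    ultimately show ?thesis using x(1) cover by blast
  qed
  have PF: "P \<inter> {x. a \<bullet> x = 0} = F"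
    using F_zero zero_F by (auto simp: F_def cover)
  \<comment> \<open>A cell with points strictly on both sides has a point of F inside the segment
    between them; F being a face, the ends would lie in F.\<close>
  have one_side: False
    if C: "C = Sp \<or> C = Sm" and y: "y \<in> C" "0 < b \<bullet> y" and z: "z \<in> C" "b \<bullet> z < 0"
      and b: "b = a \<or> b = - a" for C y z b
  proof -
    obtain r where r: "0 < r" "r < 1" "b \<bullet> ((1 - r) *\<^sub>R y + r *\<^sub>R z) = 0"
      using segment_zero[OF y(2) z(2)] by blast
    let ?x = "(1 - r) *\<^sub>R y + r *\<^sub>R z"
    have "?x \<in> C" using convexD_alt[of C y z r] C cc y z r by auto
    then have "?x \<in> F" using zero_F[of ?x] r(3) b C cover by auto
    moreover have "?x \<in> open_segment y z"
      using r y z by (auto simp: in_segment)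
    moreover have "F face_of C" using C face by blast
    ultimately have "y \<in> F" using y z unfolding face_of_def by blast
    then show False using F_zero y b by auto
  qed
  have "\<not> Sp \<subseteq> F" using mem(3)[OF mem(2)] ne by (auto simp: F_def)
  then obtain p where p: "p \<in> Sp" "p \<notin> F" by blast
  have "\<not> Sm \<subseteq> F" using mem(4)[OF mem(1)] ne by (auto simp: F_def)
  then obtain q where q: "q \<in> Sm" "q \<notin> F" by blast
  have ap: "a \<bullet> p \<noteq> 0" "a \<bullet> q \<noteq> 0" using zero_F p q cover by auto
  define b where "b = (if 0 < a \<bullet> p then a else - a)"
  have b: "b = a \<or> b = - a" and bp: "0 < b \<bullet> p" using ap by (auto simp: b_def)
  have bq: "b \<bullet> q < 0"
  proof (rule ccontr)
    assume "\<not> b \<bullet> q < 0"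
    then have bq: "0 < b \<bullet> q" using ap(2) by (auto simp: b_def split: if_splits)
    \<comment> \<open>With q on the same side, the segment avoids F but is covered by the two closed
      cells, contradicting connectedness.\<close>
    let ?T = "closed_segment p q"
    have "?T \<subseteq> {x. 0 < b \<bullet> x}"
      using bp bq by (intro closed_segment_subset convex_halfspace_gt) auto
    then have "?T \<inter> F = {}" using F_zero b by fastforce
    moreover have "?T \<subseteq> P" using closed_segment_subset[OF _ _ conv] p q cover by blast
    ultimately have "Sp \<inter> Sm \<inter> ?T = {}" "?T \<subseteq> Sp \<union> Sm" by (auto simp: F_def cover)
    moreover have "connected ?T" by (rule connected_segment)
    moreover have "p \<in> ?T" "q \<in> ?T" by auto
    ultimately show False using cc(3,4) p(1) q(1) unfolding connected_closed by blast
  qed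
  have "Sp \<subseteq> {x. 0 \<le> b \<bullet> x}"
    using one_side[of Sp p b] p(1) bp b by (force simp: not_less[symmetric])
  moreover have "Sm \<subseteq> {x. b \<bullet> x \<le> 0}"
    using one_side[of Sm _ b q] q(1) bq b by (force simp: not_less[symmetric])
  moreover have Fb: "P \<inter> {x. b \<bullet> x = 0} = F" using PF b by auto
  moreover have "F \<subseteq> Sp" "F \<subseteq> Sm" by (auto simp: F_def)
  ultimately have "Sp = P \<inter> {x. 0 \<le> b \<bullet> x}" "Sm = P \<inter> {x. b \<bullet> x \<le> 0}"
    unfolding cover by (auto dest: antisym)
  moreover have "span (P \<inter> {x. b \<bullet> x = 0}) = {x. b \<bullet> x = 0}"
    unfolding Fb span using b by auto
  moreover have "p \<in> P" "q \<in> P" using p q cover by auto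
  ultimately show ?thesis
    using that[OF b] bp bq Fb FS by auto
qed

text \<open>A sign change of one form between p and y produces a zero on the segment. The other form
  vanishes there too and is positive at p, so it is negative at y.\<close>

lemma same_zero_set_imp_same_sign:
  fixes b b' :: "'a::euclidean_space"
  assumes conv: "convex P" and zero: "\<And>y. y \<in> P \<Longrightarrow> b \<bullet> y = 0 \<longleftrightarrow> b' \<bullet> y = 0"
    and p: "p \<in> P" "0 < b \<bullet> p" "0 < b' \<bullet> p" and y: "y \<in> P"
  shows "0 \<le> b \<bullet> y \<longleftrightarrow> 0 \<le> b' \<bullet> y" "b \<bullet> y \<le> 0 \<longleftrightarrow> b' \<bullet> y \<le> 0"
proof -
  have neg: "b' \<bullet> y < 0"
    if zero: "\<And>y. y \<in> P \<Longrightarrow> b \<bullet> y = 0 \<longleftrightarrow> b' \<bullet> y = 0"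
      and p: "0 < b \<bullet> p" "0 < b' \<bullet> p" and bneg: "b \<bullet> y < 0" for b b' :: 'a
  proof -
    obtain r where r: "0 < r" "r < 1" "b \<bullet> ((1 - r) *\<^sub>R p + r *\<^sub>R y) = 0"
      using segment_zero[OF p(1) bneg] by blast
    have "(1 - r) *\<^sub>R p + r *\<^sub>R y \<in> P"
      using convexD_alt[OF conv \<open>p \<in> P\<close> y] r by auto
    then have "b' \<bullet> ((1 - r) *\<^sub>R p + r *\<^sub>R y) = 0" using zero r(3) by blast
    then have "(1 - r) * (b' \<bullet> p) + r * (b' \<bullet> y) = 0" by (simp add: inner_add_right)
    moreover have "0 < (1 - r) * (b' \<bullet> p)" using r p(2) by simp
    ultimately have "r * (b' \<bullet> y) < 0" by linarith
    then show ?thesis using r(1) by (simp add: mult_less_0_iff)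
  qed
  have "b \<bullet> y < 0 \<longleftrightarrow> b' \<bullet> y < 0"
    using neg[of b b'] neg[of b' b] zero p by blast
  then show "0 \<le> b \<bullet> y \<longleftrightarrow> 0 \<le> b' \<bullet> y" "b \<bullet> y \<le> 0 \<longleftrightarrow> b' \<bullet> y \<le> 0"
    using zero[OF y] by (auto simp: not_less[symmetric] le_less)
qed

lemma finite_splits:
  fixes P :: "'a::euclidean_space set"
  assumes "finite (vertices P)"
  shows "finite {S. is_split P S}"
proof (rule finite_subset)
  have "C \<in> (hull) convex ` Pow (vertices P)" if S: "is_split P S" and C: "C \<in> S" for S C
  proof -
    have "polytope C" "vertices C \<subseteq> vertices P"
      using S C by (auto simp: is_split_def polytopal_subdivision_def)
    moreover from this(1) have "C = convex hull vertices C"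
      unfolding vertices_def
      using Krein_Milman_Minkowski[OF polytope_imp_compact polytope_imp_convex] by blast
    ultimately show ?thesis by blast
  qed
  then show "{S. is_split P S} \<subseteq> Pow ((hull) convex ` Pow (vertices P))" by blast
  show "finite (Pow ((hull) convex ` Pow (vertices P)))" using assms by simp
qed

section \<open>Equality of regular subdivisions\<close>

lemma tie_set_cong:
  assumes "\<And>v. v \<in> V \<Longrightarrow> \<omega> v = \<omega>' v"
  shows "tie_set V \<omega> = tie_set V \<omega>'"
proof -
  have "{v\<in>V. \<omega> v = m \<bullet> v + b} = {v\<in>V. \<omega>' v = m \<bullet> v + b}" for m b
    using assms by auto
  then show ?thesis using assms by (simp add: tie_set_def fun_eq_iff)
qed

lemma regular_subdivision_eq_iff:
  assumes "convex P" "finite (vertices P)"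
  shows "regular_subdivision P \<omega> = regular_subdivision P \<omega>' \<longleftrightarrow>
    tie_set (vertices P) \<omega> = tie_set (vertices P) \<omega>'"
proof
  assume eq: "regular_subdivision P \<omega> = regular_subdivision P \<omega>'"
  have *: "tie_set (vertices P) \<omega>' E"
    if eq: "regular_subdivision P \<omega> = regular_subdivision P \<omega>'" and E: "tie_set (vertices P) \<omega> E"
    for \<omega> \<omega>' E
  proof -
    have "convex hull E \<in> (hull) convex ` {E. tie_set (vertices P) \<omega>' E}"
      using eq E unfolding regular_subdivision_eq[OF assms(2)] by blast
    then obtain E' where E': "tie_set (vertices P) \<omega>' E'" "convex hull E = convex hull E'" by blast
    then have "E = E'"
      using vertices_Int_convex_hull[OF assms(1) tie_set_subset] E by metis
    then show ?thesis using E'(1) by simp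
  qed
  show "tie_set (vertices P) \<omega> = tie_set (vertices P) \<omega>'"
    using *[OF eq] *[OF eq[symmetric]] by blast
qed (simp add: regular_subdivision_eq[OF assms(2)])

section \<open>The hypersimplex\<close>

lemma char_vec_nth [simp]: "char_vec A $ i = (if i \<in> A then 1 else 0)"
  by (simp add: char_vec_def)

lemma char_vec_support [simp]: "{i. char_vec A $ i = 1} = A"
  by auto

lemma inner_char_vec: "b \<bullet> char_vec A = sum (\<lambda>i. b $ i) A"
proof -
  have "b \<bullet> char_vec A = (\<Sum>i\<in>UNIV. if i \<in> A then b $ i else 0)"
    unfolding inner_vec_def by (intro sum.cong) auto
  then show ?thesis by (simp add: sum.If_cases)
qed

lemma weight_fun_char_vec [simp]: "weight_fun w (char_vec A) = w $ A"
  by (simp only: weight_fun_def char_vec_support)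

lemma hypersimplex_eq: "hypersimplex k = cbox 0 (1 :: real^'n) \<inter> {x. 1 \<bullet> x = real k}"
  by (auto simp: hypersimplex_def mem_box_cart inner_vec_def)

lemma convex_hypersimplex: "convex (hypersimplex k)"
  unfolding hypersimplex_eq by (intro convex_Int convex_box convex_hyperplane)

lemma compact_hypersimplex: "compact (hypersimplex k)"
  unfolding hypersimplex_eq by (intro compact_Int_closed compact_cbox closed_hyperplane)

lemma char_vec_in_hypersimplex: "char_vec A \<in> hypersimplex (card A)"
  by (auto simp: hypersimplex_def char_vec_def sum.If_cases)

text \<open>An extreme point has no fractional coordinate: as the sum is an integer there would be a
  second one, and moving a small amount between the two in either direction stays in the
  hypersimplex.\<close>

lemma vertices_hypersimplex:
  "vertices (hypersimplex k :: (real^'n) set) = char_vec ` {A. card A = k}"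
proof (intro equalityI subsetI)
  fix v :: "real^'n" assume "v \<in> char_vec ` {A. card A = k}"
  then obtain A where v: "v = char_vec A" "card A = k" by blast
  have "False" if xy: "x \<in> hypersimplex k" "y \<in> hypersimplex k" "v \<in> open_segment x y" for x y
  proof -
    obtain r where r: "0 < r" "r < 1" "v = (1 - r) *\<^sub>R x + r *\<^sub>R y" "x \<noteq> y"
      using xy(3) by (auto simp: in_segment)
    have "x $ i = y $ i" for i
    proof -
      have b: "0 \<le> x $ i" "x $ i \<le> 1" "0 \<le> y $ i" "y $ i \<le> 1"
        using xy by (auto simp: hypersimplex_def)
      have e: "v $ i = (1 - r) * x $ i + r * y $ i" by (simp add: r(3))
      show ?thesis
      proof (cases "i \<in> A")
        case True
        then have "(1 - r) * (1 - x $ i) + r * (1 - y $ i) = 0"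
          using e by (simp add: v(1) algebra_simps)
        moreover have "0 \<le> (1 - r) * (1 - x $ i)" "0 \<le> r * (1 - y $ i)" using r b by auto
        ultimately have "(1 - r) * (1 - x $ i) = 0" "r * (1 - y $ i) = 0" by linarith+
        then show ?thesis using r by auto
      next
        case False
        then have "(1 - r) * x $ i + r * y $ i = 0" using e by (simp add: v(1))
        moreover have "0 \<le> (1 - r) * x $ i" "0 \<le> r * y $ i" using r b by auto
        ultimately have "(1 - r) * x $ i = 0" "r * y $ i = 0" by linarith+
        then show ?thesis using r by auto
      qed
    qed
    then show False using r(4) by (simp add: vec_eq_iff)
  qed
  then show "v \<in> vertices (hypersimplex k)"
    using char_vec_in_hypersimplex[of A] v by (auto simp: vertices_def extreme_point_of_def)
next
  fix v :: "real^'n" assume "v \<in> vertices (hypersimplex k)"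
  then have ext: "v extreme_point_of hypersimplex k" and "v \<in> hypersimplex k"
    by (auto simp: vertices_def extreme_point_of_def)
  then have v: "\<And>i. 0 \<le> v $ i" "\<And>i. v $ i \<le> 1" "(\<Sum>i\<in>UNIV. v $ i) = real k"
    by (auto simp: hypersimplex_def)
  define A where "A = {i. v $ i = 1}"
  define Fr where "Fr = {i. v $ i \<noteq> 0 \<and> v $ i \<noteq> 1}"
  have sum: "(\<Sum>i\<in>UNIV. v $ i) = real (card A) + (\<Sum>i\<in>Fr. v $ i)"
  proof -
    have "(\<Sum>i\<in>UNIV. v $ i) = (\<Sum>i\<in>UNIV. (if i \<in> A then 1 else 0) + (if i \<in> Fr then v $ i else 0))"
      by (intro sum.cong) (auto simp: A_def Fr_def)
    then show ?thesis by (simp add: sum.distrib sum.If_cases)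
  qed
  have "Fr = {}"
  proof (rule ccontr)
    assume "Fr \<noteq> {}"
    then obtain i where i: "i \<in> Fr" by blast
    have vi: "0 < v $ i" "v $ i < 1" using i v(1,2)[of i] by (auto simp: Fr_def less_le)
    have "\<exists>j\<in>Fr. j \<noteq> i"
    proof (rule ccontr)
      assume "\<not> ?thesis"
      then have "Fr = {i}" using i by blast
      then have "v $ i = real k - real (card A)" using sum v(3) by simp
      then have "v $ i = real_of_int (int k - int (card A))" by simp
      then show False using vi by (metis of_int_0_less_iff of_int_less_1_iff zless_add1_eq not_less add_0 less_le_not_le zero_less_iff_neq_zero int_one_le_iff_zero_less)
    qed
    then obtain j where j: "j \<in> Fr" "j \<noteq> i" by blast
    have vj: "0 < v $ j" "v $ j < 1" using j v(1,2)[of j] by (auto simp: Fr_def less_le)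
    define d where "d = min (min (v $ i) (1 - v $ i)) (min (v $ j) (1 - v $ j))"
    have d: "0 < d" "d \<le> v $ i" "d \<le> 1 - v $ i" "d \<le> v $ j" "d \<le> 1 - v $ j"
      using vi vj by (auto simp: d_def)
    define w :: "real^'n" where "w = (\<chi> l. if l = i then d else if l = j then - d else 0)"
    have "(\<Sum>l\<in>UNIV. w $ l) = (\<Sum>l\<in>UNIV. (if l = i then d else 0) + (if l = j then - d else 0))"
      using j(2) by (intro sum.cong) (auto simp: w_def)
    also have "\<dots> = 0" by (simp add: sum.distrib)
    finally have w0: "(\<Sum>l\<in>UNIV. w $ l) = 0" .
    have "v - w \<in> hypersimplex k" "v + w \<in> hypersimplex k"
      using v w0 d by (auto simp: hypersimplex_def sum.distrib sum_subtractf w_def)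
    moreover have "w $ i \<noteq> 0" using d(1) by (simp add: w_def)
    then have "w \<noteq> 0" by auto
    ultimately show False using not_extreme_point_symmetric ext by blast
  qed
  then have "v = char_vec A" by (auto simp: vec_eq_iff Fr_def A_def)
  moreover have "card A = k" using sum v(3) \<open>Fr = {}\<close> by simp
  ultimately show "v \<in> char_vec ` {A. card A = k}" by blast
qed

lemma finite_vertices_hypersimplex: "finite (vertices (hypersimplex k :: (real^'n) set))"
  by (simp add: vertices_hypersimplex)

text \<open>A convex combination of vertices of the hypersimplex which lies on the edge between two
  neighbouring vertices only uses these two.\<close>

lemma no_split_of_edge:
  fixes b :: "real^'n"
  assumes verts: "vertices (hypersimplex k \<inter> {x. b \<bullet> x = 0}) \<subseteq> vertices (hypersimplex k)"
    and A: "card A = k" "i \<in> A" "j \<notin> A"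
  shows "0 \<le> (b \<bullet> char_vec A) * (b \<bullet> char_vec (insert j (A - {i})))"
proof (rule ccontr)
  let ?A' = "insert j (A - {i})" and ?F = "hypersimplex k \<inter> {x. b \<bullet> x = 0}"
  assume neg: "\<not> ?thesis"
  have A': "card ?A' = k" using A card_Suc_Diff1[of A i] by simp
  have "\<exists>r. 0 < r \<and> r < 1 \<and> b \<bullet> ((1 - r) *\<^sub>R char_vec A + r *\<^sub>R char_vec ?A') = 0"
  proof -
    consider "0 < b \<bullet> char_vec A" "b \<bullet> char_vec ?A' < 0" |
      "0 < (- b) \<bullet> char_vec A" "(- b) \<bullet> char_vec ?A' < 0"
      using neg by (auto simp only: not_le mult_less_0_iff inner_minus_left neg_0_less_iff_less neg_less_0_iff_less)
    then show ?thesis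
    proof cases
      case 1
      then show ?thesis using segment_zero[OF 1] by blast
    next
      case 2
      then obtain r where "0 < r" "r < 1" "(- b) \<bullet> ((1 - r) *\<^sub>R char_vec A + r *\<^sub>R char_vec ?A') = 0"
        using segment_zero[OF 2] by blast
      then show ?thesis unfolding inner_minus_left by (intro exI[of _ r]) linarith
    qed
  qed
  then obtain r where r: "0 < r" "r < 1" "b \<bullet> ((1 - r) *\<^sub>R char_vec A + r *\<^sub>R char_vec ?A') = 0"
    by blast
  define x where "x = (1 - r) *\<^sub>R char_vec A + r *\<^sub>R char_vec ?A'"
  have "x \<in> hypersimplex k"
    unfolding x_def using char_vec_in_hypersimplex[of A] char_vec_in_hypersimplex[of ?A'] A(1) A' r
    by (intro convexD[OF convex_hypersimplex]) auto
  then have xF: "x \<in> ?F" using r(3) by (simp add: x_def)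
  have "convex ?F" "compact ?F"
    by (auto intro!: convex_Int convex_hypersimplex convex_hyperplane
        compact_Int_closed compact_hypersimplex closed_hyperplane)
  then have hull: "x \<in> convex hull (vertices ?F)"
    using Krein_Milman_Minkowski[of ?F] xF unfolding vertices_def by blast
  \<comment> \<open>On the hypersimplex D is the l1-distance to the indicator of A in the
    coordinates other than i and j, so it is nonnegative there; m is its linear part.\<close>
  define m :: "real^'n" where
    "m = (\<chi> l. if l = i \<or> l = j then 0 else if l \<in> A then - 1 else 1)"
  define D where
    "D y = (\<Sum>l\<in>UNIV. if l = i \<or> l = j then 0 else if l \<in> A then 1 - y $ l else y $ l)" for y :: "real^'n"
  have mD: "m \<bullet> y = D y - real (card (A - {i}))" for y
  proof -
    have "D y = (\<Sum>l\<in>UNIV. m $ l * y $ l + (if l \<in> A - {i} then 1 else 0))"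
      unfolding D_def m_def using A(3) by (intro sum.cong) auto
    also have "\<dots> = m \<bullet> y + real (card (A - {i}))"
      by (simp add: sum.distrib inner_vec_def sum.If_cases del: Diff_iff)
    finally show ?thesis by simp
  qed
  have D_nonneg: "0 \<le> D v" and D_eq: "D v = 0 \<longleftrightarrow> (\<forall>l. l \<noteq> i \<and> l \<noteq> j \<longrightarrow> v $ l = (if l \<in> A then 1 else 0))"
    if "v \<in> hypersimplex k" for v
    using that unfolding D_def
    by (auto intro!: sum_nonneg simp: hypersimplex_def sum_nonneg_eq_0_iff)
  have VF: "vertices ?F \<subseteq> ?F" by (auto simp: vertices_def extreme_point_of_def)
  have "D x = 0" using D_eq[of x] xF A(2,3) by (auto simp: x_def)
  then have "x \<in> convex hull (vertices ?F \<inter> {y. m \<bullet> y = - real (card (A - {i}))})"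
    using convex_hull_exposed_subset(1)[of "vertices ?F" "- real (card (A - {i}))" m]
      finite_subset[OF verts finite_vertices_hypersimplex] D_nonneg VF hull by (auto simp: mD)
  moreover have "vertices ?F \<inter> {y. m \<bullet> y = - real (card (A - {i}))} = {}"
  proof (rule ccontr)
    assume "\<not> ?thesis"
    then obtain v where v: "v \<in> vertices ?F" "D v = 0" by (auto simp: mD)
    then obtain B where B: "v = char_vec B" "card B = k"
      using verts by (auto simp: vertices_hypersimplex)
    have "v \<in> hypersimplex k" using v(1) VF by blast
    then have "l \<in> B \<longleftrightarrow> l \<in> A" if "l \<noteq> i" "l \<noteq> j" for l
      using v(2) D_eq[of v] that by (auto simp: B(1) split: if_splits)
    then have Bij: "B - {i, j} = A - {i}" using A(2,3) by auto
    \<comment> \<open>The size k leaves exactly one of i and j in B. Neither A nor ?A' lies on the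
      hyperplane, as their values have a negative product.\<close>
    have "B = A \<or> B = ?A'"
    proof (cases "i \<in> B"; cases "j \<in> B")
      assume "i \<in> B" "j \<in> B"
      then have "B = insert j A" using Bij A(2) by auto
      then have "card B = Suc (card A)" using A(3) by simp
      then show ?thesis using A(1) B(2) by simp
    next
      assume "i \<notin> B" "j \<notin> B"
      then have "B = A - {i}" using Bij by auto
      then have "card B < card A" using card_Diff1_less[OF finite A(2)] by (simp only:)
      then show ?thesis using A(1) B(2) by simp
    qed (use Bij A in auto)
    then show False using v(1) VF neg B(1) by auto
  qed
  ultimately show False by simp
qed

section \<open>The secondary fan and the split complex\<close>

text \<open>Absorbs the choice of the normal and of the order of the cells into one vector b,
  oriented so that \<open>Sp\<close> is its nonnegative side.\<close>

lemma split_weight_normal: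
  fixes P :: "'a::euclidean_space set"
  assumes conv: "convex P" and level: "\<And>x. x \<in> P \<Longrightarrow> u \<bullet> x = 1"
    and split: "is_split P S" and weight: "split_weight P S \<omega>"
  obtains b where "maximal_cells S = {P \<inter> {x. 0 \<le> b \<bullet> x}, P \<inter> {x. b \<bullet> x \<le> 0}}"
    "\<exists>x\<in>P. 0 < b \<bullet> x" "\<exists>x\<in>P. b \<bullet> x < 0"
    "vertices (P \<inter> {x. b \<bullet> x = 0}) \<subseteq> vertices P"
    "span (P \<inter> {x. b \<bullet> x = 0}) = {x. b \<bullet> x = 0}"
    "split_hyperplane S = {x. b \<bullet> x = 0}"
    "\<forall>v\<in>vertices P. \<omega> v = max 0 (b \<bullet> v)"
proof -
  obtain Sp Sm a where *: "maximal_cells S = {Sp, Sm} \<and> Sp \<noteq> Sm \<and> a \<noteq> 0 \<and>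
      split_hyperplane S = {x. a \<bullet> x = 0} \<and>
      (\<forall>v\<in>vertices P. (v \<in> Sp \<longrightarrow> \<omega> v = \<bar>a \<bullet> v\<bar>) \<and> (v \<in> Sm \<longrightarrow> \<omega> v = 0))"
    using weight unfolding split_weight_def by (elim exE) (rule that)
  then have max: "maximal_cells S = {Sp, Sm}" and ne: "Sp \<noteq> Sm"
    and sp: "split_hyperplane S = {x. a \<bullet> x = 0}" by simp_all
  have \<omega>: "v \<in> Sp \<Longrightarrow> \<omega> v = \<bar>a \<bullet> v\<bar>" "v \<in> Sm \<Longrightarrow> \<omega> v = 0" if "v \<in> vertices P" for v
    using * that by blast+
  have sub: "polytopal_subdivision P S" and new: "\<And>C. C \<in> S \<Longrightarrow> vertices C \<subseteq> vertices P"
    using split by (auto simp: is_split_def)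
  obtain b where b: "b = a \<or> b = - a" "Sp = P \<inter> {x. 0 \<le> b \<bullet> x}" "Sm = P \<inter> {x. b \<bullet> x \<le> 0}"
    "\<exists>x\<in>P. 0 < b \<bullet> x" "\<exists>x\<in>P. b \<bullet> x < 0" "P \<inter> {x. b \<bullet> x = 0} \<in> S"
    "span (P \<inter> {x. b \<bullet> x = 0}) = {x. b \<bullet> x = 0}"
    using split_cells_halfspaces[OF conv level sub max ne sp] by blast
  show ?thesis
  proof (rule that[of b])
    show "maximal_cells S = {P \<inter> {x. 0 \<le> b \<bullet> x}, P \<inter> {x. b \<bullet> x \<le> 0}}"
      using max b(2,3) by simp
    show "vertices (P \<inter> {x. b \<bullet> x = 0}) \<subseteq> vertices P" using new[OF b(6)] .
    have "{x. a \<bullet> x = 0} = {x. b \<bullet> x = 0}" using b(1) by (elim disjE) simp_all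
    then show "split_hyperplane S = {x. b \<bullet> x = 0}" using sp by simp
    show "\<forall>v\<in>vertices P. \<omega> v = max 0 (b \<bullet> v)"
    proof
      fix v assume v: "v \<in> vertices P"
      then have "v \<in> P" unfolding vertices_def extreme_point_of_def by blast
      show "\<omega> v = max 0 (b \<bullet> v)"
      proof (cases "0 \<le> b \<bullet> v")
        case True
        then have "\<omega> v = \<bar>a \<bullet> v\<bar>" using \<omega>[OF v] \<open>v \<in> P\<close> b(2) by simp
        also have "\<dots> = \<bar>b \<bullet> v\<bar>" using b(1) by (elim disjE) simp_all
        finally show ?thesis using True by simp
      next
        case False
        then show ?thesis using \<omega>[OF v] \<open>v \<in> P\<close> b(3) by simp
      qed
    qed
  qed (rule b)+
qed

text \<open>Proportional absolute values have the same zeros on P, so both splits cut P into the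
  same two parts, possibly swapped; maximal cells determine the subdivision.\<close>

lemma split_eqI:
  fixes P :: "'a::euclidean_space set"
  assumes conv: "convex P" and S: "is_split P S" and T: "is_split P T"
    and maxS: "maximal_cells S = {P \<inter> {x. 0 \<le> b \<bullet> x}, P \<inter> {x. b \<bullet> x \<le> 0}}"
    and maxT: "maximal_cells T = {P \<inter> {x. 0 \<le> b' \<bullet> x}, P \<inter> {x. b' \<bullet> x \<le> 0}}"
    and pos: "\<exists>x\<in>P. 0 < b \<bullet> x" and c: "0 < c"
    and eq: "\<And>y. y \<in> P \<Longrightarrow> c * \<bar>b \<bullet> y\<bar> = \<bar>b' \<bullet> y\<bar>"
  shows "S = T"
proof -
  have zero: "b \<bullet> y = 0 \<longleftrightarrow> b' \<bullet> y = 0" if "y \<in> P" for y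
  proof -
    have "b \<bullet> y = 0 \<longleftrightarrow> c * \<bar>b \<bullet> y\<bar> = 0" using c by simp
    then show ?thesis using eq[OF that] by simp
  qed
  obtain p where p: "p \<in> P" "0 < b \<bullet> p" using pos by blast
  have "maximal_cells S = maximal_cells T"
  proof (cases "0 < b' \<bullet> p")
    case True
    have "P \<inter> {x. 0 \<le> b \<bullet> x} = P \<inter> {x. 0 \<le> b' \<bullet> x}" "P \<inter> {x. b \<bullet> x \<le> 0} = P \<inter> {x. b' \<bullet> x \<le> 0}"
      using same_zero_set_imp_same_sign[OF conv zero p True] by blast+
    then show ?thesis using maxS maxT by simp
  next
    case False
    then have "0 < (- b') \<bullet> p" using zero[OF p(1)] p(2) by auto
    note * = same_zero_set_imp_same_sign[OF conv _ p this]
    have "P \<inter> {x. 0 \<le> b \<bullet> x} = P \<inter> {x. b' \<bullet> x \<le> 0}" "P \<inter> {x. b \<bullet> x \<le> 0} = P \<inter> {x. 0 \<le> b' \<bullet> x}"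
      using * zero by auto
    then show ?thesis using maxS maxT by (simp add: insert_commute)
  qed
  moreover have "S = {F. \<exists>C\<in>maximal_cells S. F face_of C}" "T = {F. \<exists>C\<in>maximal_cells T. F face_of C}"
    using polytopal_subdivision_eq_faces S T by (auto simp only: is_split_def)
  ultimately show ?thesis by simp
qed

section \<open>Weight functions modulo affine functions\<close>

lemma weight_fun_sum:
  "weight_fun (\<Sum>S\<in>\<S>. c S *\<^sub>R w S) v = (\<Sum>S\<in>\<S>. c S * weight_fun (w S) v)"
  by (simp add: weight_fun_def sum_component)

lemma subspace_weight_space: "subspace (weight_space k)"
  by (auto simp: subspace_def weight_space_def)

text \<open>Provides the level form of \<open>split_system\<close>: the coordinates sum to k, which
  is nonzero.\<close>

lemma inner_one_hypersimplex:
  assumes "1 \<le> k" "x \<in> hypersimplex k"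
  shows "((1 / real k) *\<^sub>R (1 :: real^'n)) \<bullet> x = 1"
  using assms by (simp add: hypersimplex_eq)

lemma mem_lineality_iff:
  fixes l :: "real^('n::finite set)"
  assumes k: "1 \<le> k"
  shows "l \<in> lineality k \<longleftrightarrow> l \<in> weight_space k \<and>
    (\<exists>m::real^'n. \<forall>v\<in>vertices (hypersimplex k). weight_fun l v = m \<bullet> v)"
proof
  assume "l \<in> lineality k"
  then obtain c :: "real^'n" and d where l: "l \<in> weight_space k"
    "\<And>A. card A = k \<Longrightarrow> l $ A = c \<bullet> char_vec A + d"
    by (auto simp: lineality_def)
  let ?u = "(1 / real k) *\<^sub>R (1 :: real^'n)"
  have "weight_fun l v = (c + d *\<^sub>R ?u) \<bullet> v" if v: "v \<in> vertices (hypersimplex k)" for v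
  proof -
    obtain A where A: "v = char_vec A" "card A = k" using v by (auto simp: vertices_hypersimplex)
    have "?u \<bullet> v = 1"
      using inner_one_hypersimplex[OF k] char_vec_in_hypersimplex[of A] A by blast
    then show ?thesis using l(2)[OF A(2)] A(1) by (simp only: inner_add_left inner_scaleR_left weight_fun_char_vec)
  qed
  then show "l \<in> weight_space k \<and> (\<exists>m::real^'n. \<forall>v\<in>vertices (hypersimplex k). weight_fun l v = m \<bullet> v)"
    using l(1) by blast
next
  assume "l \<in> weight_space k \<and> (\<exists>m::real^'n. \<forall>v\<in>vertices (hypersimplex k). weight_fun l v = m \<bullet> v)"
  then obtain m :: "real^'n" where "l \<in> weight_space k"
    "\<And>v. v \<in> vertices (hypersimplex k) \<Longrightarrow> weight_fun l v = m \<bullet> v" by blast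
  then have "l \<in> weight_space k" "\<forall>A. card A = k \<longrightarrow> l $ A = m \<bullet> char_vec A + 0"
    by (auto simp: vertices_hypersimplex simp flip: weight_fun_char_vec)
  then show "l \<in> lineality k" unfolding lineality_def by blast
qed

lemma subspace_lineality: "subspace (lineality k :: (real^('n::finite set)) set)"
proof (rule subspaceI)
  show "0 \<in> (lineality k :: (real^('n set)) set)"
    by (auto simp: lineality_def weight_space_def intro!: exI[of _ 0])
next
  fix x y :: "real^('n set)"
  assume "x \<in> lineality k" "y \<in> lineality k"
  then obtain c d c' d' where "x \<in> weight_space k" "y \<in> weight_space k"
    "\<forall>A. card A = k \<longrightarrow> x $ A = c \<bullet> char_vec A + d" "\<forall>A. card A = k \<longrightarrow> y $ A = c' \<bullet> char_vec A + d'"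
    unfolding lineality_def by blast
  then show "x + y \<in> lineality k"
    by (auto simp: lineality_def weight_space_def inner_add_left intro!: exI[of _ "c + c'"] exI[of _ "d + d'"])
next
  fix r and x :: "real^('n set)"
  assume "x \<in> lineality k"
  then obtain c d where "x \<in> weight_space k" "\<forall>A. card A = k \<longrightarrow> x $ A = c \<bullet> char_vec A + d"
    unfolding lineality_def by blast
  then show "r *\<^sub>R x \<in> lineality k"
    by (auto simp: lineality_def weight_space_def algebra_simps intro!: exI[of _ "r *\<^sub>R c"] exI[of _ "r * d"])
qed

text \<open>Holds one normal per split, as produced by \<open>split_weight_normal\<close>, so that
  they can serve as a \<open>split_system\<close>. The bound \<open>k_le\<close> ensures that the
  hypersimplex has a vertex.\<close>

locale hypersimplex_splits =
  fixes k :: nat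
    and w :: "(real^'n) set set \<Rightarrow> real^('n::finite set)"
    and a :: "(real^'n) set set \<Rightarrow> real^'n"
  assumes k_ge: "1 \<le> k" and k_le: "k \<le> CARD('n)"
    and cells: "is_split (hypersimplex k) S \<Longrightarrow>
      maximal_cells S = {hypersimplex k \<inter> {x. 0 \<le> a S \<bullet> x}, hypersimplex k \<inter> {x. a S \<bullet> x \<le> 0}}"
    and normal_pos: "is_split (hypersimplex k) S \<Longrightarrow> \<exists>x\<in>hypersimplex k. 0 < a S \<bullet> x"
    and normal_neg: "is_split (hypersimplex k) S \<Longrightarrow> \<exists>x\<in>hypersimplex k. a S \<bullet> x < 0"
    and normal_vertices: "is_split (hypersimplex k) S \<Longrightarrow>
      vertices (hypersimplex k \<inter> {x. a S \<bullet> x = 0}) \<subseteq> vertices (hypersimplex k)"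
    and normal_span: "is_split (hypersimplex k) S \<Longrightarrow>
      span (hypersimplex k \<inter> {x. a S \<bullet> x = 0}) = {x. a S \<bullet> x = 0}"
    and hyperplane: "is_split (hypersimplex k) S \<Longrightarrow> split_hyperplane S = {x. a S \<bullet> x = 0}"
    and weight_eq: "is_split (hypersimplex k) S \<Longrightarrow> v \<in> vertices (hypersimplex k) \<Longrightarrow>
      weight_fun (w S) v = max 0 (a S \<bullet> v)"
    and weight_mem: "is_split (hypersimplex k) S \<Longrightarrow> w S \<in> weight_space k"
begin

sublocale split_system "hypersimplex k" "{S. is_split (hypersimplex k) S}" a
  "(1 / real k) *\<^sub>R (1 :: real^'n)"
proof
  show "S = T" if "S \<in> {S. is_split (hypersimplex k) S}" "T \<in> {S. is_split (hypersimplex k) S}"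
    "0 < c" "\<And>y. y \<in> hypersimplex k \<Longrightarrow> c * \<bar>a S \<bullet> y\<bar> = \<bar>a T \<bullet> y\<bar>" for S T c
    using split_eqI[OF convex_hypersimplex _ _ cells cells normal_pos that(3,4)] that(1,2) by blast
  show "((1 / real k) *\<^sub>R (1 :: real^'n)) \<bullet> x = 1" if "x \<in> hypersimplex k" for x
    using inner_one_hypersimplex[OF k_ge that] .
qed (use normal_pos normal_neg normal_vertices normal_span compact_hypersimplex convex_hypersimplex
    finite_vertices_hypersimplex in auto)

lemma split_complex_iff: "\<S> \<in> split_complex (hypersimplex k) \<longleftrightarrow> compatible_family \<S>"
proof -
  have "pairwise (compatible_splits (hypersimplex k)) \<S> \<longleftrightarrow> pairwise compatible \<S>"
    if "\<S> \<subseteq> {S. is_split (hypersimplex k) S}"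
    using that by (auto simp: pairwise_def compatible_splits_def compatible_def hyperplane subset_iff)
  moreover have "finite \<S>" if "\<S> \<subseteq> {S. is_split (hypersimplex k) S}"
    using finite_subset[OF that finite_splits[OF finite_vertices_hypersimplex]] .
  ultimately show ?thesis
    unfolding split_complex_def compatible_family_def by blast
qed

lemma weight_fun_combination:
  assumes "compatible_family \<S>" "v \<in> vertices (hypersimplex k)"
  shows "weight_fun (\<Sum>S\<in>\<S>. c S *\<^sub>R w S) v = split_sum \<S> c v"
  unfolding weight_fun_sum split_sum_def
  using assms weight_eq by (intro sum.cong) (auto simp: compatible_family_def)

lemma combination_weight_space:
  assumes "compatible_family \<S>"
  shows "(\<Sum>S\<in>\<S>. c S *\<^sub>R w S) \<in> weight_space k"
  using assms weight_mem
  by (intro subspace_sum[OF subspace_weight_space] subspace_scale[OF subspace_weight_space])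
    (auto simp: compatible_family_def)

lemma combination_unique_mod_lineality:
  assumes "compatible_family \<S>" "compatible_family \<T>"
    and "\<And>S. S \<in> \<S> \<Longrightarrow> 0 \<le> c S" "\<And>S. S \<in> \<T> \<Longrightarrow> 0 \<le> d S"
    and diff: "(\<Sum>S\<in>\<S>. c S *\<^sub>R w S) - (\<Sum>S\<in>\<T>. d S *\<^sub>R w S) \<in> lineality k"
    and "S \<in> \<S>" "0 < c S"
  shows "S \<in> \<T> \<and> d S = c S"
proof -
  obtain m where m: "\<And>v. v \<in> vertices (hypersimplex k) \<Longrightarrow>
      weight_fun ((\<Sum>S\<in>\<S>. c S *\<^sub>R w S) - (\<Sum>S\<in>\<T>. d S *\<^sub>R w S)) v = m \<bullet> v"
    using diff mem_lineality_iff[OF k_ge] by blast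
  have "split_sum \<S> c v = split_sum \<T> d v + m \<bullet> v" if "v \<in> vertices (hypersimplex k)" for v
  proof -
    have "split_sum \<S> c v - split_sum \<T> d v = m \<bullet> v"
      unfolding weight_fun_combination[OF assms(1) that, symmetric]
        weight_fun_combination[OF assms(2) that, symmetric] m[OF that, symmetric]
      by (simp add: weight_fun_def)
    then show ?thesis by linarith
  qed
  then show ?thesis
    using split_sum_unique[of \<S> c \<T> d m S] assms(1-4,6,7) by blast
qed

text \<open>Adding a linear form and changing positive coefficients both keep the tie sets; the
  coefficients 1 serve as a common reference.\<close>

lemma tie_set_combination:
  assumes fam: "compatible_family \<S>" and c: "\<And>S. S \<in> \<S> \<Longrightarrow> 0 < c S" and l: "l \<in> lineality k"
  shows "tie_set (vertices (hypersimplex k)) (weight_fun ((\<Sum>S\<in>\<S>. c S *\<^sub>R w S) + l)) E \<longleftrightarrow>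
    tie_set (vertices (hypersimplex k)) (split_sum \<S> (\<lambda>_. 1)) E"
proof -
  obtain m where m: "\<And>v. v \<in> vertices (hypersimplex k) \<Longrightarrow> weight_fun l v = m \<bullet> v"
    using l mem_lineality_iff[OF k_ge] by blast
  have "weight_fun ((\<Sum>S\<in>\<S>. c S *\<^sub>R w S) + l) v = split_sum \<S> c v + m \<bullet> v"
    if "v \<in> vertices (hypersimplex k)" for v
    unfolding weight_fun_combination[OF fam that, symmetric] m[OF that, symmetric]
    by (simp add: weight_fun_def)
  then have "tie_set (vertices (hypersimplex k)) (weight_fun ((\<Sum>S\<in>\<S>. c S *\<^sub>R w S) + l)) =
      tie_set (vertices (hypersimplex k)) (\<lambda>v. split_sum \<S> c v + m \<bullet> v)"
    by (rule tie_set_cong)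
  then have "tie_set (vertices (hypersimplex k)) (weight_fun ((\<Sum>S\<in>\<S>. c S *\<^sub>R w S) + l)) E \<longleftrightarrow>
      tie_set (vertices (hypersimplex k)) (split_sum \<S> c) E"
    by (simp add: tie_set_add_linear)
  also have "\<dots> \<longleftrightarrow> tie_set (vertices (hypersimplex k)) (split_sum \<S> (\<lambda>_. 1)) E"
    using tie_set_positive_coefficients[OF fam, of c "\<lambda>_. 1" E]
      tie_set_positive_coefficients[OF fam, of "\<lambda>_. 1" c E] c by auto
  finally show ?thesis .
qed

lemma tie_set_sum_weights:
  assumes "compatible_family \<S>"
  shows "tie_set (vertices (hypersimplex k)) (weight_fun (\<Sum>S\<in>\<S>. w S)) =
    tie_set (vertices (hypersimplex k)) (split_sum \<S> (\<lambda>_. 1))"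
  using tie_set_combination[OF assms, of "\<lambda>_. 1" 0] subspace_0[OF subspace_lineality]
  by (auto simp: fun_eq_iff)

text \<open>\<open>tie_set_combination\<close> and
  \<open>same_tie_sets_imp_positive_combination\<close> give the two inclusions for positive
  coefficients; taking closures admits zero coefficients.\<close>

lemma secondary_cone_sum_weights:
  assumes fam: "compatible_family \<S>"
  shows "secondary_cone k (\<Sum>S\<in>\<S>. w S) = split_cone k w \<S>"
proof -
  let ?w0 = "\<Sum>S\<in>\<S>. w S" and ?V = "vertices (hypersimplex k) :: (real^'n) set"
  have fin: "finite \<S>" using fam by (simp add: compatible_family_def)
  have induced_eq: "induced_subdivision k x = induced_subdivision k y \<longleftrightarrow>
      tie_set ?V (weight_fun x) = tie_set ?V (weight_fun y)" for x y
    unfolding induced_subdivision_def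
    by (rule regular_subdivision_eq_iff[OF convex_hypersimplex finite_vertices_hypersimplex])
  have "{w' \<in> weight_space k. induced_subdivision k w' = induced_subdivision k ?w0} =
      {(\<Sum>S\<in>\<S>. c S *\<^sub>R w S) + l | c l. (\<forall>S\<in>\<S>. 0 < c S) \<and> l \<in> lineality k}"
  proof (intro equalityI subsetI)
    fix w' assume "w' \<in> {w' \<in> weight_space k. induced_subdivision k w' = induced_subdivision k ?w0}"
    then have w': "w' \<in> weight_space k"
      and "tie_set ?V (weight_fun w') = tie_set ?V (split_sum \<S> (\<lambda>_. 1))"
      using tie_set_sum_weights[OF fam] by (auto simp: induced_eq)
    then obtain d m where d: "\<And>S. S \<in> \<S> \<Longrightarrow> 0 < d S"
        and m: "\<And>v. v \<in> ?V \<Longrightarrow> weight_fun w' v = split_sum \<S> d v + m \<bullet> v"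
      using same_tie_sets_imp_positive_combination[OF fam, of "\<lambda>_. 1" "weight_fun w'"] by auto
    let ?l = "w' - (\<Sum>S\<in>\<S>. d S *\<^sub>R w S)"
    have "weight_fun ?l v = m \<bullet> v" if "v \<in> ?V" for v
    proof -
      have "weight_fun ?l v = weight_fun w' v - weight_fun (\<Sum>S\<in>\<S>. d S *\<^sub>R w S) v"
        by (simp add: weight_fun_def)
      then show ?thesis using m[OF that] weight_fun_combination[OF fam that] by simp
    qed
    moreover have "?l \<in> weight_space k"
      using w' combination_weight_space[OF fam] subspace_diff[OF subspace_weight_space] by blast
    ultimately have "?l \<in> lineality k" using mem_lineality_iff[OF k_ge] by blast
    moreover have "w' = (\<Sum>S\<in>\<S>. d S *\<^sub>R w S) + ?l" by simp
    ultimately show "w' \<in> {(\<Sum>S\<in>\<S>. c S *\<^sub>R w S) + l | c l. (\<forall>S\<in>\<S>. 0 < c S) \<and> l \<in> lineality k}"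
      using d by blast
  next
    fix w' assume "w' \<in> {(\<Sum>S\<in>\<S>. c S *\<^sub>R w S) + l | c l. (\<forall>S\<in>\<S>. 0 < c S) \<and> l \<in> lineality k}"
    then obtain c l where c: "\<And>S. S \<in> \<S> \<Longrightarrow> 0 < c S" and l: "l \<in> lineality k"
      and w': "w' = (\<Sum>S\<in>\<S>. c S *\<^sub>R w S) + l" by blast
    have "l \<in> weight_space k" using l by (simp add: lineality_def)
    then have "w' \<in> weight_space k"
      unfolding w' using combination_weight_space[OF fam] subspace_add[OF subspace_weight_space] by blast
    moreover have "tie_set ?V (weight_fun w') = tie_set ?V (weight_fun ?w0)"
      unfolding w' tie_set_sum_weights[OF fam] using tie_set_combination[of \<S> c l] fam c l by (simp add: fun_eq_iff)
    ultimately show "w' \<in> {w' \<in> weight_space k. induced_subdivision k w' = induced_subdivision k ?w0}"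
      by (simp add: induced_eq)
  qed
  then show ?thesis
    unfolding secondary_cone_def split_cone_def
    using closure_positive_combinations[OF subspace_lineality fin] by simp
qed

text \<open>Sets up the exchange lemma: \<open>nocut\<close> comes from
  \<open>no_split_of_edge\<close>, and \<open>nested\<close> from
  \<open>compatible_nested\<close>.\<close>

lemma matroid_bases_chamber:
  assumes fam: "compatible_family \<S>" and \<sigma>: "sign_vector \<sigma>"
    and ne: "vertices (hypersimplex k) \<inter> chamber \<S> \<sigma> \<noteq> {}"
  shows "matroid_bases {A. card A = k \<and> char_vec A \<in> chamber \<S> \<sigma>}" (is "matroid_bases ?B")
proof -
  \<comment> \<open>The signs are folded into the forms so that every constraint is a lower bound 0;
    they square to 1 and so drop out of products of two values of one form.\<close>
  define \<beta> where "\<beta> S i = \<sigma> S * a S $ i" for S i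
  have val: "sum (\<beta> S) A = \<sigma> S * (a S \<bullet> char_vec A)" for S A
    by (simp add: \<beta>_def inner_char_vec sum_distrib_left)
  have sq: "\<sigma> S * \<sigma> S = 1" for S
  proof -
    have "\<sigma> S = 1 \<or> \<sigma> S = - 1" using \<sigma> by (simp add: sign_vector_def)
    then show ?thesis by auto
  qed
  have splits: "is_split (hypersimplex k) S" if "S \<in> \<S>" for S
    using fam that by (auto simp: compatible_family_def)
  have B: "A \<in> ?B \<longleftrightarrow> card A = k \<and> (\<forall>S\<in>\<S>. 0 \<le> sum (\<beta> S) A)" for A
    using char_vec_in_hypersimplex[of A] by (auto simp: chamber_def val)
  show ?thesis
    unfolding matroid_bases_def
  proof (intro conjI ballI)
    show "?B \<noteq> {}" using ne by (auto simp: vertices_hypersimplex)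
    fix A B i assume A: "A \<in> ?B" and B': "B \<in> ?B" and i: "i \<in> A - B"
    have "\<exists>j\<in>B - A. card (insert j (A - {i})) = k \<and> (\<forall>S\<in>\<S>. 0 \<le> sum (\<beta> S) (insert j (A - {i})))"
    proof (rule exchange_of_nested_halfspaces)
      show "finite \<S>" using fam by (simp add: compatible_family_def)
      show "0 \<le> sum (\<beta> S) A * sum (\<beta> S) (insert j (A - {i}))"
        if "S \<in> \<S>" "card A = k" "i \<in> A" "j \<notin> A" for S A i j
      proof -
        have "sum (\<beta> S) A * sum (\<beta> S) (insert j (A - {i})) =
            (\<sigma> S * \<sigma> S) * ((a S \<bullet> char_vec A) * (a S \<bullet> char_vec (insert j (A - {i}))))"
          unfolding val by (simp only: mult_ac)
        then show ?thesis
          using no_split_of_edge[OF normal_vertices[OF splits[OF that(1)]] that(2-4)] by (simp add: sq)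
      qed
      show "\<exists>s t. s \<noteq> 0 \<and> t \<noteq> 0 \<and> (\<forall>A. card A = k \<longrightarrow> 0 \<le> s * sum (\<beta> S) A + t * sum (\<beta> T) A)"
        if ST: "S \<in> \<S>" "T \<in> \<S>" "S \<noteq> T" for S T
      proof -
        have "compatible S T" using fam ST by (auto simp: compatible_family_def pairwise_def)
        then obtain s t where st: "s \<noteq> 0" "t \<noteq> 0"
            "\<And>x. x \<in> hypersimplex k \<Longrightarrow> 0 \<le> s * (a S \<bullet> x) + t * (a T \<bullet> x)"
          using compatible_nested[of S T] splits ST by blast
        have "0 \<le> (s * \<sigma> S) * sum (\<beta> S) A + (t * \<sigma> T) * sum (\<beta> T) A" if "card A = k" for A
        proof -
          have "(s * \<sigma> S) * sum (\<beta> S) A + (t * \<sigma> T) * sum (\<beta> T) A =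
              s * (\<sigma> S * \<sigma> S) * (a S \<bullet> char_vec A) + t * (\<sigma> T * \<sigma> T) * (a T \<bullet> char_vec A)"
            unfolding val by (simp only: mult_ac)
          then show ?thesis
            using st(3)[of "char_vec A"] char_vec_in_hypersimplex[of A] that by (simp add: sq)
        qed
        moreover have "s * \<sigma> S \<noteq> 0" "t * \<sigma> T \<noteq> 0" using st sq[of S] sq[of T] by auto
        ultimately show ?thesis by blast
      qed
    qed (use A B' i B in auto)
    then show "\<exists>j\<in>B - A. insert j (A - {i}) \<in> ?B" unfolding B by blast
  qed
qed

text \<open>Every cell lies in a chamber and chambers are themselves cells, so a maximal cell is a
  whole chamber.\<close>

lemma matroid_subdivision_sum_weights:
  assumes fam: "compatible_family \<S>"
  shows "matroid_subdivision k (induced_subdivision k (\<Sum>S\<in>\<S>. w S))"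
proof -
  let ?V = "vertices (hypersimplex k) :: (real^'n) set"
  let ?\<Sigma> = "induced_subdivision k (\<Sum>S\<in>\<S>. w S)"
  have fin: "finite \<S>" using fam by (simp add: compatible_family_def)
  have \<Sigma>: "?\<Sigma> = (hull) convex ` {E. tie_set ?V (split_sum \<S> (\<lambda>_. 1)) E}"
    unfolding induced_subdivision_def regular_subdivision_eq[OF finite_vertices_hypersimplex]
      tie_set_sum_weights[OF fam] ..
  have chamber_mem: "convex hull (?V \<inter> chamber \<S> \<sigma>) \<in> ?\<Sigma>" if "sign_vector \<sigma>" for \<sigma>
    unfolding \<Sigma> using tie_set_chamber[OF fin _ that, of "\<lambda>_. 1"] by simp
  have cover: "hypersimplex k \<subseteq> \<Union>?\<Sigma>"
  proof
    fix x :: "real^'n" assume "x \<in> hypersimplex k"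
    then obtain \<sigma> where "sign_vector \<sigma>" "x \<in> chamber \<S> \<sigma>" using chamber_exists by blast
    then show "x \<in> \<Union>?\<Sigma>" using chamber_mem chamber_eq_convex_hull[OF fam] by blast
  qed
  have "polytopal_subdivision (hypersimplex k) ?\<Sigma>"
    using cover unfolding induced_subdivision_def
    by (rule polytopal_subdivision_regular_subdivision[OF convex_hypersimplex finite_vertices_hypersimplex])
  moreover have "matroid_polytope C" if C: "C \<in> maximal_cells ?\<Sigma>" for C
  proof -
    have CS: "C \<in> ?\<Sigma>" and Cmax: "\<And>D. D \<in> ?\<Sigma> \<Longrightarrow> C \<subseteq> D \<Longrightarrow> D = C"
      using C by (auto simp: maximal_cells_def)
    obtain E where E: "tie_set ?V (split_sum \<S> (\<lambda>_. 1)) E" "C = convex hull E"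
      using CS unfolding \<Sigma> by blast
    obtain \<sigma> where \<sigma>: "sign_vector \<sigma>" "E \<subseteq> chamber \<S> \<sigma>"
      using tie_set_within_chamber[OF fam _ E(1)] by auto
    have "C \<subseteq> convex hull (?V \<inter> chamber \<S> \<sigma>)"
      unfolding E(2) using \<sigma>(2) tie_set_subset[OF E(1)] by (intro hull_mono) blast
    then have C_eq: "C = convex hull (?V \<inter> chamber \<S> \<sigma>)"
      using Cmax[OF chamber_mem[OF \<sigma>(1)]] by simp
    \<comment> \<open>Excludes the empty cell, which is not maximal because the polytope has a
      vertex.\<close>
    obtain A :: "'n set" where "card A = k"
      using obtain_subset_with_card_n[OF k_le] by blast
    then have "char_vec A \<in> \<Union>?\<Sigma>" using char_vec_in_hypersimplex[of A] cover by blast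
    then have "C \<noteq> {}" using Cmax by blast
    then have ne: "?V \<inter> chamber \<S> \<sigma> \<noteq> {}" using C_eq by auto
    have "?V \<inter> chamber \<S> \<sigma> = char_vec ` {A. card A = k \<and> char_vec A \<in> chamber \<S> \<sigma>}"
      by (auto simp: vertices_hypersimplex)
    then show ?thesis
      unfolding matroid_polytope_def using C_eq matroid_bases_chamber[OF fam \<sigma>(1) ne] by metis
  qed
  ultimately show ?thesis by (simp add: matroid_subdivision_def)
qed

text \<open>The fan is generated by the split weights projected to the orthogonal complement of the
  lineality space, where uniqueness modulo lineality becomes \<open>unique\<close> of
  \<open>simplicial_family\<close>.\<close>

lemma split_cells_subcomplex:
  shows "polytopal_subcomplex (split_cell k w ` split_complex (hypersimplex k)) (pre_grassmannian k)"
    and "\<And>\<S> \<T>. \<S> \<in> split_complex (hypersimplex k) \<Longrightarrow> \<T> \<in> split_complex (hypersimplex k) \<Longrightarrow>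
      split_cell k w \<S> \<subseteq> split_cell k w \<T> \<longleftrightarrow> \<S> \<subseteq> \<T>"
proof -
  let ?K = "split_complex (hypersimplex k) :: (real^'n) set set set set"
  let ?L = "lineality k :: (real^('n set)) set"
  obtain p :: "real^('n set) \<Rightarrow> real^('n set)" where p: "linear p" "\<And>x. p x \<in> ?L\<^sup>\<bottom>" "\<And>x. x - p x \<in> ?L"
    "\<And>x. x \<in> ?L\<^sup>\<bottom> \<Longrightarrow> p x = x" "\<And>x. x \<in> ?L \<Longrightarrow> p x = 0"
    using exists_orthogonal_projection[OF subspace_lineality] by blast
  have p_sum: "p (\<Sum>S\<in>\<S>. c S *\<^sub>R w S) = (\<Sum>S\<in>\<S>. c S *\<^sub>R p (w S))" for \<S> c
    by (simp add: linear_sum[OF p(1)] linear_scale[OF p(1)])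
  interpret simplicial_family ?K "\<lambda>S. p (w S)"
  proof
    have "?K \<subseteq> Pow {S. is_split (hypersimplex k) S}" by (auto simp: split_complex_def)
    then show "finite ?K"
      using finite_splits[OF finite_vertices_hypersimplex] by (meson finite_Pow_iff finite_subset)
    show "finite \<S>" if "\<S> \<in> ?K" for \<S>
      using that unfolding split_complex_iff by (simp add: compatible_family_def)
    show "\<T> \<in> ?K" if "\<S> \<in> ?K" "\<T> \<subseteq> \<S>" for \<S> \<T>
      using that compatible_family_subset unfolding split_complex_iff by blast
    show "S \<in> \<T> \<and> d S = c S"
      if "\<S> \<in> ?K" "\<T> \<in> ?K" "\<And>S. S \<in> \<S> \<Longrightarrow> 0 \<le> c S" "\<And>S. S \<in> \<T> \<Longrightarrow> 0 \<le> d S"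
        "(\<Sum>S\<in>\<S>. c S *\<^sub>R p (w S)) = (\<Sum>S\<in>\<T>. d S *\<^sub>R p (w S))" "S \<in> \<S>" "0 < c S"
      for \<S> \<T> c d S
    proof -
      let ?d = "(\<Sum>S\<in>\<S>. c S *\<^sub>R w S) - (\<Sum>S\<in>\<T>. d S *\<^sub>R w S)"
      have "p ?d = 0" using that(5) by (simp add: linear_diff[OF p(1)] p_sum)
      then have "?d \<in> ?L" using p(3)[of ?d] by simp
      then show ?thesis
        using combination_unique_mod_lineality that(1-4,6,7) unfolding split_complex_iff by blast
    qed
  qed
  have cell: "split_cell k w \<S> = cone_of \<S> \<inter> sphere 0 1" for \<S>
  proof -
    have "split_cone k w \<S> \<inter> ?L\<^sup>\<bottom> = convex_cone hull (p ` w ` \<S>)"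
      unfolding split_cone_def by (rule cone_plus_subspace_Int_orthogonal[OF subspace_lineality p])
    then show ?thesis
      unfolding split_cell_def spherical_cell_def cone_of_def image_image by simp
  qed
  show "split_cell k w \<S> \<subseteq> split_cell k w \<T> \<longleftrightarrow> \<S> \<subseteq> \<T>" if "\<S> \<in> ?K" "\<T> \<in> ?K" for \<S> \<T>
    unfolding cell by (rule sphere_subset_iff[OF that])
  have "spherical_polytopal_complex (split_cell k w ` ?K)"
    unfolding spherical_polytopal_complex_def
    by (intro exI[of _ "cone_of ` ?K"] conjI pointed_fan_cones) (simp add: cell image_image)
  moreover have "split_cell k w \<S> \<in> pre_grassmannian k" if "\<S> \<in> ?K" for \<S>
  proof -
    have fam: "compatible_family \<S>" using that unfolding split_complex_iff .
    have mem: "(\<Sum>S\<in>\<S>. w S) \<in> weight_space k"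
      using combination_weight_space[OF fam, of "\<lambda>_. 1"] by simp
    then have "secondary_cone k (\<Sum>S\<in>\<S>. w S) \<in> pre_grassmannian_fan k"
      unfolding pre_grassmannian_fan_def secondary_fan_def
      using matroid_subdivision_sum_weights[OF fam] by blast
    then show ?thesis
      unfolding pre_grassmannian_def split_cell_def secondary_cone_sum_weights[OF fam] by blast
  qed
  ultimately show "polytopal_subcomplex (split_cell k w ` ?K) (pre_grassmannian k)"
    unfolding polytopal_subcomplex_def by blast
qed

end

theorem theorem7p8:
  fixes k :: nat
    and w :: "(real^'n) set set \<Rightarrow> real^('n::finite set)"
  assumes "1 \<le> k" and "k \<le> CARD('n) - 1"
    and "\<And>S. is_split (hypersimplex k) S \<Longrightarrow>
           w S \<in> weight_space k \<and> split_weight (hypersimplex k) S (weight_fun (w S))"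
  shows "polytopal_subcomplex (split_cell k w ` split_complex (hypersimplex k)) (pre_grassmannian k) \<and>
         (\<forall>\<S>\<in>split_complex (hypersimplex k). \<forall>\<T>\<in>split_complex (hypersimplex k).
            split_cell k w \<S> \<subseteq> split_cell k w \<T> \<longleftrightarrow> \<S> \<subseteq> \<T>) \<and>
         (\<forall>\<S>\<in>split_complex (hypersimplex k).
            \<forall>C\<in>maximal_cells (induced_subdivision k (\<Sum>S\<in>\<S>. w S)). matroid_polytope C)"
proof -
  let ?P = "hypersimplex k :: (real^'n) set"
  let ?Q = "\<lambda>S b. maximal_cells S = {?P \<inter> {x. 0 \<le> b \<bullet> x}, ?P \<inter> {x. b \<bullet> x \<le> 0}} \<and>
    (\<exists>x\<in>?P. 0 < b \<bullet> x) \<and> (\<exists>x\<in>?P. b \<bullet> x < 0) \<and>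
    vertices (?P \<inter> {x. b \<bullet> x = 0}) \<subseteq> vertices ?P \<and>
    span (?P \<inter> {x. b \<bullet> x = 0}) = {x. b \<bullet> x = 0} \<and> split_hyperplane S = {x. b \<bullet> x = 0} \<and>
    (\<forall>v\<in>vertices ?P. weight_fun (w S) v = max 0 (b \<bullet> v))"
  have "\<exists>b. ?Q S b" if "is_split ?P S" for S
  proof -
    have "split_weight ?P S (weight_fun (w S))" using assms(3)[OF that] by blast
    from split_weight_normal[OF convex_hypersimplex inner_one_hypersimplex[OF assms(1)] that this]
    show ?thesis by metis
  qed
  then have "\<forall>S. \<exists>b. is_split ?P S \<longrightarrow> ?Q S b" by blast
  from choice[OF this] obtain a where a: "\<And>S. is_split ?P S \<Longrightarrow> ?Q S (a S)" by blast
  interpret hypersimplex_splits k w a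
    by unfold_locales (use assms a in auto)
  have "matroid_polytope C"
    if "\<S> \<in> split_complex ?P" "C \<in> maximal_cells (induced_subdivision k (\<Sum>S\<in>\<S>. w S))" for \<S> C
    using matroid_subdivision_sum_weights[of \<S>] that
    unfolding split_complex_iff matroid_subdivision_def by blast
  then show ?thesis
    using split_cells_subcomplex by blast
qed

end
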